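(* Let $n\ge m\ge 2$ with $n\ge 3$. The cut complex $\Delta_4(G(m,n))$ is homotopy equivalent to a wedge of spheres of dimension $mn-5$, and hence its reduced homology is concentrated in dimension $mn-5$. The number of spheres (the Betti number) is \[ \binom{mn-1}{3}-\begin{cases} 11n-23, &\text{if } n> m=2,\\ 19mn-28(m+n) +33, &\text{if } n\ge m\ge 3. \end{cases} \]
   Context: The grid graph $G(m,n)$ has vertex set $\{(i,j):1\le i\le m,1\le j\le n\}$, with edges $\{(i,j),(i+1,j)\}$ and $\{(i,j),(i,j+1)\}$ whenever both endpoints are vertices. For a graph $G=(V,E)$ with $|V|=N$ and $k\ge 2$, the $k$-cut complex $\Delta_k(G)$ is the simplicial complex on $V$ whose facets are the subsets $F\subseteq V$ with $|F|=N-k$ such that the induced subgraph $G[V\setminus F]$ is disconnected. A wedge of zero spheres means a contractible space. *)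

theory Defs
  imports
    "HOL-Homology.Homology"
    "HOL-Library.Extended_Nat"
    "Graph_Theory.Digraph_Component"
begin

text \<open>An undirected graph is a symmetric loopfree digraph (locale \<open>pair_graph\<close>): each edge of the
  grid is represented by its two orientations.\<close>

definition grid_graph :: "nat \<Rightarrow> nat \<Rightarrow> (nat \<times> nat) pair_pre_digraph" where
  "grid_graph m n =
     (let V = {1..m} \<times> {1..n};
          E = {((i, j), (i + 1, j)) | i j. (i, j) \<in> V \<and> (i + 1, j) \<in> V}
            \<union> {((i, j), (i, j + 1)) | i j. (i, j) \<in> V \<and> (i, j + 1) \<in> V}
      in \<lparr>pverts = V, parcs = E \<union> E\<inverse>\<rparr>)"

lemma pair_graph_grid_graph: "pair_graph (grid_graph m n)"
proof
  show "finite (parcs (grid_graph m n))"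
    by (rule finite_subset[of _ "({1..m} \<times> {1..n}) \<times> ({1..m} \<times> {1..n})"])
       (auto simp: grid_graph_def Let_def)
  show "symmetric (with_proj (grid_graph m n))"
    by (auto simp: grid_graph_def Let_def symmetric_def arcs_ends_def arc_to_ends_def sym_def)
qed (auto simp: grid_graph_def Let_def)

text \<open>The library's \<open>connected\<close> is false for the empty graph, so the facets are the
  intended ones for \<open>k \<ge> 1\<close>.  Writing \<open>card F + k = card V\<close> instead of
  \<open>card F = card V - k\<close> avoids truncated subtraction when \<open>k > card V\<close>.\<close>

definition cut_facets :: "nat \<Rightarrow> ('a, 'b) pre_digraph \<Rightarrow> 'a set set" where
  "cut_facets k G = {F. F \<subseteq> verts G \<and> card F + k = card (verts G) \<and>
     \<not> Digraph_Component.connected (induce_subgraph G (verts G - F))}"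

text \<open>An abstract simplicial complex is the set of its faces, including the empty face.\<close>

definition cut_complex :: "nat \<Rightarrow> ('a, 'b) pre_digraph \<Rightarrow> 'a set set" where
  "cut_complex k G = {S. \<exists>F \<in> cut_facets k G. S \<subseteq> F}"

text \<open>Barycentric coordinates, with the topology of pointwise convergence.  For a complex with
  finitely many vertices this is the usual geometric realization.\<close>

definition geometric_realization :: "'a set set \<Rightarrow> ('a \<Rightarrow> real) topology" where
  "geometric_realization K =
     top_of_set {x. (\<forall>v. 0 \<le> x v) \<and> {v. x v \<noteq> 0} \<in> K \<and> (\<Sum>v | x v \<noteq> 0. x v) = 1}"

text \<open>The wedge of pointed spaces \<open>(X i, p i)\<close>, \<open>i \<in> I\<close>: all the base points are identified to the
  single point \<^term>\<open>None\<close>, which is also present when \<open>I\<close> is empty, and a set is open if its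
  preimage in every summand is open.\<close>

definition wedge_in :: "('i \<Rightarrow> 'a) \<Rightarrow> 'i \<Rightarrow> 'a \<Rightarrow> ('i \<times> 'a) option" where
  "wedge_in p i x = (if x = p i then None else Some (i, x))"

definition wedge_topology ::
    "('i \<Rightarrow> 'a topology) \<Rightarrow> ('i \<Rightarrow> 'a) \<Rightarrow> 'i set \<Rightarrow> ('i \<times> 'a) option topology" where
  "wedge_topology X p I =
     topology (\<lambda>U. U \<subseteq> insert None (\<Union>i\<in>I. wedge_in p i ` topspace (X i)) \<and>
       (\<forall>i\<in>I. openin (X i) {x \<in> topspace (X i). wedge_in p i x \<in> U}))"

lemma openin_wedge_topology:
  "openin (wedge_topology X p I) U \<longleftrightarrow>
     U \<subseteq> insert None (\<Union>i\<in>I. wedge_in p i ` topspace (X i)) \<and>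
     (\<forall>i\<in>I. openin (X i) {x \<in> topspace (X i). wedge_in p i x \<in> U})"
proof -
  have "istopology (\<lambda>U. U \<subseteq> insert None (\<Union>i\<in>I. wedge_in p i ` topspace (X i)) \<and>
       (\<forall>i\<in>I. openin (X i) {x \<in> topspace (X i). wedge_in p i x \<in> U}))" (is "istopology ?L")
    unfolding istopology_def
  proof (intro conjI allI impI)
    fix S T assume S: "?L S" and T: "?L T"
    show "S \<inter> T \<subseteq> insert None (\<Union>i\<in>I. wedge_in p i ` topspace (X i))"
      using S by blast
    show "\<forall>i\<in>I. openin (X i) {x \<in> topspace (X i). wedge_in p i x \<in> S \<inter> T}"
    proof
      fix i assume "i \<in> I"
      then have "openin (X i) ({x \<in> topspace (X i). wedge_in p i x \<in> S} \<inter>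
                              {x \<in> topspace (X i). wedge_in p i x \<in> T})"
        using S T by blast
      moreover have "{x \<in> topspace (X i). wedge_in p i x \<in> S} \<inter>
          {x \<in> topspace (X i). wedge_in p i x \<in> T} =
          {x \<in> topspace (X i). wedge_in p i x \<in> S \<inter> T}"
        by blast
      ultimately show "openin (X i) {x \<in> topspace (X i). wedge_in p i x \<in> S \<inter> T}"
        by simp
    qed
  next
    fix \<K> assume K: "\<forall>S\<in>\<K>. ?L S"
    show "\<Union>\<K> \<subseteq> insert None (\<Union>i\<in>I. wedge_in p i ` topspace (X i))"
      using K by blast
    show "\<forall>i\<in>I. openin (X i) {x \<in> topspace (X i). wedge_in p i x \<in> \<Union>\<K>}"
    proof
      fix i assume "i \<in> I"
      then have "openin (X i) (\<Union>S\<in>\<K>. {x \<in> topspace (X i). wedge_in p i x \<in> S})"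
        using K by blast
      moreover have "(\<Union>S\<in>\<K>. {x \<in> topspace (X i). wedge_in p i x \<in> S}) =
          {x \<in> topspace (X i). wedge_in p i x \<in> \<Union>\<K>}"
        by blast
      ultimately show "openin (X i) {x \<in> topspace (X i). wedge_in p i x \<in> \<Union>\<K>}"
        by simp
    qed
  qed
  then show ?thesis
    by (simp add: wedge_topology_def)
qed

lemma topspace_wedge_topology:
  "topspace (wedge_topology X p I) = insert None (\<Union>i\<in>I. wedge_in p i ` topspace (X i))"
proof
  show "topspace (wedge_topology X p I) \<subseteq> insert None (\<Union>i\<in>I. wedge_in p i ` topspace (X i))"
    using openin_topspace[of "wedge_topology X p I"] by (simp only: openin_wedge_topology)
  have "openin (wedge_topology X p I) (insert None (\<Union>i\<in>I. wedge_in p i ` topspace (X i)))"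
    unfolding openin_wedge_topology
  proof (intro conjI ballI)
    fix i assume "i \<in> I"
    then have "{x \<in> topspace (X i). wedge_in p i x \<in> insert None (\<Union>i\<in>I. wedge_in p i ` topspace (X i))}
        = topspace (X i)"
      by blast
    then show "openin (X i) {x \<in> topspace (X i). wedge_in p i x \<in>
        insert None (\<Union>i\<in>I. wedge_in p i ` topspace (X i))}"
      by simp
  qed simp
  then show "insert None (\<Union>i\<in>I. wedge_in p i ` topspace (X i)) \<subseteq> topspace (wedge_topology X p I)"
    by (rule openin_subset)
qed

lemma quotient_map_wedge_topology:
  assumes "I \<noteq> {}" and p: "\<And>i. i \<in> I \<Longrightarrow> p i \<in> topspace (X i)"
  shows "quotient_map (sum_topology X I) (wedge_topology X p I) (\<lambda>(i, x). wedge_in p i x)"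
proof -
  have base: "None \<in> (\<Union>i\<in>I. wedge_in p i ` topspace (X i))"
  proof -
    obtain i where i: "i \<in> I" using assms(1) by blast
    have "None = wedge_in p i (p i)" by (simp add: wedge_in_def)
    then show ?thesis using i p[OF i] by blast
  qed
  have im: "(\<lambda>(i, x). wedge_in p i x) ` topspace (sum_topology X I) = topspace (wedge_topology X p I)"
  proof -
    have "(\<lambda>(i, x). wedge_in p i x) ` topspace (sum_topology X I) =
        (\<Union>i\<in>I. wedge_in p i ` topspace (X i))"
      by (force simp: topspace_sum_topology)
    then show ?thesis using base by (auto simp: topspace_wedge_topology)
  qed
  have "openin (sum_topology X I)
          {z \<in> topspace (sum_topology X I). (case z of (i, x) \<Rightarrow> wedge_in p i x) \<in> U} \<longleftrightarrow>
        openin (wedge_topology X p I) U" if U: "U \<subseteq> topspace (wedge_topology X p I)" for U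
  proof -
    have "{x. (i, x) \<in> {z \<in> topspace (sum_topology X I). (case z of (i, x) \<Rightarrow> wedge_in p i x) \<in> U}}
        = {x \<in> topspace (X i). wedge_in p i x \<in> U}" if "i \<in> I" for i
      using that by (auto simp: topspace_sum_topology)
    moreover have "{z \<in> topspace (sum_topology X I). (case z of (i, x) \<Rightarrow> wedge_in p i x) \<in> U}
        \<subseteq> Sigma I (topspace \<circ> X)"
      by (auto simp: topspace_sum_topology)
    ultimately show ?thesis
      using U by (simp add: openin_sum_topology openin_wedge_topology topspace_wedge_topology)
  qed
  then show ?thesis
    unfolding quotient_map_def using im by blast
qed

definition sphere_base :: "nat \<Rightarrow> real" where
  "sphere_base = (\<lambda>i. if i = 0 then 1 else 0)"

lemma sphere_base_in_nsphere: "sphere_base \<in> topspace (nsphere d)"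
  by (auto simp: nsphere sphere_base_def if_distrib[of "\<lambda>t. t ^ 2"] cong: if_cong)

text \<open>A wedge of \<open>b\<close> copies of the \<open>d\<close>-sphere; a single point if \<open>b = 0\<close>.\<close>

definition wedge_of_spheres :: "nat \<Rightarrow> nat \<Rightarrow> (nat \<times> (nat \<Rightarrow> real)) option topology" where
  "wedge_of_spheres b d = wedge_topology (\<lambda>_. nsphere d) (\<lambda>_. sphere_base) {..<b}"

text \<open>The (torsion-free) rank of an abelian group, in multiplicative notation: the supremum of
  the sizes of its \<open>\<int>\<close>-linearly independent finite subsets.\<close>

definition int_independent :: "('a, 'c) monoid_scheme \<Rightarrow> 'a set \<Rightarrow> bool" where
  "int_independent G B \<longleftrightarrow> finite B \<and> B \<subseteq> carrier G \<and>
     (\<forall>c :: 'a \<Rightarrow> int. (\<Otimes>\<^bsub>G\<^esub>x\<in>B. x [^]\<^bsub>G\<^esub> c x) = \<one>\<^bsub>G\<^esub> \<longrightarrow> (\<forall>x\<in>B. c x = 0))"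

definition abelian_rank :: "('a, 'c) monoid_scheme \<Rightarrow> enat" where
  "abelian_rank G = (SUP B \<in> {B. int_independent G B}. enat (card B))"

definition reduced_betti_number :: "int \<Rightarrow> 'a topology \<Rightarrow> enat" where
  "reduced_betti_number p X = abelian_rank (reduced_homology_group p X)"

end

theory Submission
  imports Defs "HOL-Analysis.Abstract_Topological_Spaces"
begin

text \<open>Let \<open>V\<close> be the grid, \<open>v = (1, 1)\<close>, and call a connected 4-set a tetromino.  The complex consists of
  the complements of the sets containing a 4-set that is not a tetromino, so its homotopy type is
  governed by the 4-sets through \<open>v\<close>: everything whose complement minus \<open>v\<close> still contains a disconnected
  4-set forms a cone over \<open>v\<close>.  Each tetromino \<open>T\<close> avoiding \<open>v\<close> leaves a ridge \<open>V - (T \<union> {v})\<close> outside the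
  cone.  One deletes a cell from \<open>T\<close> so that the remaining three cells are disconnected from \<open>v\<close> and
  all their other completions to a tetromino come later in a fixed ranking (squares, then skew
  tetrominoes, then all others); this pairs the ridges with facets so that they can be collapsed
  one after another.  Hence the complex is a contractible subcomplex with
  \<open>binomial (mn - 1) 3 - #tetrominoes\<close> facets of dimension \<open>mn - 5\<close> attached.  Contracting the subcomplex
  by homotopy extension yields a wedge of spheres, and attaching one facet at a time computes the
  homology by excision and the long exact sequence.\<close>

section \<open>Realizations of finite complexes and collapses\<close>

text \<open>What shapes the pairing is that a deleted cell should be recoverable from the three
  others. The ridge of \<open>T\<close> lies in the facet paired with \<open>T'\<close> exactly when
  the three cells kept from \<open>T'\<close> lie in \<open>T\<close>, so every competing completion
  has to be ordered away. For 14 of the 19 tetrominoes up to translation, some cell is the only one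
  that joins the other three. A skew tetromino without an inner cell, a domino and a cell diagonal
  to it, can also be completed to an L; a square without a cell, a bent tromino, also to skew, L and
  T shapes. Ranking squares and then skew shapes first removes both conflicts. In a square the
  deleted cell must be the one nearest to \<open>v\<close>: after any other deletion, some position
  of the square would let \<open>v\<close> be the missing neighbour. Recoverability also gives the
  count: of the \<open>binomial (mn - 1) 3\<close> 4-sets through \<open>v\<close>, the tetrominoes
  among them and one 4-set for each tetromino avoiding \<open>v\<close> are lost.\<close>

definition realization_set :: "'a set set \<Rightarrow> ('a \<Rightarrow> real) set" where
  "realization_set K = {x. (\<forall>v. 0 \<le> x v) \<and> {v. x v \<noteq> 0} \<in> K \<and> (\<Sum>v | x v \<noteq> 0. x v) = 1}"

definition complex_on :: "'a set \<Rightarrow> 'a set set \<Rightarrow> bool" where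
  "complex_on V K \<longleftrightarrow> finite V \<and> K \<subseteq> Pow V \<and> (\<forall>S\<in>K. Pow S \<subseteq> K)"

lemma geometric_realization_eq: "geometric_realization K = top_of_set (realization_set K)"
  by (simp add: geometric_realization_def realization_set_def)

lemma complex_onD:
  assumes "complex_on V K"
  shows "finite V" "S \<in> K \<Longrightarrow> S \<subseteq> V" "S \<in> K \<Longrightarrow> finite S" "S \<in> K \<Longrightarrow> T \<subseteq> S \<Longrightarrow> T \<in> K"
  using assms by (auto simp: complex_on_def dest: finite_subset)

lemma realization_set_iff:
  assumes "complex_on V K"
  shows "x \<in> realization_set K \<longleftrightarrow> (\<forall>v. 0 \<le> x v) \<and> {v. x v \<noteq> 0} \<in> K \<and> sum x V = 1"
proof -
  have "(\<Sum>v | x v \<noteq> 0. x v) = sum x V" if "{v. x v \<noteq> 0} \<in> K"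
    by (rule sum.mono_neutral_left) (use that assms in \<open>auto simp: complex_on_def\<close>)
  then show ?thesis unfolding realization_set_def by auto
qed

lemma realization_set_mono: "K \<subseteq> L \<Longrightarrow> realization_set K \<subseteq> realization_set L"
  by (auto simp: realization_set_def)

lemma realization_set_subset_iff: "K \<subseteq> L \<Longrightarrow> x \<in> realization_set K \<longleftrightarrow> x \<in> realization_set L \<and> {v. x v \<noteq> 0} \<in> K"
  by (auto simp: realization_set_def)

lemma realization_set_combine:
  assumes K: "complex_on V K" and "\<sigma> \<in> K" "{v. x v \<noteq> 0} \<subseteq> \<sigma>" "{v. y v \<noteq> 0} \<subseteq> \<sigma>"
    and "\<And>v. 0 \<le> x v" "\<And>v. 0 \<le> y v" "sum x V = 1" "sum y V = 1" "0 \<le> t" "t \<le> (1::real)"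
  shows "(\<lambda>v. (1-t) * x v + t * y v) \<in> realization_set K"
  unfolding realization_set_iff[OF K]
proof (intro conjI allI)
  show "0 \<le> (1-t) * x v + t * y v" for v using assms by simp
  show "{v. (1-t) * x v + t * y v \<noteq> 0} \<in> K"
  proof (rule complex_onD(4)[OF K \<open>\<sigma> \<in> K\<close>])
    have "x v = 0" "y v = 0" if "v \<notin> \<sigma>" for v using assms(3,4) that by blast+
    then show "{v. (1-t) * x v + t * y v \<noteq> 0} \<subseteq> \<sigma>" by force
  qed
  show "(\<Sum>v\<in>V. (1-t) * x v + t * y v) = 1"
    using assms by (simp add: sum.distrib flip: sum_distrib_left)
qed

section \<open>Straight-line homotopies and the smallest coordinate on a face\<close>

lemma continuous_on_Min_image:
  fixes f :: "'b::topological_space \<Rightarrow> 'a \<Rightarrow> real"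
  assumes "finite R" "R \<noteq> {}" "\<And>v. v \<in> R \<Longrightarrow> continuous_on S (\<lambda>p. f p v)"
  shows "continuous_on S (\<lambda>p. Min (f p ` R))"
  using assms
proof (induction R rule: finite_ne_induct)
  case (insert v R)
  then have "(\<lambda>p. Min (f p ` insert v R)) = (\<lambda>p. min (f p v) (Min (f p ` R)))"
    by (auto simp: Min_insert)
  then show ?case using insert by (simp add: continuous_on_min)
qed auto

lemma continuous_on_fun_coord:
  fixes f :: "'b::topological_space \<Rightarrow> 'a \<Rightarrow> real"
  shows "continuous_on S f \<Longrightarrow> continuous_on S (\<lambda>p. f p v)"
  by (rule continuous_on_product_then_coordinatewise)

text \<open>The collapses, cones and punctures below all move points along straight segments, so
  only the continuity of the end map and the position of the segments remain to be checked.\<close>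

lemma segment_homotopy:
  fixes X :: "('a \<Rightarrow> real) set"
  assumes r: "continuous_on X r"
    and Y: "\<And>x t. x \<in> X \<Longrightarrow> 0 \<le> t \<Longrightarrow> t \<le> 1 \<Longrightarrow> (\<lambda>v. (1-t) * x v + t * r x v) \<in> Y"
  shows "homotopic_with_canon (\<lambda>_. True) X Y id r"
proof -
  let ?h = "\<lambda>p. \<lambda>v. (1 - fst p) * snd p v + fst p * r (snd p) v"
  have "continuous_on ({0..1} \<times> X) ?h"
    by (intro continuous_on_coordinatewise_then_product continuous_on_add continuous_on_mult
        continuous_on_diff continuous_on_const continuous_on_fst continuous_on_id
        continuous_on_fun_coord[OF continuous_on_snd] continuous_on_fun_coord[OF continuous_on_compose2[OF r]]
        continuous_on_snd) auto
  moreover have "?h \<in> {0..1} \<times> X \<rightarrow> Y"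
    using Y by (auto split: prod.splits)
  ultimately show ?thesis
    unfolding homotopic_with_def
    by (intro exI[of _ ?h]) (auto simp: image_subset_iff_funcset)
qed

definition face_min :: "'a set \<Rightarrow> ('a \<Rightarrow> real) \<Rightarrow> real" where
  "face_min R x = Min (x ` R)"

lemma continuous_on_face_min:
  assumes "finite R" "R \<noteq> {}" "continuous_on S f"
  shows "continuous_on S (\<lambda>p. face_min R (f p))"
  unfolding face_min_def using assms by (intro continuous_on_Min_image continuous_on_fun_coord)

lemma face_min_le: "finite R \<Longrightarrow> v \<in> R \<Longrightarrow> face_min R x \<le> x v"
  by (simp add: face_min_def)

lemma face_min_attained:
  assumes "finite R" "R \<noteq> {}"
  shows "\<exists>v\<in>R. x v = face_min R x"
proof -
  have "face_min R x \<in> x ` R" unfolding face_min_def using assms by (intro Min_in) auto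
  then show ?thesis by auto
qed

lemma face_min_nonneg: "finite R \<Longrightarrow> R \<noteq> {} \<Longrightarrow> (\<And>v. 0 \<le> x v) \<Longrightarrow> 0 \<le> face_min R x"
  by (simp add: face_min_def)

lemma face_min_eq_0_iff:
  assumes "finite R" "R \<noteq> {}" "\<And>v. 0 \<le> x v"
  shows "face_min R x = 0 \<longleftrightarrow> \<not> R \<subseteq> {v. x v \<noteq> 0}"
proof
  assume "face_min R x = 0"
  then show "\<not> R \<subseteq> {v. x v \<noteq> 0}" using face_min_attained[OF assms(1,2), of x] by auto
next
  assume "\<not> R \<subseteq> {v. x v \<noteq> 0}"
  then obtain v where "v \<in> R" "x v = 0" by auto
  then show "face_min R x = 0"
    using face_min_le[OF assms(1), of v x] face_min_nonneg[OF assms(1,2), of x] assms(3) by simp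
qed

text \<open>Pushing points away from the free face \<open>R\<close> towards \<open>u\<close> empties
  the two open faces \<open>R\<close> and \<open>insert u R\<close> and fixes everything else;
  freeness confines each moved point to the simplex \<open>insert u R\<close>.\<close>

lemma collapse_homotopy_equivalent:
  assumes K: "complex_on V K" and R: "u \<notin> R" "R \<noteq> {}" "insert u R \<in> K"
    and free: "\<And>S. S \<in> K \<Longrightarrow> R \<subseteq> S \<Longrightarrow> S = R \<or> S = insert u R"
  shows "top_of_set (realization_set K) homotopy_equivalent_space
    top_of_set (realization_set (K - {R, insert u R}))"
proof -
  note fin = complex_onD(1)[OF K]
  have RV: "R \<subseteq> V" "u \<in> V" using R complex_onD(2)[OF K] by auto
  moreover have "finite R" using fin RV(1) finite_subset by blast
  ultimately have RV: "R \<subseteq> V" "u \<in> V" "finite R" by auto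
  define m where "m = face_min R"
  \<comment> \<open>Each coordinate in \<open>R\<close> loses the smallest one, \<open>m x\<close>,
    and \<open>u\<close> receives the total loss \<open>card R * m x\<close>: the sum stays 1 and
    some coordinate in \<open>R\<close> becomes 0.\<close>
  define r where "r x = (\<lambda>v. x v - (if v \<in> R then m x else 0)
      + (if v = u then card R * m x else 0))" for x :: "'a \<Rightarrow> real"
  have mpos: "0 \<le> m x" if "x \<in> realization_set K" for x
    unfolding m_def using that RV R(2) by (auto simp: realization_set_def intro: face_min_nonneg)
  have supp: "{v. x v \<noteq> 0} = R \<or> {v. x v \<noteq> 0} = insert u R"
    if "x \<in> realization_set K" "m x \<noteq> 0" for x
    using that face_min_eq_0_iff[of R x] RV R(2) free[of "{v. x v \<noteq> 0}"]
    by (auto simp: realization_set_def m_def)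
  have r0: "r x = x" if "m x = 0" for x using that by (auto simp: r_def)
  have r_nonneg: "0 \<le> r x v" if "x \<in> realization_set K" for x v
    using mpos[OF that] face_min_le[of R v x] RV that R
    by (auto simp: r_def m_def realization_set_def)
  have r_sum: "sum (r x) V = 1" if "x \<in> realization_set K" for x
  proof -
    have "sum (r x) V = sum x V - (\<Sum>v\<in>V. if v \<in> R then m x else 0) + (\<Sum>v\<in>V. if v = u then card R * m x else 0)"
      by (simp add: r_def sum.distrib sum_subtractf)
    also have "\<dots> = 1"
      using that fin RV by (simp add: realization_set_iff[OF K] Int_absorb1 flip: sum.inter_restrict)
    finally show ?thesis .
  qed
  have r_supp: "{v. r x v \<noteq> 0} \<subseteq> insert u R" if "x \<in> realization_set K" "m x \<noteq> 0" for x
    using supp[OF that] by (auto simp: r_def split: if_splits)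
  have r_in: "r x \<in> realization_set (K - {R, insert u R})" if "x \<in> realization_set K" for x
  proof (cases "m x = 0")
    case True
    then have "\<not> R \<subseteq> {v. x v \<noteq> 0}"
      using face_min_eq_0_iff[of R x] RV R(2) that by (auto simp: realization_set_def m_def)
    then show ?thesis using that r0[OF True] by (auto simp: realization_set_def)
  next
    case False
    obtain w where "w \<in> R" "x w = m x" using face_min_attained[of R x] RV R(2) by (auto simp: m_def)
    then have "r x w = 0" using R by (auto simp: r_def)
    then have "{v. r x v \<noteq> 0} \<noteq> R \<and> {v. r x v \<noteq> 0} \<noteq> insert u R" using \<open>w \<in> R\<close> by blast
    moreover have "{v. r x v \<noteq> 0} \<in> K" using complex_onD(4)[OF K R(3) r_supp[OF that False]] .
    ultimately show ?thesis
      using r_nonneg[OF that] r_sum[OF that] realization_set_subset_iff[of "K - {R, insert u R}" K]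
      by (auto simp: realization_set_iff[OF K])
  qed
  have cm: "continuous_on X m" for X
    unfolding m_def using RV R by (intro continuous_on_face_min continuous_on_id) auto
  have "continuous_on X (\<lambda>x. if P then c * m x else 0)" "continuous_on X (\<lambda>x. if P then m x else 0)"
    for X P and c :: real
    by (cases P; simp add: cm continuous_on_mult)+
  then have cont: "continuous_on X r" for X
    unfolding r_def
    by (intro continuous_on_coordinatewise_then_product continuous_on_add continuous_on_diff
        continuous_on_fun_coord[OF continuous_on_id])
  have "homotopic_with_canon (\<lambda>_. True) (realization_set K) (realization_set K) id r"
  proof (rule segment_homotopy[OF cont])
    fix x t assume x: "x \<in> realization_set K" and t: "0 \<le> t" "t \<le> (1::real)"
    show "(\<lambda>v. (1-t) * x v + t * r x v) \<in> realization_set K"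
    proof (cases "m x = 0")
      case True then show ?thesis using x r0[OF True] by (simp flip: distrib_right)
    next
      case False
      show ?thesis
        by (rule realization_set_combine[OF K R(3)])
          (use supp[OF x False] r_supp[OF x False] r_nonneg[OF x] r_sum[OF x] x t in \<open>auto simp: realization_set_iff[OF K]\<close>)
    qed
  qed
  moreover have "retraction_maps (top_of_set (realization_set K)) (top_of_set (realization_set (K - {R, insert u R}))) r id"
    unfolding retraction_maps_def
  proof (intro conjI ballI)
    show "continuous_map (top_of_set (realization_set K)) (top_of_set (realization_set (K - {R, insert u R}))) r"
      using cont r_in by auto
    show "continuous_map (top_of_set (realization_set (K - {R, insert u R}))) (top_of_set (realization_set K)) id"
      using realization_set_mono[of "K - {R, insert u R}" K] by auto
    fix x assume x: "x \<in> topspace (top_of_set (realization_set (K - {R, insert u R})))"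
    then have "x \<in> realization_set K" using realization_set_mono[of "K - {R, insert u R}" K] by auto
    then have "m x = 0" using supp[of x] x by (auto simp: realization_set_def)
    then show "r (id x) = x" by (simp add: r0)
  qed
  ultimately show ?thesis
    using deformation_retract_imp_homotopy_equivalent_space homotopic_with_symD by blast
qed

lemma cone_contractible:
  assumes K: "complex_on V K" and a: "\<And>S. S \<in> K \<Longrightarrow> insert a S \<in> K"
  shows "contractible_space (top_of_set (realization_set K))"
  unfolding contractible_space_def
proof (intro exI segment_homotopy)
  let ?a = "\<lambda>v. if v = a then 1 else (0::real)"
  fix x t assume x: "x \<in> realization_set K" and t: "0 \<le> t" "t \<le> (1::real)"
  then have s: "insert a {v. x v \<noteq> 0} \<in> K" using a by (simp add: realization_set_def)
  have "a \<in> V" "finite V" using complex_onD[OF K] s by auto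
  then have "sum ?a V = 1" by simp
  then show "(\<lambda>v. (1-t) * x v + t * ?a v) \<in> realization_set K"
    by (intro realization_set_combine[OF K s]) (use x t in \<open>auto simp: realization_set_iff[OF K]\<close>)
qed auto

section \<open>Puncturing a maximal simplex\<close>

definition barycenter :: "'a set \<Rightarrow> 'a \<Rightarrow> real" where
  "barycenter \<sigma> = (\<lambda>v. if v \<in> \<sigma> then 1 / card \<sigma> else 0)"

text \<open>Within a maximal simplex \<open>\<sigma>\<close>, the quantity \<open>card \<sigma> * face_min \<sigma> x\<close> serves as radial coordinate: it is
  0 on the boundary and 1 at the barycenter.\<close>

lemma maximal_face_facts:
  assumes K: "complex_on V K" and s: "\<sigma> \<in> K" "\<sigma> \<noteq> {}"
    and max: "\<And>S. S \<in> K \<Longrightarrow> \<sigma> \<subseteq> S \<Longrightarrow> S = \<sigma>" and x: "x \<in> realization_set K"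
  shows "0 \<le> face_min \<sigma> x" "face_min \<sigma> x \<noteq> 0 \<longleftrightarrow> {v. x v \<noteq> 0} = \<sigma>"
    "card \<sigma> * face_min \<sigma> x \<le> 1" "card \<sigma> * face_min \<sigma> x = 1 \<longleftrightarrow> x = barycenter \<sigma>"
proof -
  have fin: "finite \<sigma>" "\<sigma> \<subseteq> V" "finite V" using complex_onD[OF K] s by auto
  have c: "card \<sigma> > 0" using fin s by (simp add: card_gt_0_iff)
  have x0: "0 \<le> x v" for v using x by (simp add: realization_set_def)
  have sx: "{v. x v \<noteq> 0} \<in> K" "sum x V = 1" using x by (auto simp: realization_set_iff[OF K])
  show m0: "0 \<le> face_min \<sigma> x" using fin s x0 by (intro face_min_nonneg)
  show supp: "face_min \<sigma> x \<noteq> 0 \<longleftrightarrow> {v. x v \<noteq> 0} = \<sigma>"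
    using face_min_eq_0_iff[of \<sigma> x] fin s x0 sx max by blast
  have le: "card \<sigma> * face_min \<sigma> x \<le> sum x \<sigma>"
    using sum_mono[of \<sigma> "\<lambda>_. face_min \<sigma> x" x] face_min_le[OF fin(1)] by simp
  have s1: "sum x \<sigma> \<le> 1" using sum_mono2[OF fin(3,2), of x] x0 sx by simp
  then show le1: "card \<sigma> * face_min \<sigma> x \<le> 1" using le by simp
  have sum1: "sum x \<sigma> = 1" if "face_min \<sigma> x \<noteq> 0"
    using sum.mono_neutral_left[OF fin(3,2), of x] sx supp that by auto
  show "card \<sigma> * face_min \<sigma> x = 1 \<longleftrightarrow> x = barycenter \<sigma>"
  proof
    assume eq: "card \<sigma> * face_min \<sigma> x = 1"
    then have nz: "face_min \<sigma> x \<noteq> 0" by auto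
    \<comment> \<open>All terms are nonnegative, so each of them vanishes and the coordinates on
      \<open>\<sigma>\<close> are equal.\<close>
    have "(\<Sum>v\<in>\<sigma>. x v - face_min \<sigma> x) = 0" using eq sum1[OF nz] by (simp add: sum_subtractf)
    then have "x v = face_min \<sigma> x" if "v \<in> \<sigma>" for v
      using sum_nonneg_eq_0_iff[OF fin(1), of "\<lambda>v. x v - face_min \<sigma> x"] face_min_le[OF fin(1)] that by auto
    moreover have "x v = 0" if "v \<notin> \<sigma>" for v using supp nz that by auto
    moreover have "face_min \<sigma> x = 1 / card \<sigma>" using eq c by (simp add: field_simps)
    ultimately show "x = barycenter \<sigma>" by (auto simp: barycenter_def)
  next
    assume "x = barycenter \<sigma>"
    then have "x ` \<sigma> = {1 / card \<sigma>}" using s by (auto simp: barycenter_def)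
    then show "card \<sigma> * face_min \<sigma> x = 1" using c by (simp add: face_min_def)
  qed
qed

text \<open>Radial projection from the barycenter onto the boundary of \<open>\<sigma>\<close>;
  since \<open>\<sigma>\<close> is maximal, only points of its open simplex move.\<close>

lemma puncture_homotopy_equivalent:
  assumes K: "complex_on V K" and s: "\<sigma> \<in> K" "\<sigma> \<noteq> {}"
    and max: "\<And>S. S \<in> K \<Longrightarrow> \<sigma> \<subseteq> S \<Longrightarrow> S = \<sigma>"
  shows "top_of_set (realization_set K - {barycenter \<sigma>}) homotopy_equivalent_space
    top_of_set (realization_set (K - {\<sigma>}))"
proof -
  note F = maximal_face_facts[OF K s max]
  have fin: "finite \<sigma>" "\<sigma> \<subseteq> V" "finite V" using complex_onD[OF K] s by auto
  have c: "card \<sigma> > 0" using fin s by (simp add: card_gt_0_iff)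
  define m where "m = face_min \<sigma>"
  \<comment> \<open>Subtracting \<open>m x\<close> from the coordinates in \<open>\<sigma>\<close>
    leaves the mass \<open>1 - card \<sigma> * m x\<close>, which vanishes only at the barycenter;
    dividing by it restores the sum 1.\<close>
  define r where "r x = (\<lambda>v. (x v - (if v \<in> \<sigma> then m x else 0)) / (1 - card \<sigma> * m x))"
    for x :: "'a \<Rightarrow> real"
  let ?X = "realization_set K - {barycenter \<sigma>}"
  have lt: "card \<sigma> * m x < 1" if "x \<in> ?X" for x
    using F(3,4)[of x] that by (auto simp: m_def)
  have r0: "r x = x" if "m x = 0" for x using that by (auto simp: r_def)
  have r_nonneg: "0 \<le> r x v" if "x \<in> ?X" for x v
    using lt[OF that] face_min_le[OF fin(1), of v x] that
    by (auto simp: r_def m_def realization_set_def)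
  have r_sum: "sum (r x) V = 1" if "x \<in> ?X" for x
  proof -
    have "sum (r x) V = (sum x V - (\<Sum>v\<in>V. if v \<in> \<sigma> then m x else 0)) / (1 - card \<sigma> * m x)"
      by (simp add: r_def sum_subtractf flip: sum_divide_distrib)
    also have "\<dots> = 1"
      using that fin lt[OF that] by (simp add: realization_set_iff[OF K] Int_absorb1 flip: sum.inter_restrict)
    finally show ?thesis .
  qed
  have r_supp: "{v. r x v \<noteq> 0} \<subseteq> \<sigma>" if "x \<in> ?X" "m x \<noteq> 0" for x
    using F(2)[of x] that by (auto simp: r_def m_def split: if_splits)
  have r_zero: "\<exists>w\<in>\<sigma>. r x w = 0 \<and> x w = m x" for x
    using face_min_attained[OF fin(1) s(2), of x] by (auto simp: r_def m_def)
  have r_in: "r x \<in> realization_set (K - {\<sigma>})" if "x \<in> ?X" for x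
  proof (cases "m x = 0")
    case True
    then show ?thesis using that r0[OF True] F(2)[of x] by (auto simp: realization_set_def m_def)
  next
    case False
    have "{v. r x v \<noteq> 0} \<noteq> \<sigma>" using r_zero[of x] by blast
    moreover have "{v. r x v \<noteq> 0} \<in> K" using complex_onD(4)[OF K s(1) r_supp[OF that False]] .
    ultimately show ?thesis
      using r_nonneg[OF that] r_sum[OF that] realization_set_subset_iff[of "K - {\<sigma>}" K]
      by (auto simp: realization_set_iff[OF K])
  qed
  have cm: "continuous_on ?X m"
    unfolding m_def using fin s by (intro continuous_on_face_min continuous_on_id) auto
  have "continuous_on ?X (\<lambda>x. if v \<in> \<sigma> then m x else 0)" for v
    by (cases "v \<in> \<sigma>") (simp_all add: cm)
  then have cont: "continuous_on ?X r"
    unfolding r_def using less_imp_neq[OF lt]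
    by (intro continuous_on_coordinatewise_then_product continuous_on_divide continuous_on_diff
        continuous_on_mult continuous_on_const cm continuous_on_fun_coord[OF continuous_on_id])
      auto
  have "homotopic_with_canon (\<lambda>_. True) ?X ?X id r"
  proof (rule segment_homotopy[OF cont])
    fix x t assume x: "x \<in> ?X" and t: "0 \<le> t" "t \<le> (1::real)"
    show "(\<lambda>v. (1-t) * x v + t * r x v) \<in> ?X"
    proof (cases "m x = 0")
      case True then show ?thesis using x r0[OF True] by (simp flip: distrib_right)
    next
      case False
      have "(\<lambda>v. (1-t) * x v + t * r x v) \<in> realization_set K"
        by (rule realization_set_combine[OF K s(1)])
          (use F(2)[of x] False r_supp[OF x False] r_nonneg[OF x] r_sum[OF x] x t in \<open>auto simp: realization_set_iff[OF K] m_def\<close>)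
      moreover have "(\<lambda>v. (1-t) * x v + t * r x v) \<noteq> barycenter \<sigma>"
      proof
        \<comment> \<open>At a smallest coordinate \<open>w\<close> the segment has value
          \<open>(1 - t) * m x\<close>, at most \<open>m x < 1 / card \<sigma>\<close>, whereas the
          barycenter has \<open>1 / card \<sigma>\<close> there.\<close>
        assume eq: "(\<lambda>v. (1-t) * x v + t * r x v) = barycenter \<sigma>"
        obtain w where w: "w \<in> \<sigma>" "r x w = 0" "x w = m x" using r_zero by blast
        then have "(1-t) * m x = 1 / card \<sigma>" using fun_cong[OF eq, of w] by (simp add: barycenter_def)
        moreover have "(1-t) * m x \<le> m x" using t F(1)[of x] x by (simp add: m_def mult_left_le_one_le)
        ultimately have "card \<sigma> * (1 / card \<sigma>) \<le> card \<sigma> * m x" by (intro mult_left_mono) auto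
        then show False using lt[OF x] c by simp
      qed
      ultimately show ?thesis by blast
    qed
  qed
  moreover have sub: "realization_set (K - {\<sigma>}) \<subseteq> ?X"
    using realization_set_mono[of "K - {\<sigma>}" K] c by (auto simp: realization_set_def barycenter_def)
  have "retraction_maps (top_of_set ?X) (top_of_set (realization_set (K - {\<sigma>}))) r id"
    unfolding retraction_maps_def
  proof (intro conjI ballI)
    show "continuous_map (top_of_set ?X) (top_of_set (realization_set (K - {\<sigma>}))) r"
      using cont r_in by auto
    show "continuous_map (top_of_set (realization_set (K - {\<sigma>}))) (top_of_set ?X) id"
      using sub by auto
    fix x assume x: "x \<in> topspace (top_of_set (realization_set (K - {\<sigma>})))"
    then have "m x = 0" using F(2)[of x] sub by (auto simp: realization_set_def m_def)
    then show "r (id x) = x" by (simp add: r0)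
  qed
  ultimately show ?thesis
    using deformation_retract_imp_homotopy_equivalent_space homotopic_with_symD by blast
qed

section \<open>Attaching simplices to a contractible complex\<close>

lemma nsphere_eq: "nsphere d = top_of_set {x. (\<Sum>i\<le>d. x i ^ 2) = 1 \<and> (\<forall>i>d. x i = 0)}"
  by (simp add: nsphere euclidean_product_topology)

definition std_simplex :: "nat \<Rightarrow> (nat \<Rightarrow> real) set" where
  "std_simplex d = {u. (\<forall>i. 0 \<le> u i) \<and> (\<forall>i>d. u i = 0) \<and> sum u {..d} = 1}"

text \<open>Collapsing the boundary of the simplex: the point \<open>z / mu\<close> of \<open>\<real>\<^sup>d\<close>, where \<open>z i = u i - u 0\<close>
  and \<open>mu\<close> is \<open>d + 1\<close> times the smallest barycentric coordinate, is sent to the sphere by inverse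
  stereographic projection; clearing denominators makes the formula regular on the boundary.\<close>

definition simplex_to_sphere :: "nat \<Rightarrow> (nat \<Rightarrow> real) \<Rightarrow> nat \<Rightarrow> real" where
  "simplex_to_sphere d u = (\<lambda>i.
     let mu = real (Suc d) * face_min {..d} u; Z = (\<Sum>j\<in>{1..d}. (u j - u 0) ^ 2) in
     if i = 0 then (Z - mu ^ 2) / (Z + mu ^ 2)
     else if i \<le> d then 2 * mu * (u i - u 0) / (Z + mu ^ 2) else 0)"

context
  fixes d :: nat and u :: "nat \<Rightarrow> real" and mu Z :: real
  assumes u: "u \<in> std_simplex d"
  defines "mu \<equiv> real (Suc d) * face_min {..d} u"
    and "Z \<equiv> (\<Sum>j\<in>{1..d}. (u j - u 0) ^ 2)"
begin

lemma sphere_mu_nonneg: "0 \<le> mu"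
  using u unfolding mu_def by (simp add: face_min_nonneg std_simplex_def)

lemma sphere_Z_nonneg: "0 \<le> Z"
  unfolding Z_def by (simp add: sum_nonneg)

text \<open>If \<open>Z\<close> vanishes, all coordinates agree; if \<open>mu\<close> vanishes, one
  of them is 0. Both together contradict the coordinate sum 1.\<close>

lemma sphere_denominator: "0 < Z + mu ^ 2"
proof (rule ccontr)
  assume "\<not> 0 < Z + mu ^ 2"
  moreover have "0 \<le> mu\<^sup>2" by simp
  ultimately have "Z = 0" "mu ^ 2 = 0" using sphere_Z_nonneg by linarith+
  then have eq: "u j = u 0" if "j \<le> d" for j
    using that by (cases "j = 0") (auto simp: Z_def sum_nonneg_eq_0_iff)
  obtain i where "i \<le> d" "u i = face_min {..d} u" using face_min_attained[of "{..d}" u] by auto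
  moreover have "face_min {..d} u = 0" using \<open>mu ^ 2 = 0\<close> by (simp add: mu_def)
  ultimately have "u j = 0" if "j \<le> d" for j using eq[OF that] eq[of i] by metis
  then have "sum u {..d} = 0" by simp
  then show False using u by (simp add: std_simplex_def)
qed

lemma simplex_to_sphere_apply:
  "simplex_to_sphere d u i = (if i = 0 then (Z - mu ^ 2) / (Z + mu ^ 2)
     else if i \<le> d then 2 * mu * (u i - u 0) / (Z + mu ^ 2) else 0)"
  by (simp add: simplex_to_sphere_def mu_def Z_def Let_def)

lemma simplex_to_sphere_in: "simplex_to_sphere d u \<in> topspace (nsphere d)"
proof -
  have "(\<Sum>i\<le>d. (simplex_to_sphere d u i)\<^sup>2)
      = ((Z - mu ^ 2) / (Z + mu ^ 2)) ^ 2 + (\<Sum>i\<in>{1..d}. (simplex_to_sphere d u i)\<^sup>2)"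
    by (simp add: sum.atMost_shift sum.atLeast1_atMost_eq simplex_to_sphere_apply atLeast0LessThan lessThan_Suc_atMost[symmetric] sum.lessThan_Suc_shift del: sum.lessThan_Suc)
  also have "(\<Sum>i\<in>{1..d}. (simplex_to_sphere d u i)\<^sup>2)
      = (\<Sum>i\<in>{1..d}. (2 * mu / (Z + mu ^ 2)) ^ 2 * (u i - u 0) ^ 2)"
    by (intro sum.cong) (auto simp: simplex_to_sphere_apply power_divide power_mult_distrib)
  also have "\<dots> = (2 * mu / (Z + mu ^ 2)) ^ 2 * Z"
    by (simp add: Z_def sum_distrib_left)
  \<comment> \<open>This is \<open>(Z - mu^2)^2 + 4 * mu^2 * Z = (Z + mu^2)^2\<close>.\<close>
  also have "((Z - mu ^ 2) / (Z + mu ^ 2)) ^ 2 + \<dots> = 1"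
    using sphere_denominator by (simp add: power_divide flip: add_divide_distrib)
      (simp add: power2_eq_square algebra_simps)
  finally show ?thesis by (auto simp: nsphere_eq simplex_to_sphere_apply)
qed

lemma simplex_to_sphere_base_iff: "simplex_to_sphere d u = sphere_base \<longleftrightarrow> face_min {..d} u = 0"
proof
  assume "simplex_to_sphere d u = sphere_base"
  then have "simplex_to_sphere d u 0 = 1" by (simp add: sphere_base_def)
  then have "mu ^ 2 = 0" using sphere_denominator by (simp add: simplex_to_sphere_apply field_simps)
  then show "face_min {..d} u = 0" by (simp add: mu_def)
next
  assume "face_min {..d} u = 0"
  then have "mu = 0" by (simp add: mu_def)
  then show "simplex_to_sphere d u = sphere_base" using sphere_denominator
    by (auto simp: simplex_to_sphere_apply sphere_base_def)
qed

text \<open>Stereographic projection from \<open>sphere_base\<close> recovers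
  \<open>q j = (u j - u 0) / mu\<close>. The smallest entries of \<open>u\<close> and
  \<open>q\<close> sit at the same index, and the sum 1 then determines \<open>mu\<close> and
  \<open>u 0\<close>. The right-hand side involves \<open>u\<close> only through its image, which
  yields injectivity off the boundary.\<close>

lemma simplex_to_sphere_inverse:
  fixes q :: "nat \<Rightarrow> real" and p :: "nat \<Rightarrow> real"
  defines "p \<equiv> simplex_to_sphere d u"
  defines "q \<equiv> \<lambda>i. if i = 0 then 0 else p i / (1 - p 0)"
  assumes m: "face_min {..d} u \<noteq> 0" and i: "i \<le> d"
  shows "u i = (1 / real (Suc d) + q i - face_min {..d} q) / (1 + sum q {..d} - real (Suc d) * face_min {..d} q)"
proof -
  have "mu \<noteq> 0" using m by (simp add: mu_def del: of_nat_Suc)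
  then have mu: "mu > 0" using sphere_mu_nonneg by simp
  have "1 - p 0 = 2 * mu ^ 2 / (Z + mu ^ 2)"
    using sphere_denominator by (simp add: p_def simplex_to_sphere_apply field_simps)
  then have q: "q j = (u j - u 0) / mu" if "j \<le> d" for j
    using that mu sphere_denominator by (simp add: q_def p_def simplex_to_sphere_apply power2_eq_square)
  have uq: "u j = u 0 + mu * q j" if "j \<le> d" for j using q[OF that] mu by simp
  obtain k where k: "k \<le> d" "u k = face_min {..d} u" using face_min_attained[of "{..d}" u] by auto
  have "q k \<le> q j" if "j \<le> d" for j
  proof -
    have "u k \<le> u j" using k(2) face_min_le[of "{..d}" j u] that by simp
    then show ?thesis using q[OF that] q[OF k(1)] mu by (simp add: divide_right_mono)
  qed
  then have qk: "face_min {..d} q = q k"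
    unfolding face_min_def using k(1) by (intro Min_eqI) auto
  have "sum u {..d} = (\<Sum>j\<le>d. u 0 + mu * q j)" by (intro sum.cong refl uq) simp
  then have s: "1 = real (Suc d) * u 0 + mu * sum q {..d}"
    using u by (simp add: std_simplex_def sum.distrib sum_distrib_left)
  have t: "mu = real (Suc d) * (u 0 + mu * q k)" using uq[OF k(1)] k(2) by (simp add: mu_def)
  define D where "D = 1 + sum q {..d} - real (Suc d) * q k"
  have "real (Suc d) * u 0 = mu - real (Suc d) * (mu * q k)" using t by (simp add: algebra_simps)
  then have muD: "mu * D = 1" using s by (simp add: D_def algebra_simps)
  then have D: "D \<noteq> 0" by auto
  have u0: "u 0 = mu / real (Suc d) - mu * q k"
    using t by (simp add: divide_simps) (simp add: algebra_simps)
  have "u i = mu * (1 / real (Suc d) + q i - q k)"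
    unfolding uq[OF i] u0 by (simp add: algebra_simps)
  also have "mu = 1 / D" using muD D by (simp add: field_simps)
  finally show ?thesis by (simp add: qk D_def)
qed

end

lemma simplex_to_sphere_inj:
  assumes "u \<in> std_simplex d" "w \<in> std_simplex d" "face_min {..d} u \<noteq> 0"
    "simplex_to_sphere d u = simplex_to_sphere d w"
  shows "u = w"
proof
  fix i
  have "face_min {..d} w \<noteq> 0" using assms simplex_to_sphere_base_iff by metis
  show "u i = w i"
  proof (cases "i \<le> d")
    case True
    show ?thesis
      by (rule trans[OF simplex_to_sphere_inverse[OF assms(1,3) True, unfolded assms(4)]
        simplex_to_sphere_inverse[OF assms(2) \<open>face_min {..d} w \<noteq> 0\<close> True, symmetric]])
  next
    case False then show ?thesis using assms by (simp add: std_simplex_def)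
  qed
qed

lemma simplex_to_sphere_surj:
  assumes p: "p \<in> topspace (nsphere d)" and "0 < d"
  shows "\<exists>u\<in>std_simplex d. simplex_to_sphere d u = p"
proof (cases "p 0 = 1")
  case True
  have "(\<Sum>i\<le>d. p i ^ 2) = 1" "\<And>i. i > d \<Longrightarrow> p i = 0" using p by (auto simp: nsphere_eq)
  moreover have "(\<Sum>i\<le>d. p i ^ 2) = p 0 ^ 2 + (\<Sum>i\<in>{..d}-{0}. p i ^ 2)" by (rule sum.remove) auto
  ultimately have "(\<Sum>i\<in>{..d}-{0}. p i ^ 2) = 0" using True by simp
  then have "p i = 0" if "i \<noteq> 0" for i
    using \<open>\<And>i. i > d \<Longrightarrow> p i = 0\<close> that by (cases "i \<le> d") (auto simp: sum_nonneg_eq_0_iff)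
  then have b: "p = sphere_base" using True by (auto simp: sphere_base_def)
  \<comment> \<open>The base point is the image of the boundary. A vertex is a boundary point
    because \<open>0 < d\<close> provides the vanishing coordinate 1.\<close>
  let ?u = "\<lambda>i. if i = 0 then 1 else (0::real)"
  have u: "?u \<in> std_simplex d" by (auto simp: std_simplex_def)
  have "face_min {..d} ?u = 0" unfolding face_min_def
    by (rule Min_eqI) (use \<open>0 < d\<close> in \<open>auto intro!: image_eqI[of _ _ 1]\<close>)
  then show ?thesis using simplex_to_sphere_base_iff[OF u] u b by blast
next
  case False
  have ps: "(\<Sum>i\<le>d. p i ^ 2) = 1" "\<And>i. i > d \<Longrightarrow> p i = 0" using p by (auto simp: nsphere_eq)
  have p0: "p 0 ^ 2 + (\<Sum>i\<in>{1..d}. p i ^ 2) = 1"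
  proof -
    have "{..d} = insert 0 {1..d}" by auto
    then show ?thesis using ps(1) by simp
  qed
  have "p 0 ^ 2 \<le> 1" using p0 sum_nonneg[of "{1..d}" "\<lambda>i. p i ^ 2"] by simp
  then have "p 0 \<le> 1" using power2_le_imp_le[of "p 0" 1] by simp
  with False have p1: "p 0 < 1" by simp
  define q where "q = (\<lambda>i. if i = 0 then 0 else p i / (1 - p 0))"
  define a where "a = face_min {..d} q"
  \<comment> \<open>The inversion formula read backwards: \<open>q\<close> is the stereographic
    projection of \<open>p\<close>, and the coordinate sum 1 of \<open>u\<close> forces
    \<open>mu\<close>. The denominator is at least 1, since \<open>a\<close> is the smallest entry
    of \<open>q\<close>.\<close>
  define mu where "mu = 1 / (1 + sum q {..d} - real (Suc d) * a)"
  define u where "u = (\<lambda>i. if i \<le> d then mu * (1 / real (Suc d) + q i - a) else 0)"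
  have ale: "a \<le> q i" if "i \<le> d" for i using that by (simp add: a_def face_min_le)
  have "(\<Sum>i\<le>d. a) \<le> sum q {..d}" by (intro sum_mono) (use ale in auto)
  then have mupos: "mu > 0" by (simp add: mu_def)
  have "(\<Sum>i\<le>d. u i) = mu * (\<Sum>i\<le>d. 1 / real (Suc d) + q i - a)"
    unfolding sum_distrib_left by (intro sum.cong) (auto simp: u_def)
  also have "(\<Sum>i\<le>d. 1 / real (Suc d) + q i - a) = 1 + sum q {..d} - real (Suc d) * a"
    by (simp add: sum.distrib sum_subtractf del: of_nat_Suc)
  also have "mu * \<dots> = 1" using mupos unfolding mu_def by simp
  finally have us: "sum u {..d} = 1" .
  have u: "u \<in> std_simplex d"
    using us ale mupos by (auto simp: std_simplex_def u_def intro!: mult_nonneg_nonneg add_nonneg_nonneg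
        simp del: of_nat_Suc simp: add_diff_eq[symmetric])
  obtain k where k: "k \<le> d" "q k = a" using face_min_attained[of "{..d}" q] by (auto simp: a_def)
  have "face_min {..d} u = mu / real (Suc d)" unfolding face_min_def
  proof (rule Min_eqI)
    show "mu / real (Suc d) \<in> u ` {..d}" using k by (intro image_eqI[of _ _ k]) (auto simp: u_def)
    fix y assume "y \<in> u ` {..d}"
    then obtain i where i: "i \<le> d" "y = u i" by auto
    have "mu * (1 / real (Suc d)) \<le> mu * (1 / real (Suc d) + q i - a)"
      using mupos ale[OF i(1)] by (intro mult_left_mono) auto
    then show "mu / real (Suc d) \<le> y" using i by (simp add: u_def)
  qed auto
  then have mu: "real (Suc d) * face_min {..d} u = mu" by simp
  have z: "u i - u 0 = mu * q i" if "i \<le> d" for i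
    using that by (simp add: u_def q_def algebra_simps)
  have "(\<Sum>j\<in>{1..d}. (u j - u 0) ^ 2) = (\<Sum>j\<in>{1..d}. (mu / (1 - p 0)) ^ 2 * p j ^ 2)"
    by (intro sum.cong) (auto simp: z q_def power_mult_distrib power_divide)
  also have "\<dots> = (mu / (1 - p 0)) ^ 2 * (1 - p 0 ^ 2)"
    using p0 by (simp flip: sum_distrib_left)
  also have "\<dots> = mu ^ 2 * ((1 + p 0) / (1 - p 0))"
    using p1 by (simp add: power2_eq_square divide_simps) (simp add: algebra_simps)
  finally have Z: "(\<Sum>j\<in>{1..d}. (u j - u 0) ^ 2) = mu ^ 2 * ((1 + p 0) / (1 - p 0))" .
  have den: "mu ^ 2 * ((1 + p 0) / (1 - p 0)) + mu ^ 2 = mu ^ 2 * (2 / (1 - p 0))"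
    using p1 by (simp add: field_simps)
  have num: "mu ^ 2 * ((1 + p 0) / (1 - p 0)) - mu ^ 2 = mu ^ 2 * (2 * p 0 / (1 - p 0))"
    using p1 by (simp add: field_simps)
  have "simplex_to_sphere d u i = p i" for i
    unfolding simplex_to_sphere_apply[OF u] mu Z den num
    using p1 mupos ps(2)[of i] by (auto simp: z q_def power2_eq_square)
  then show ?thesis using u by blast
qed

lemma continuous_on_simplex_to_sphere: "continuous_on (std_simplex d) (simplex_to_sphere d)"
proof (rule continuous_on_coordinatewise_then_product)
  fix i
  have *: "continuous_on (std_simplex d) (\<lambda>u. u j)" for j
    by (rule continuous_on_fun_coord[OF continuous_on_id])
  have m: "continuous_on (std_simplex d) (\<lambda>u. face_min {..d} u)"
    by (intro continuous_on_face_min continuous_on_id) auto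
  have ne: "(\<Sum>j\<in>{1..d}. (u j - u 0) ^ 2) + (real (Suc d) * face_min {..d} u) ^ 2 \<noteq> 0"
    if "u \<in> std_simplex d" for u using sphere_denominator[OF that] by simp
  show "continuous_on (std_simplex d) (\<lambda>u. simplex_to_sphere d u i)"
    unfolding simplex_to_sphere_def Let_def
    by (cases "i = 0"; cases "i \<le> d"; simp only: if_True if_False simp_thms)
      (use ne in \<open>intro continuous_on_divide continuous_on_diff continuous_on_add continuous_on_sum
        continuous_on_mult continuous_on_power continuous_on_const m *; blast\<close>)+
qed

text \<open>In the proof, \<open>shrink s\<close> pushes the part of each deleted simplex with radial coordinate at most
  \<open>s\<close> into the boundary; points that reach the boundary before the time is up are moved on by \<open>h\<close>.\<close>

lemma homotopy_extension:
  fixes h :: "real \<times> ('a \<Rightarrow> real) \<Rightarrow> 'a \<Rightarrow> real"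
  assumes K: "complex_on V K" and B: "B \<subseteq> K" "{} \<notin> B"
    and max: "\<And>\<sigma> S. \<sigma> \<in> B \<Longrightarrow> S \<in> K \<Longrightarrow> \<sigma> \<subseteq> S \<Longrightarrow> S = \<sigma>"
    and h: "continuous_on ({0..1} \<times> realization_set (K - B)) h"
    and hL: "\<And>t x. 0 \<le> t \<Longrightarrow> t \<le> 1 \<Longrightarrow> x \<in> realization_set (K - B) \<Longrightarrow> h (t, x) \<in> realization_set (K - B)"
    and h0: "\<And>x. x \<in> realization_set (K - B) \<Longrightarrow> h (0, x) = x"
  obtains H where "continuous_on ({0..1} \<times> realization_set K) H"
    "\<And>t x. 0 \<le> t \<Longrightarrow> t \<le> 1 \<Longrightarrow> x \<in> realization_set K \<Longrightarrow> H (t, x) \<in> realization_set K"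
    "\<And>x. x \<in> realization_set K \<Longrightarrow> H (0, x) = x"
    "\<And>t x. 0 \<le> t \<Longrightarrow> t \<le> 1 \<Longrightarrow> x \<in> realization_set (K - B) \<Longrightarrow> H (t, x) = h (t, x)"
proof -
  let ?X = "realization_set K" and ?L = "realization_set (K - B)"
  have finK: "finite K" using K by (auto simp: complex_on_def intro: finite_subset)
  then have finB: "finite B" using B finite_subset by blast
  have finV: "finite V" using K by (simp add: complex_on_def)
  \<comment> \<open>At most one summand is nonzero, as the open simplices of \<open>B\<close> are
    disjoint: \<open>M x\<close> is the radial coordinate in the simplex of \<open>B\<close> whose
    interior contains \<open>x\<close>, and 0 on the subcomplex.\<close>
  define M where "M x = (\<Sum>\<sigma>\<in>B. card \<sigma> * face_min \<sigma> x)" for x :: "'a \<Rightarrow> real"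
  define e where "e s \<sigma> x = min (face_min \<sigma> x) (s / card \<sigma>)" for s \<sigma> and x :: "'a \<Rightarrow> real"
  define shrink where "shrink s x = (\<lambda>v. (x v - (\<Sum>\<sigma>\<in>B. if v \<in> \<sigma> then e s \<sigma> x else 0)) /
      (1 - (\<Sum>\<sigma>\<in>B. card \<sigma> * e s \<sigma> x)))" for s and x :: "'a \<Rightarrow> real"
  have B': "\<sigma> \<in> K" "\<sigma> \<noteq> {}" "finite \<sigma>" "\<sigma> \<subseteq> V" "card \<sigma> > 0" if "\<sigma> \<in> B" for \<sigma>
    using B that complex_onD(2,3)[OF K, of \<sigma>] by (auto simp: card_gt_0_iff)
  have F: "0 \<le> face_min \<sigma> x" "face_min \<sigma> x \<noteq> 0 \<longleftrightarrow> {v. x v \<noteq> 0} = \<sigma>"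
    if "\<sigma> \<in> B" "x \<in> ?X" for \<sigma> x
    using maximal_face_facts(1,2)[OF K B'(1,2)[OF that(1)] max[OF that(1)] that(2)] by auto
  have inL: "x \<in> ?L \<longleftrightarrow> (\<forall>\<sigma>\<in>B. face_min \<sigma> x = 0)" if "x \<in> ?X" for x
    using F(2)[OF _ that] that by (auto simp: realization_set_def)
  have M0: "M x = 0 \<longleftrightarrow> x \<in> ?L" if "x \<in> ?X" for x
  proof -
    have "M x = 0 \<longleftrightarrow> (\<forall>\<sigma>\<in>B. card \<sigma> * face_min \<sigma> x = 0)"
      unfolding M_def using F(1)[OF _ that] by (intro sum_nonneg_eq_0_iff finB) auto
    moreover have "card \<sigma> * face_min \<sigma> x = 0 \<longleftrightarrow> face_min \<sigma> x = 0" if "\<sigma> \<in> B" for \<sigma>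
      using B'(5)[OF that] by simp
    ultimately show ?thesis unfolding inL[OF that] by simp
  qed
  have M_nonneg: "0 \<le> M x" if "x \<in> ?X" for x
    unfolding M_def using F(1)[OF _ that] by (intro sum_nonneg) auto
  have shrink_L: "shrink s x = x" if "x \<in> ?L" "0 \<le> s" for s x
  proof -
    have "x \<in> ?X" using that realization_set_mono[of "K - B" K] by auto
    then have "e s \<sigma> x = 0" if "\<sigma> \<in> B" for \<sigma>
      using inL[of x] that \<open>x \<in> ?L\<close> \<open>0 \<le> s\<close> by (auto simp: e_def)
    then show ?thesis by (simp add: shrink_def cong: if_cong)
  qed
  \<comment> \<open>The bound \<open>s \<le> 1/2\<close> keeps the denominator of
    \<open>shrink\<close> at least 1/2 even at the barycenters, where a full push to the boundary
    would be undefined.\<close>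
  have main: "(\<Sum>\<sigma>\<in>B. card \<sigma> * e s \<sigma> x) \<le> 1/2 \<and> shrink s x \<in> ?X \<and> (M x \<le> s \<longrightarrow> shrink s x \<in> ?L)"
    if s: "0 \<le> s" "s \<le> 1/2" and x: "x \<in> ?X" for s x
  proof (cases "x \<in> ?L")
    case True
    then have "e s \<sigma> x = 0" if "\<sigma> \<in> B" for \<sigma> using inL[OF x] that s by (auto simp: e_def)
    then show ?thesis using shrink_L[OF True s(1)] True x by simp
  next
    case False
    then obtain \<sigma> where \<sigma>: "\<sigma> \<in> B" "face_min \<sigma> x \<noteq> 0" using inL[OF x] by auto
    have supp: "{v. x v \<noteq> 0} = \<sigma>" using F(2)[OF \<sigma>(1) x] \<sigma>(2) by blast
    have oth: "face_min \<tau> x = 0" if "\<tau> \<in> B - {\<sigma>}" for \<tau>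
      using F(2)[OF _ x, of \<tau>] that supp max by blast
    have eo: "e s \<tau> x = 0" if "\<tau> \<in> B - {\<sigma>}" for \<tau> using oth[OF that] s by (simp add: e_def)
    have one: "(\<Sum>\<tau>\<in>B. g \<tau>) = g \<sigma>" if "\<And>\<tau>. \<tau> \<in> B - {\<sigma>} \<Longrightarrow> g \<tau> = 0" for g :: "'a set \<Rightarrow> real"
      using sum.mono_neutral_right[of B "{\<sigma>}" g] that finB \<sigma>(1) by auto
    define c where "c = real (card \<sigma>)"
    have c: "c > 0" using B'(5)[OF \<sigma>(1)] by (simp add: c_def)
    define m where "m = face_min \<sigma> x"
    have m: "m > 0" using F(1)[OF \<sigma>(1) x] \<sigma>(2) unfolding m_def by force
    define a where "a = min m (s / c)"
    have Mx: "M x = c * m" unfolding M_def c_def m_def by (rule one) (simp add: oth)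
    have S1: "(\<Sum>\<tau>\<in>B. card \<tau> * e s \<tau> x) = c * a"
      using one[of "\<lambda>\<tau>. card \<tau> * e s \<tau> x"] eo by (simp add: e_def c_def a_def m_def)
    have S2: "(\<Sum>\<tau>\<in>B. if v \<in> \<tau> then e s \<tau> x else 0) = (if v \<in> \<sigma> then a else 0)" for v
      using one[of "\<lambda>\<tau>. if v \<in> \<tau> then e s \<tau> x else 0"] eo by (simp add: e_def c_def a_def m_def)
    have sh: "shrink s x = (\<lambda>v. (x v - (if v \<in> \<sigma> then a else 0)) / (1 - c * a))"
      by (simp add: shrink_def S1 S2)
    have "c * a \<le> c * (s / c)" using c by (intro mult_left_mono) (auto simp: a_def)
    then have ca: "c * a \<le> 1/2" using c s by simp
    have am: "a \<le> m" by (simp add: a_def)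
    have xm: "m \<le> x v" if "v \<in> \<sigma>" for v using face_min_le B'(3)[OF \<sigma>(1)] that by (auto simp: m_def)
    have x0: "0 \<le> x v" for v using x by (simp add: realization_set_def)
    have nn: "0 \<le> shrink s x v" for v
      using ca am xm[of v] x0[of v] by (auto simp: sh)
    have "sum (shrink s x) V = (sum x V - (\<Sum>v\<in>V. if v \<in> \<sigma> then a else 0)) / (1 - c * a)"
      by (simp add: sh sum_subtractf flip: sum_divide_distrib)
    also have "(\<Sum>v\<in>V. if v \<in> \<sigma> then a else 0) = c * a"
      using B'(4)[OF \<sigma>(1)] finV by (simp add: c_def Int_absorb1 flip: sum.inter_restrict)
    also have "sum x V = 1" using x by (simp add: realization_set_iff[OF K])
    finally have sm: "sum (shrink s x) V = 1" using ca by simp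
    have sub: "{v. shrink s x v \<noteq> 0} \<subseteq> \<sigma>" using supp by (auto simp: sh split: if_splits)
    then have inK: "{v. shrink s x v \<noteq> 0} \<in> K" using complex_onD(4)[OF K B'(1)[OF \<sigma>(1)]] by blast
    then have inX: "shrink s x \<in> ?X" using nn sm by (simp add: realization_set_iff[OF K])
    moreover have "shrink s x \<in> ?L" if "M x \<le> s"
    proof -
      have "a = m" using that c by (simp add: Mx a_def field_simps min_def)
      moreover obtain w where "w \<in> \<sigma>" "x w = m"
        using face_min_attained B'(2,3)[OF \<sigma>(1)] by (metis m_def)
      ultimately have "w \<in> \<sigma>" "shrink s x w = 0" by (auto simp: sh)
      then have "{v. shrink s x v \<noteq> 0} \<noteq> \<sigma>" by blast
      then have "{v. shrink s x v \<noteq> 0} \<notin> B" using max[OF _ B'(1)[OF \<sigma>(1)] sub] by blast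
      then show ?thesis using inK inX by (simp add: realization_set_def)
    qed
    ultimately show ?thesis using ca by (simp add: S1)
  qed
  \<comment> \<open>A point \<open>x\<close> reaches the boundary at time \<open>2 * M x\<close>,
    and \<open>h\<close> runs for the time that remains. On the interface \<open>M x = t / 2\<close>
    the homotopy \<open>h\<close> is at time 0, where it is the identity, so the branches
    agree.\<close>
  define H where "H p = (if M (snd p) - fst p / 2 \<le> 0 then h (fst p - 2 * M (snd p), shrink (fst p / 2) (snd p))
      else shrink (fst p / 2) (snd p))" for p
  have c_snd: "continuous_on S (\<lambda>p. snd p v)" for S :: "(real \<times> ('a \<Rightarrow> real)) set" and v
    by (rule continuous_on_fun_coord[OF continuous_on_snd[OF continuous_on_id]])
  have c_fm: "continuous_on S (\<lambda>p. face_min \<sigma> (snd p))" if "\<sigma> \<in> B" for S :: "(real \<times> ('a \<Rightarrow> real)) set" and \<sigma>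
    using B'[OF that] by (intro continuous_on_face_min continuous_on_snd continuous_on_id)
  have cM: "continuous_on S (\<lambda>p. M (snd p))" for S :: "(real \<times> ('a \<Rightarrow> real)) set"
    unfolding M_def by (intro continuous_on_sum continuous_on_mult continuous_on_const c_fm)
  have c_e: "continuous_on S (\<lambda>p. e (fst p / 2) \<sigma> (snd p))" if "\<sigma> \<in> B" for S :: "(real \<times> ('a \<Rightarrow> real)) set" and \<sigma>
    unfolding e_def using B'(5)[OF that] that
    by (intro continuous_on_min c_fm continuous_on_divide continuous_on_const continuous_on_fst continuous_on_id) auto
  have c_e': "continuous_on S (\<lambda>p. if v \<in> \<sigma> then e (fst p / 2) \<sigma> (snd p) else 0)"
    if "\<sigma> \<in> B" for S :: "(real \<times> ('a \<Rightarrow> real)) set" and \<sigma> v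
    by (cases "v \<in> \<sigma>") (simp_all add: c_e[OF that])
  have c_sh: "continuous_on ({0..1} \<times> ?X) (\<lambda>p. shrink (fst p / 2) (snd p))"
  proof -
    have "1 - (\<Sum>\<sigma>\<in>B. card \<sigma> * e (fst p / 2) \<sigma> (snd p)) \<noteq> 0" if "p \<in> {0..1} \<times> ?X" for p
      using main[of "fst p / 2" "snd p"] that by auto
    then show ?thesis unfolding shrink_def
      by (intro continuous_on_coordinatewise_then_product continuous_on_divide continuous_on_diff c_snd
          continuous_on_sum c_e c_e' continuous_on_mult continuous_on_const) auto
  qed
  have hsub: "(\<lambda>p. (fst p - 2 * M (snd p), shrink (fst p / 2) (snd p))) `
      {p \<in> {0..1} \<times> ?X. M (snd p) - fst p / 2 \<le> 0} \<subseteq> {0..1} \<times> ?L"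
  proof -
    have "shrink (t / 2) x \<in> ?L \<and> 0 \<le> t - 2 * M x \<and> t - 2 * M x \<le> 1"
      if "0 \<le> t" "t \<le> 1" "x \<in> ?X" "M x - t / 2 \<le> 0" for t x
      using main[of "t / 2" x] M_nonneg[of x] that by auto
    then show ?thesis by force
  qed
  show thesis
  proof
    show "continuous_on ({0..1} \<times> ?X) H"
      unfolding H_def
    proof (rule continuous_on_cases_le)
      show "continuous_on {p \<in> {0..1} \<times> ?X. M (snd p) - fst p / 2 \<le> 0}
          (\<lambda>p. h (fst p - 2 * M (snd p), shrink (fst p / 2) (snd p)))"
        by (rule continuous_on_compose2[OF h _ hsub])
          (intro continuous_on_Pair continuous_on_diff continuous_on_mult continuous_on_const cM
            continuous_on_fst continuous_on_id continuous_on_subset[OF c_sh]; blast)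
      show "continuous_on {p \<in> {0..1} \<times> ?X. 0 \<le> M (snd p) - fst p / 2} (\<lambda>p. shrink (fst p / 2) (snd p))"
        by (rule continuous_on_subset[OF c_sh]) blast
      show "continuous_on ({0..1} \<times> ?X) (\<lambda>p. M (snd p) - fst p / 2)"
        by (intro continuous_on_diff cM continuous_on_divide continuous_on_fst continuous_on_id continuous_on_const) auto
      fix p assume p: "p \<in> {0..1} \<times> ?X" "M (snd p) - fst p / 2 = 0"
      then have "shrink (fst p / 2) (snd p) \<in> ?L" using main[of "fst p / 2" "snd p"] by auto
      moreover have z: "fst p - 2 * M (snd p) = 0" using p(2) by simp
      ultimately show "h (fst p - 2 * M (snd p), shrink (fst p / 2) (snd p)) = shrink (fst p / 2) (snd p)"
        unfolding z by (intro h0)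
    qed
  next
    fix t x assume t: "0 \<le> t" "t \<le> (1::real)" and x: "x \<in> ?X"
    have "shrink (t/2) x \<in> ?X" using main[of "t/2" x] t x by simp
    moreover have "h (t - 2 * M x, shrink (t / 2) x) \<in> ?X" if "M x - t / 2 \<le> 0"
      using hL[of "t - 2 * M x" "shrink (t / 2) x"] main[of "t/2" x] M_nonneg[OF x] t x that
        realization_set_mono[of "K - B" K] by auto
    ultimately show "H (t, x) \<in> ?X" by (simp add: H_def)
  next
    fix x assume x: "x \<in> ?X"
    have e0: "shrink 0 x = x"
    proof (cases "x \<in> ?L")
      case False
      have "e 0 \<sigma> x = 0" if "\<sigma> \<in> B" for \<sigma>
        using F(1)[OF that x] by (simp add: e_def)
      then show ?thesis by (simp add: shrink_def cong: if_cong)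
    qed (simp add: shrink_L)
    show "H (0, x) = x"
    proof (cases "M x \<le> 0")
      case True
      then have "M x = 0" using M_nonneg[OF x] by simp
      then show ?thesis using M0[OF x] h0 by (simp add: H_def e0)
    qed (simp add: H_def e0)
  next
    fix t x assume t: "0 \<le> t" "t \<le> (1::real)" and x: "x \<in> ?L"
    have "x \<in> ?X" using x realization_set_mono[of "K - B" K] by auto
    then have z: "M x = 0" using M0 x by blast
    show "H (t, x) = h (t, x)" using x t by (simp add: H_def shrink_L z)
  qed
qed

section \<open>Closedness and compactness of realizations\<close>

lemma realization_set_Pow:
  assumes "finite \<sigma>"
  shows "realization_set (Pow \<sigma>) = {x. (\<forall>v. 0 \<le> x v) \<and> (\<forall>v. v \<notin> \<sigma> \<longrightarrow> x v = 0) \<and> sum x \<sigma> = 1}"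
proof -
  have "complex_on \<sigma> (Pow \<sigma>)" using assms by (auto simp: complex_on_def)
  then show ?thesis by (auto simp: realization_set_iff)
qed

lemma realization_set_eq_Union:
  assumes "complex_on V K"
  shows "realization_set K = (\<Union>\<sigma>\<in>K. realization_set (Pow \<sigma>))"
  using complex_onD(4)[OF assms] by (auto simp: realization_set_def)

lemma closed_realization_set_Pow:
  assumes "finite \<sigma>" shows "closed (realization_set (Pow \<sigma>))"
proof -
  have c: "continuous_on UNIV (\<lambda>x::'a \<Rightarrow> real. x v)" for v by simp
  have "realization_set (Pow \<sigma>) = (\<Inter>v. {x. 0 \<le> x v}) \<inter> (\<Inter>v\<in>-\<sigma>. {x. x v = 0}) \<inter> {x. sum x \<sigma> = 1}"
    unfolding realization_set_Pow[OF assms] by auto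
  also have "closed \<dots>"
    by (intro closed_Int closed_INT ballI closed_Collect_le closed_Collect_eq
        continuous_on_sum continuous_on_const c)
  finally show ?thesis .
qed

lemma closed_realization_set:
  assumes "complex_on V K" shows "closed (realization_set K)"
proof -
  have "finite K" using assms by (auto simp: complex_on_def intro: finite_subset)
  then show ?thesis unfolding realization_set_eq_Union[OF assms]
    using complex_onD(3)[OF assms] by (intro closed_UN closed_realization_set_Pow ballI)
qed

lemma compact_realization_set_Pow:
  assumes "finite \<sigma>" shows "compact (realization_set (Pow \<sigma>))"
proof -
  have "compactin (product_topology (\<lambda>_. euclidean) UNIV) (PiE (UNIV :: 'a set) (\<lambda>_. {0..1::real}))"
    by (simp add: compactin_PiE)
  then have c: "compact (PiE (UNIV :: 'a set) (\<lambda>_. {0..1::real}))"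
    by (simp add: euclidean_product_topology)
  have "realization_set (Pow \<sigma>) \<subseteq> PiE UNIV (\<lambda>_. {0..1})"
  proof
    fix x assume "x \<in> realization_set (Pow \<sigma>)"
    then have x: "\<And>v. 0 \<le> x v" "\<And>v. v \<notin> \<sigma> \<Longrightarrow> x v = 0" "sum x \<sigma> = 1"
      by (auto simp: realization_set_Pow[OF assms])
    have "x v \<le> 1" for v
      using member_le_sum[of v \<sigma> x] x assms by (cases "v \<in> \<sigma>") auto
    then show "x \<in> PiE UNIV (\<lambda>_. {0..1})" using x by auto
  qed
  then have "realization_set (Pow \<sigma>) = PiE UNIV (\<lambda>_. {0..1}) \<inter> realization_set (Pow \<sigma>)" by blast
  then show ?thesis using compact_Int_closed[OF c closed_realization_set_Pow[OF assms]] by simp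
qed

lemma Hausdorff_nsphere: "Hausdorff_space (nsphere d)"
  unfolding nsphere
  by (intro Hausdorff_space_subtopology) (simp add: Hausdorff_space_product_topology)

text \<open>An enumeration of the vertices transports \<open>simplex_to_sphere\<close> to
  \<open>\<sigma>\<close>. It is a quotient map because it is a continuous surjection from a compact
  space onto a Hausdorff space.\<close>

lemma face_to_sphere:
  assumes \<sigma>: "finite \<sigma>" "card \<sigma> = Suc d" "0 < d"
  obtains \<phi> where "quotient_map (top_of_set (realization_set (Pow \<sigma>))) (nsphere d) \<phi>"
    "\<And>x. x \<in> realization_set (Pow \<sigma>) \<Longrightarrow> \<phi> x = sphere_base \<longleftrightarrow> {v. x v \<noteq> 0} \<noteq> \<sigma>"
    "\<And>x y. x \<in> realization_set (Pow \<sigma>) \<Longrightarrow> y \<in> realization_set (Pow \<sigma>) \<Longrightarrow> {v. x v \<noteq> 0} = \<sigma> \<Longrightarrow>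
       \<phi> x = \<phi> y \<Longrightarrow> x = y"
proof -
  obtain e where "bij_betw e {0..<Suc d} \<sigma>" using ex_bij_betw_nat_finite[OF \<sigma>(1)] \<sigma>(2) by auto
  then have e: "bij_betw e {..d} \<sigma>" by (simp add: atLeast0LessThan lessThan_Suc_atMost)
  let ?D = "realization_set (Pow \<sigma>)"
  define pull where "pull x = (\<lambda>i. if i \<le> d then x (e i) else 0)" for x :: "'a \<Rightarrow> real"
  define \<phi> where "\<phi> x = simplex_to_sphere d (pull x)" for x
  have pull_in: "pull x \<in> std_simplex d" if "x \<in> ?D" for x
  proof -
    have "sum (pull x) {..d} = (\<Sum>i\<le>d. x (e i))" by (intro sum.cong) (auto simp: pull_def)
    also have "\<dots> = sum x \<sigma>" by (rule sum.reindex_bij_betw[OF e])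
    finally show ?thesis using that by (auto simp: std_simplex_def realization_set_Pow[OF \<sigma>(1)] pull_def)
  qed
  have pull_inj: "x = y" if "x \<in> ?D" "y \<in> ?D" "pull x = pull y" for x y
  proof
    fix v
    show "x v = y v"
    proof (cases "v \<in> \<sigma>")
      case True
      then obtain i where "i \<le> d" "v = e i" using e by (auto simp: bij_betw_def)
      then show ?thesis using fun_cong[OF that(3), of i] by (simp add: pull_def)
    qed (use that in \<open>auto simp: realization_set_Pow[OF \<sigma>(1)]\<close>)
  qed
  have pull_surj: "\<exists>x\<in>?D. pull x = u" if "u \<in> std_simplex d" for u
  proof -
    define x where "x v = (if v \<in> \<sigma> then u (inv_into {..d} e v) else 0)" for v
    have xe: "x (e i) = u i" if "i \<le> d" for i
      using that e by (auto simp: x_def bij_betw_def inv_into_f_f)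
    have "sum x \<sigma> = (\<Sum>i\<le>d. x (e i))" by (rule sum.reindex_bij_betw[OF e, symmetric])
    also have "\<dots> = sum u {..d}" by (intro sum.cong) (auto simp: xe)
    finally have "x \<in> ?D" using that by (auto simp: realization_set_Pow[OF \<sigma>(1)] x_def std_simplex_def)
    moreover have "pull x = u" using that by (auto simp: pull_def xe std_simplex_def)
    ultimately show ?thesis by blast
  qed
  have ne: "\<sigma> \<noteq> {}" using \<sigma> by auto
  have fm: "face_min {..d} (pull x) = face_min \<sigma> x" for x
  proof -
    have "pull x ` {..d} = (\<lambda>i. x (e i)) ` {..d}" by (auto simp: pull_def)
    also have "\<dots> = x ` \<sigma>" using e by (auto simp: bij_betw_def)
    finally show ?thesis by (simp add: face_min_def)
  qed
  have fm0: "face_min \<sigma> x = 0 \<longleftrightarrow> {v. x v \<noteq> 0} \<noteq> \<sigma>" if "x \<in> ?D" for x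
    using face_min_eq_0_iff[OF \<sigma>(1) ne, of x] that by (auto simp: realization_set_Pow[OF \<sigma>(1)])
  have "continuous_on ?D pull"
    unfolding pull_def
  proof (rule continuous_on_coordinatewise_then_product)
    show "continuous_on ?D (\<lambda>x. if i \<le> d then x (e i) else 0)" for i
      by (cases "i \<le> d") (simp_all add: continuous_on_fun_coord[OF continuous_on_id])
  qed
  then have "continuous_on ?D \<phi>" unfolding \<phi>_def
    by (rule continuous_on_compose2[OF continuous_on_simplex_to_sphere]) (use pull_in in auto)
  moreover have "\<phi> x \<in> topspace (nsphere d)" if "x \<in> ?D" for x
    unfolding \<phi>_def by (rule simplex_to_sphere_in[OF pull_in[OF that]])
  ultimately have "continuous_map (top_of_set ?D) (nsphere d) \<phi>"
    by (auto simp: nsphere_eq)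
  moreover have "\<phi> ` ?D = topspace (nsphere d)"
  proof
    show "\<phi> ` ?D \<subseteq> topspace (nsphere d)"
      using \<open>\<And>x. x \<in> ?D \<Longrightarrow> \<phi> x \<in> topspace (nsphere d)\<close> by blast
    show "topspace (nsphere d) \<subseteq> \<phi> ` ?D"
    proof
      fix p assume "p \<in> topspace (nsphere d)"
      then obtain u where "u \<in> std_simplex d" "simplex_to_sphere d u = p"
        using simplex_to_sphere_surj[OF _ \<sigma>(3)] by blast
      moreover obtain x where "x \<in> ?D" "pull x = u" using pull_surj calculation(1) by blast
      ultimately show "p \<in> \<phi> ` ?D" unfolding \<phi>_def by blast
    qed
  qed
  ultimately have "quotient_map (top_of_set ?D) (nsphere d) \<phi>"
    using compact_realization_set_Pow[OF \<sigma>(1)] Hausdorff_nsphere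
    by (intro T1_Spaces.continuous_imp_quotient_map) (auto simp: compact_space_subtopology)
  moreover have "\<phi> x = sphere_base \<longleftrightarrow> {v. x v \<noteq> 0} \<noteq> \<sigma>" if "x \<in> ?D" for x
    using simplex_to_sphere_base_iff[OF pull_in[OF that]] fm fm0[OF that] by (simp add: \<phi>_def)
  moreover have "x = y" if "x \<in> ?D" "y \<in> ?D" "{v. x v \<noteq> 0} = \<sigma>" "\<phi> x = \<phi> y" for x y
    using simplex_to_sphere_inj[OF pull_in[OF that(1)] pull_in[OF that(2)]] fm[of x] fm0[OF that(1)] that
      pull_inj by (simp add: \<phi>_def)
  ultimately show thesis using that by blast
qed

section \<open>Shrinking a contractible subcomplex to the base point of a wedge\<close>

lemma openin_wedge_subset:
  "U \<subseteq> topspace (wedge_topology X p I) \<Longrightarrow> openin (wedge_topology X p I) U \<longleftrightarrow>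
     (\<forall>i\<in>I. openin (X i) {x \<in> topspace (X i). wedge_in p i x \<in> U})"
  by (simp add: openin_wedge_topology topspace_wedge_topology)

lemma continuous_map_wedge_in:
  assumes "i \<in> I" shows "continuous_map (X i) (wedge_topology X p I) (wedge_in p i)"
  unfolding continuous_map_def topspace_wedge_topology
  using assms by (auto simp: openin_wedge_topology)

text \<open>The wedge is the quotient of \<open>realization_set K\<close> by the contractible
  subspace \<open>realization_set (K - B)\<close>. Homotopy extension turns the contraction of the
  subspace into a homotopy \<open>H\<close> of the whole space that keeps the subspace in itself and
  ends constant on it. At time 1 it factors through the quotient map, which gives the homotopy
  inverse, and \<open>H\<close> itself descends to the homotopy on the wedge.\<close>

theorem maximal_faces_wedge_of_spheres:
  assumes K: "complex_on V K" and B: "B \<subseteq> K" "card B = b" and card: "\<And>\<sigma>. \<sigma> \<in> B \<Longrightarrow> card \<sigma> = Suc d"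
    and d: "0 < d"
    and max: "\<And>\<sigma> S. \<sigma> \<in> B \<Longrightarrow> S \<in> K \<Longrightarrow> \<sigma> \<subseteq> S \<Longrightarrow> S = \<sigma>"
    and L: "contractible_space (top_of_set (realization_set (K - B)))" "realization_set (K - B) \<noteq> {}"
  shows "top_of_set (realization_set K) homotopy_equivalent_space wedge_of_spheres b d"
proof -
  let ?X = "realization_set K" and ?L = "realization_set (K - B)" and ?W = "wedge_of_spheres b d"
  let ?D = "\<lambda>\<sigma>. realization_set (Pow \<sigma>)"
  have finK: "finite K" using K by (auto simp: complex_on_def intro: finite_subset)
  then have finB: "finite B" using B finite_subset by blast
  obtain s where s: "bij_betw s {..<b} B"
    using ex_bij_betw_nat_finite[OF finB] B(2) by (auto simp: atLeast0LessThan)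
  have sB: "s j \<in> B" if "j < b" for j using s that by (auto simp: bij_betw_def)
  have s_inj: "i = j" if "s i = s j" "i < b" "j < b" for i j
    using s that by (auto simp: bij_betw_def inj_on_def)
  have s_sub: "i = j" if "s i \<subseteq> s j" "i < b" "j < b" for i j
    using max[OF sB[OF that(2)] _ that(1)] sB[OF that(3)] B(1) s_inj that by blast
  have fin_s: "finite (s j)" "s j \<in> K" if "j < b" for j
    using complex_onD(3)[OF K] sB[OF that] B by auto
  define P where "P j \<phi> \<longleftrightarrow> quotient_map (top_of_set (?D (s j))) (nsphere d) \<phi> \<and>
    (\<forall>x\<in>?D (s j). \<phi> x = sphere_base \<longleftrightarrow> {v. x v \<noteq> 0} \<noteq> s j) \<and>
    (\<forall>x\<in>?D (s j). \<forall>y\<in>?D (s j). {v. x v \<noteq> 0} = s j \<longrightarrow> \<phi> x = \<phi> y \<longrightarrow> x = y)" for j \<phi>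
  have "\<exists>\<phi>. P j \<phi>" if "j < b" for j
    by (rule face_to_sphere[OF fin_s(1)[OF that] card[OF sB[OF that]] d]) (unfold P_def, blast)
  then obtain \<phi> where "\<And>j. j < b \<Longrightarrow> P j (\<phi> j)" by metis
  then have \<phi>: "\<And>j. j < b \<Longrightarrow> quotient_map (top_of_set (?D (s j))) (nsphere d) (\<phi> j)"
    and \<phi>_base: "\<And>j x. j < b \<Longrightarrow> x \<in> ?D (s j) \<Longrightarrow> \<phi> j x = sphere_base \<longleftrightarrow> {v. x v \<noteq> 0} \<noteq> s j"
    and \<phi>_inj: "\<And>j x y. j < b \<Longrightarrow> x \<in> ?D (s j) \<Longrightarrow> y \<in> ?D (s j) \<Longrightarrow> {v. x v \<noteq> 0} = s j \<Longrightarrow>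
       \<phi> j x = \<phi> j y \<Longrightarrow> x = y"
    unfolding P_def by blast+
  let ?w = "wedge_in (\<lambda>_. sphere_base)"
  have KB: "complex_on V (K - B)"
    using K max by (auto simp: complex_on_def)
  have DX: "?D (s j) \<subseteq> ?X" if "j < b" for j
    using complex_onD(4)[OF K fin_s(2)[OF that]] by (intro realization_set_mono) blast
  have LX: "?L \<subseteq> ?X" by (intro realization_set_mono) blast
  have cover: "x \<in> ?L \<or> (\<exists>j<b. {v. x v \<noteq> 0} = s j)" if "x \<in> ?X" for x
  proof (cases "{v. x v \<noteq> 0} \<in> B")
    case True
    then show ?thesis using s unfolding bij_betw_def by (metis imageE lessThan_iff)
  qed (use that in \<open>auto simp: realization_set_def\<close>)
  have suppD: "x \<in> ?D (s j)" if "x \<in> ?X" "{v. x v \<noteq> 0} = s j" for x j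
    using that by (auto simp: realization_set_def)
  \<comment> \<open>The finite closed cover used for pasting: \<open>None\<close> stands for the
    subcomplex, \<open>Some j\<close> for the closed simplex \<open>s j\<close>.\<close>
  define T where "T i = (case i of None \<Rightarrow> ?L | Some j \<Rightarrow> ?D (s j))" for i
  define F where "F i = (case i of None \<Rightarrow> (\<lambda>_. None) | Some j \<Rightarrow> (\<lambda>x. ?w j (\<phi> j x)))" for i
  define I where "I = insert None (Some ` {..<b})"
  obtain f where f: "continuous_map (top_of_set ?X) ?W f"
    and fF: "\<And>x i. i \<in> I \<Longrightarrow> x \<in> ?X \<inter> T i \<Longrightarrow> f x = F i x"
  proof (rule pasting_lemma_exists_closed[of I "top_of_set ?X" T ?W F])
    show "finite I" by (simp add: I_def)
    show "topspace (top_of_set ?X) \<subseteq> (\<Union>i\<in>I. T i)"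
      using cover suppD by (fastforce simp: I_def T_def)
    show "closedin (top_of_set ?X) (T i)" if "i \<in> I" for i
    proof -
      have "closed (T i)" using that closed_realization_set[OF KB] closed_realization_set_Pow[OF fin_s(1)]
        by (auto simp: I_def T_def)
      moreover have "T i \<subseteq> ?X" using that DX LX by (cases i) (simp_all add: I_def T_def image_iff)
      ultimately show ?thesis by (simp add: closed_subset)
    qed
    show "continuous_map (subtopology (top_of_set ?X) (T i)) ?W (F i)" if "i \<in> I" for i
    proof (cases i)
      case None
      then show ?thesis by (simp add: F_def wedge_of_spheres_def topspace_wedge_topology)
    next
      case (Some j)
      then have j: "j < b" using that by (auto simp: I_def)
      have "subtopology (top_of_set ?X) (T i) = top_of_set (?D (s j))"
        using DX[OF j] by (simp add: T_def Some subtopology_subtopology Int_absorb1)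
      moreover have "continuous_map (top_of_set (?D (s j))) ?W (?w j \<circ> \<phi> j)"
        unfolding wedge_of_spheres_def
        using quotient_imp_continuous_map[OF \<phi>[OF j]] j
        by (intro continuous_map_compose[OF _ continuous_map_wedge_in]) auto
      ultimately show ?thesis by (simp add: F_def Some comp_def)
    qed
    \<comment> \<open>Different pieces overlap only in boundary points of the simplices, where every
      map takes the value \<open>None\<close>.\<close>
    show "F i x = F j x" if "i \<in> I" "j \<in> I" "x \<in> topspace (top_of_set ?X) \<inter> T i \<inter> T j" for i j x
    proof -
      have *: "F k x = None" if "k \<in> I" "x \<in> T k" "\<forall>j. k = Some j \<longrightarrow> {v. x v \<noteq> 0} \<noteq> s j" for k
        using that \<phi>_base by (auto simp: F_def T_def I_def wedge_in_def split: option.splits)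
      have **: "l = k" if "l \<in> I" "x \<in> T l" "k = Some j" "j < b" "{v. x v \<noteq> 0} = s j" for k l j
        using that sB[of j] s_sub by (auto simp: T_def I_def realization_set_def split: option.splits)
      show ?thesis
      proof (cases "\<exists>k. (i = Some k \<or> j = Some k) \<and> {v. x v \<noteq> 0} = s k")
        case True
        then obtain k where k: "i = Some k \<or> j = Some k" "{v. x v \<noteq> 0} = s k" by blast
        then have "k < b" using \<open>i \<in> I\<close> \<open>j \<in> I\<close> by (auto simp: I_def)
        then have "i = Some k" "j = Some k" using ** that k by blast+
        then show ?thesis by simp
      next
        case False
        then have "F i x = None" "F j x = None" using that by (auto intro!: *)
        then show ?thesis by simp
      qed
    qed
  qed auto
  have fL: "f x = None" if "x \<in> ?L" for x
    using fF[of None x] that LX by (auto simp: I_def T_def F_def)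
  have fD: "f x = ?w j (\<phi> j x)" if "x \<in> ?D (s j)" "j < b" for x j
    using fF[of "Some j" x] that DX by (auto simp: I_def T_def F_def)
  have fS: "f x = Some (j, \<phi> j x)" if "x \<in> ?X" "{v. x v \<noteq> 0} = s j" "j < b" for x j
    using fD[OF suppD[OF that(1,2)] that(3)] \<phi>_base[OF that(3) suppD[OF that(1,2)]] that(2)
    by (simp add: wedge_in_def)
  have fibre: "x = y \<or> x \<in> ?L \<and> y \<in> ?L" if xy: "x \<in> ?X" "y \<in> ?X" "f x = f y" for x y
  proof (cases "x \<in> ?L")
    case True
    then show ?thesis using cover[OF xy(2)] fS[OF xy(2)] fL[OF True] xy(3) by fastforce
  next
    case False
    then obtain j where j: "j < b" "{v. x v \<noteq> 0} = s j" using cover[OF xy(1)] by blast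
    then have fy: "f y = Some (j, \<phi> j x)" using fS[OF xy(1)] xy(3) by simp
    then have "y \<notin> ?L" using fL by fastforce
    then obtain k where k: "k < b" "{v. y v \<noteq> 0} = s k" using cover[OF xy(2)] by blast
    then have "k = j" "\<phi> j x = \<phi> j y" using fS[OF xy(2)] fy by auto
    then show ?thesis using \<phi>_inj[OF j(1) suppD[OF xy(1) j(2)] suppD[OF xy(2), of j]] j k by blast
  qed
  have f_img: "f ` ?X = topspace ?W"
  proof
    show "f ` ?X \<subseteq> topspace ?W" using continuous_map_image_subset_topspace[OF f] by simp
    have "wedge_in (\<lambda>_. sphere_base) j z \<in> f ` ?X" if jz: "j < b" "z \<in> topspace (nsphere d)" for j z
    proof -
      obtain x where "x \<in> ?D (s j)" "z = \<phi> j x"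
        using quotient_imp_surjective_map[OF \<phi>[OF jz(1)]] jz(2) by auto
      then show ?thesis using fD[OF _ jz(1)] DX[OF jz(1)] by (metis image_eqI subsetD)
    qed
    moreover have "None \<in> f ` ?X" using L(2) fL LX by force
    ultimately show "topspace ?W \<subseteq> f ` ?X"
      by (auto simp: wedge_of_spheres_def topspace_wedge_topology)
  qed
  have q: "quotient_map (top_of_set ?X) ?W f"
    unfolding quotient_map_def
  proof (intro conjI allI impI)
    show "f ` topspace (top_of_set ?X) = topspace ?W" using f_img by simp
    fix U assume U: "U \<subseteq> topspace ?W"
    show "openin (top_of_set ?X) {x \<in> topspace (top_of_set ?X). f x \<in> U} = openin ?W U"
    proof
      assume "openin ?W U"
      then show "openin (top_of_set ?X) {x \<in> topspace (top_of_set ?X). f x \<in> U}"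
        using f openin_continuous_map_preimage by blast
    next
      assume o: "openin (top_of_set ?X) {x \<in> topspace (top_of_set ?X). f x \<in> U}"
      show "openin ?W U"
        unfolding wedge_of_spheres_def openin_wedge_subset[OF U[unfolded wedge_of_spheres_def]]
      proof
        fix j assume "j \<in> {..<b}"
        then have j: "j < b" by simp
        let ?P = "{z \<in> topspace (nsphere d). ?w j z \<in> U}"
        have "{x \<in> ?D (s j). \<phi> j x \<in> ?P} = ?D (s j) \<inter> {x \<in> ?X. f x \<in> U}"
          using fD[OF _ j] DX[OF j] continuous_map_image_subset_topspace[OF quotient_imp_continuous_map[OF \<phi>[OF j]]]
          by auto
        moreover have "openin (top_of_set (?D (s j))) (?D (s j) \<inter> {x \<in> ?X. f x \<in> U})"
        proof -
          obtain Q where "open Q" "{x \<in> ?X. f x \<in> U} = ?X \<inter> Q" using o by (auto simp: openin_open)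
          moreover from this have "?D (s j) \<inter> {x \<in> ?X. f x \<in> U} = ?D (s j) \<inter> Q" using DX[OF j] by blast
          ultimately show ?thesis by (simp add: openin_open_Int)
        qed
        moreover have "openin (top_of_set (?D (s j))) {x \<in> ?D (s j). \<phi> j x \<in> ?P} = openin (nsphere d) ?P"
          using \<phi>[OF j, unfolded quotient_map_def, THEN conjunct2, rule_format, of ?P] by simp
        ultimately show "openin (nsphere d) ?P" by simp
      qed
    qed
  qed
  obtain a where "homotopic_with (\<lambda>_. True) (top_of_set ?L) (top_of_set ?L) id (\<lambda>_. a)"
    using L(1) by (auto simp: contractible_space_def)
  then obtain h where "continuous_map (prod_topology (top_of_set {0..1::real}) (top_of_set ?L)) (top_of_set ?L) h \<and>
      (\<forall>x. h (0, x) = id x) \<and> (\<forall>x. h (1, x) = a) \<and> (\<forall>t\<in>{0..1::real}. True)"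
    unfolding homotopic_with_def by - (erule exE, erule that)
  then have h: "continuous_on ({0..1} \<times> ?L) h" "h \<in> ({0..1} \<times> ?L) \<rightarrow> ?L"
    and h01: "\<And>x. h (0, x) = x" "\<And>x. h (1, x) = a"
    by auto
  obtain H where H: "continuous_on ({0..1} \<times> ?X) H"
    and HX: "\<And>t x. 0 \<le> t \<Longrightarrow> t \<le> 1 \<Longrightarrow> x \<in> ?X \<Longrightarrow> H (t, x) \<in> ?X"
    and H0: "\<And>x. x \<in> ?X \<Longrightarrow> H (0, x) = x"
    and HL: "\<And>t x. 0 \<le> t \<Longrightarrow> t \<le> 1 \<Longrightarrow> x \<in> ?L \<Longrightarrow> H (t, x) = h (t, x)"
  proof (rule homotopy_extension[OF K B(1) _ max h(1)])
    show "{} \<notin> B" using card by fastforce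
    show "h (t, x) \<in> ?L" if "0 \<le> t" "t \<le> 1" "x \<in> ?L" for t x using h(2) that by auto
  qed (use h01 in auto)
  have HLL: "H (t, x) \<in> ?L" if "0 \<le> t" "t \<le> 1" "x \<in> ?L" for t x
    using HL[OF that] h(2) that by auto
  have cH: "continuous_map (prod_topology (top_of_set {0..1}) (top_of_set ?X)) (top_of_set ?X) H"
    using H HX by auto
  have H1: "continuous_map (top_of_set ?X) (top_of_set ?X) (\<lambda>x. H (1, x))"
    using continuous_map_o_Pair[OF cH, of 1] by (simp add: comp_def)
  obtain g where g: "continuous_map ?W (top_of_set ?X) g" and gf: "\<And>x. x \<in> ?X \<Longrightarrow> g (f x) = H (1, x)"
  proof (rule quotient_map_lift_exists[OF q H1])
    show "H (1, x) = H (1, y)" if "x \<in> topspace (top_of_set ?X)" "y \<in> topspace (top_of_set ?X)" "f x = f y" for x y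
      using fibre[of x y] that HL h01 by auto
  qed auto
  have 1: "homotopic_with (\<lambda>_. True) (top_of_set ?X) (top_of_set ?X) id (g \<circ> f)"
  proof (subst homotopic_with)
    show "\<exists>h. continuous_map (prod_topology (top_of_set {0..1::real}) (top_of_set ?X)) (top_of_set ?X) h \<and>
        (\<forall>x\<in>topspace (top_of_set ?X). h (0, x) = id x) \<and>
        (\<forall>x\<in>topspace (top_of_set ?X). h (1, x) = (g \<circ> f) x) \<and> (\<forall>t\<in>{0..1::real}. True)"
      using cH H0 gf by (intro exI[of _ H]) simp
  qed simp
  let ?I = "top_of_set {0..1::real}"
  \<comment> \<open>Multiplying a quotient map by the locally compact interval keeps it a quotient
    map; this is what makes the homotopy induced by \<open>f \<circ> H\<close> on the wedge
    continuous.\<close>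
  have qI: "quotient_map (prod_topology ?I (top_of_set ?X)) (prod_topology ?I ?W) (\<lambda>(t, x). (t, f x))"
  proof (rule quotient_map_prod_right[OF _ _ q])
    show "locally_compact_space ?I"
      by (intro compact_imp_locally_compact_space) (simp add: compact_space_subtopology)
    show "Hausdorff_space ?I \<or> regular_space ?I" by (simp add: Hausdorff_space_subtopology)
  qed
  obtain k where k: "continuous_map (prod_topology ?I ?W) ?W k"
    and kf: "\<And>p. p \<in> topspace (prod_topology ?I (top_of_set ?X)) \<Longrightarrow> k ((\<lambda>(t, x). (t, f x)) p) = (f \<circ> H) p"
  proof (rule quotient_map_lift_exists[OF qI continuous_map_compose[OF cH f]])
    fix p p' assume pp: "p \<in> topspace (prod_topology ?I (top_of_set ?X))" "p' \<in> topspace (prod_topology ?I (top_of_set ?X))"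
      "(\<lambda>(t, x). (t, f x)) p = (\<lambda>(t, x). (t, f x)) p'"
    obtain t x where p: "p = (t, x)" by (cases p)
    obtain y where p': "p' = (t, y)" "f x = f y" using pp(3) p by (cases p') auto
    have t: "0 \<le> t" "t \<le> 1" "x \<in> ?X" "y \<in> ?X" using pp p p' by auto
    show "(f \<circ> H) p = (f \<circ> H) p'"
      using fibre[OF t(3,4) p'(2)] HLL[OF t(1,2)] fL by (auto simp: p p')
  qed auto
  have 2: "homotopic_with (\<lambda>_. True) ?W ?W id (f \<circ> g)"
  proof (subst homotopic_with)
    have "k (0, y) = y \<and> k (1, y) = f (g y)" if y: "y \<in> topspace ?W" for y
    proof -
      obtain x where x: "x \<in> ?X" "y = f x" using y f_img by blast
      then show ?thesis using kf[of "(0, x)"] kf[of "(1, x)"] H0 gf by simp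
    qed
    then show "\<exists>h. continuous_map (prod_topology ?I ?W) ?W h \<and>
        (\<forall>x\<in>topspace ?W. h (0, x) = id x) \<and>
        (\<forall>x\<in>topspace ?W. h (1, x) = (f \<circ> g) x) \<and> (\<forall>t\<in>{0..1::real}. True)"
      using k by (intro exI[of _ k]) simp
  qed simp
  show ?thesis unfolding homotopy_equivalent_space_def
    by (intro exI[of _ f] exI[of _ g] conjI f g homotopic_with_symD[OF 1] homotopic_with_symD[OF 2])
qed

section \<open>Rank of abelian groups\<close>

lemma hom_finprod_comm:
  assumes "comm_group A" "comm_group G" and f: "f \<in> hom A G" and u: "u \<in> I \<rightarrow> carrier A"
  shows "f (finprod A u I) = finprod G (\<lambda>i. f (u i)) I"
proof -
  interpret A: comm_group A by fact
  interpret G: comm_group G by fact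
  have fo: "f \<one>\<^bsub>A\<^esub> = \<one>\<^bsub>G\<^esub>" using f A.is_group G.is_group by (rule hom_one)
  show ?thesis using u
  proof (induction I rule: infinite_finite_induct)
    case (insert i I)
    have c: "f x \<in> carrier G" if "x \<in> carrier A" for x using f that by (rule hom_in_carrier)
    have "f (finprod A u (insert i I)) = f (u i \<otimes>\<^bsub>A\<^esub> finprod A u I)"
      using insert by (subst A.finprod_insert) auto
    also have "\<dots> = f (u i) \<otimes>\<^bsub>G\<^esub> f (finprod A u I)"
      using insert by (intro hom_mult[OF f]) (auto intro!: A.finprod_closed)
    also have "f (finprod A u I) = finprod G (\<lambda>i. f (u i)) I" using insert by auto
    also have "f (u i) \<otimes>\<^bsub>G\<^esub> \<dots> = finprod G (\<lambda>i. f (u i)) (insert i I)"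
      using insert c by (subst G.finprod_insert) auto
    finally show ?case .
  qed (simp_all add: fo)
qed

text \<open>Independence of families avoids carrying injectivity of \<^term>\<open>x\<close> through the arguments; it
  is recovered in \<open>int_independent_image\<close>.\<close>

definition family_independent :: "('a, 'c) monoid_scheme \<Rightarrow> 'i set \<Rightarrow> ('i \<Rightarrow> 'a) \<Rightarrow> bool" where
  "family_independent G I x \<longleftrightarrow> finite I \<and> x \<in> I \<rightarrow> carrier G \<and>
     (\<forall>c :: 'i \<Rightarrow> int. finprod G (\<lambda>i. x i [^]\<^bsub>G\<^esub> c i) I = \<one>\<^bsub>G\<^esub> \<longrightarrow> (\<forall>i\<in>I. c i = 0))"

lemma int_independent_iff_family: "int_independent G B \<longleftrightarrow> family_independent G B (\<lambda>x. x)"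
  by (auto simp: int_independent_def family_independent_def)

text \<open>A coincidence \<open>x i = x j\<close> would give a nontrivial relation with exponents 1
  and -1, so an independent family is injective.\<close>

lemma int_independent_image:
  fixes G :: "('a, 'c) monoid_scheme" and I :: "'i set"
  assumes "comm_group G" and ind: "family_independent G I x"
  shows "int_independent G (x ` I)" "card (x ` I) = card I"
proof -
  interpret G: comm_group G by fact
  have fin: "finite I" and x: "\<And>i. i \<in> I \<Longrightarrow> x i \<in> carrier G"
    and c: "\<And>c :: 'i \<Rightarrow> int. finprod G (\<lambda>i. x i [^]\<^bsub>G\<^esub> c i) I = \<one>\<^bsub>G\<^esub> \<Longrightarrow> \<forall>i\<in>I. c i = 0"
    using ind by (auto simp: family_independent_def)
  have inj: "inj_on x I"
  proof (rule inj_onI, rule ccontr)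
    fix i j assume ij: "i \<in> I" "j \<in> I" "x i = x j" "i \<noteq> j"
    define c' where "c' k = (if k = i then 1 else if k = j then -1 else (0::int))" for k
    have 0: "finprod G (\<lambda>k. x k [^]\<^bsub>G\<^esub> c' k) (I - {i} - {j}) = \<one>\<^bsub>G\<^esub>"
      by (rule G.finprod_one_eqI) (use ij x in \<open>auto simp: c'_def\<close>)
    have I: "I = insert i (insert j (I - {i} - {j}))" using ij by auto
    have "finprod G (\<lambda>k. x k [^]\<^bsub>G\<^esub> c' k) I =
        finprod G (\<lambda>k. x k [^]\<^bsub>G\<^esub> c' k) (insert i (insert j (I - {i} - {j})))" using I by simp
    also have "\<dots> = x i [^]\<^bsub>G\<^esub> c' i \<otimes>\<^bsub>G\<^esub> finprod G (\<lambda>k. x k [^]\<^bsub>G\<^esub> c' k) (insert j (I - {i} - {j}))"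
      by (rule G.finprod_insert) (use fin x ij in auto)
    also have "finprod G (\<lambda>k. x k [^]\<^bsub>G\<^esub> c' k) (insert j (I - {i} - {j})) =
        x j [^]\<^bsub>G\<^esub> c' j \<otimes>\<^bsub>G\<^esub> finprod G (\<lambda>k. x k [^]\<^bsub>G\<^esub> c' k) (I - {i} - {j})"
      by (rule G.finprod_insert) (use fin x ij in auto)
    also note 0
    also have "x i [^]\<^bsub>G\<^esub> c' i \<otimes>\<^bsub>G\<^esub> (x j [^]\<^bsub>G\<^esub> c' j \<otimes>\<^bsub>G\<^esub> \<one>\<^bsub>G\<^esub>) = x i [^]\<^bsub>G\<^esub> c' i \<otimes>\<^bsub>G\<^esub> x j [^]\<^bsub>G\<^esub> c' j"
      using x[OF ij(2)] by simp
    also have "\<dots> = \<one>\<^bsub>G\<^esub>" using x[OF ij(2)] ij by (simp add: c'_def G.int_pow_neg)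
    finally have "c' i = 0" using c ij by blast
    then show False by (simp add: c'_def)
  qed
  show "card (x ` I) = card I" using inj by (rule card_image)
  show "int_independent G (x ` I)"
    unfolding int_independent_def
  proof (intro conjI allI impI)
    fix d :: "'a \<Rightarrow> int" assume "finprod G (\<lambda>y. y [^]\<^bsub>G\<^esub> d y) (x ` I) = \<one>\<^bsub>G\<^esub>"
    then have "finprod G (\<lambda>i. x i [^]\<^bsub>G\<^esub> d (x i)) I = \<one>\<^bsub>G\<^esub>"
      using x inj by (subst (asm) G.finprod_reindex) auto
    then show "\<forall>y\<in>x ` I. d y = 0" using c[of "\<lambda>i. d (x i)"] by auto
  qed (use fin x in auto)
qed

text \<open>A relation among the \<open>z i\<close> is carried by \<open>f\<close> to one with the
  same exponents among their images.\<close>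

lemma family_independent_preimage:
  fixes A :: "('a, 'c) monoid_scheme" and G :: "('b, 'd) monoid_scheme" and I :: "'i set"
  assumes "comm_group A" "comm_group G" and f: "f \<in> hom A G" and z: "z \<in> I \<rightarrow> carrier A"
    and ind: "family_independent G I (\<lambda>i. f (z i))"
  shows "family_independent A I z"
  unfolding family_independent_def
proof (intro conjI allI impI)
  interpret A: comm_group A by fact
  interpret G: comm_group G by fact
  show "finite I" using ind by (simp add: family_independent_def)
  fix c :: "'i \<Rightarrow> int" assume 1: "finprod A (\<lambda>i. z i [^]\<^bsub>A\<^esub> c i) I = \<one>\<^bsub>A\<^esub>"
  have "f (finprod A (\<lambda>i. z i [^]\<^bsub>A\<^esub> c i) I) = finprod G (\<lambda>i. f (z i [^]\<^bsub>A\<^esub> c i)) I"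
    by (rule hom_finprod_comm[OF assms(1,2) f]) (use z in auto)
  also have "\<dots> = finprod G (\<lambda>i. f (z i) [^]\<^bsub>G\<^esub> c i) I"
  proof (rule G.finprod_cong')
    fix i assume "i \<in> I"
    then have "z i \<in> carrier A" using z by blast
    then show "f (z i [^]\<^bsub>A\<^esub> c i) = f (z i) [^]\<^bsub>G\<^esub> c i"
      by (rule hom_int_pow[OF f _ A.is_group G.is_group])
  qed (use z hom_in_carrier[OF f] in auto)
  finally have "finprod G (\<lambda>i. f (z i) [^]\<^bsub>G\<^esub> c i) I = \<one>\<^bsub>G\<^esub>"
    using 1 hom_one[OF f A.is_group G.is_group] by simp
  then show "\<forall>i\<in>I. c i = 0" using ind by (simp add: family_independent_def)
qed (use z in auto)

text \<open>A rank attained as a maximum, which transfers through isomorphisms and extensions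
  without suprema in \<open>enat\<close>.\<close>

definition has_rank :: "('a, 'c) monoid_scheme \<Rightarrow> nat \<Rightarrow> bool" where
  "has_rank G k \<longleftrightarrow> (\<exists>B. int_independent G B \<and> card B = k) \<and> (\<forall>B. int_independent G B \<longrightarrow> card B \<le> k)"

lemma abelian_rank_eqI:
  assumes "has_rank G k" shows "abelian_rank G = enat k"
proof -
  obtain B where "int_independent G B" "card B = k" using assms by (auto simp: has_rank_def)
  then have "enat k \<le> abelian_rank G"
    unfolding abelian_rank_def by (intro SUP_upper2[of B]) auto
  moreover have "abelian_rank G \<le> enat k"
    unfolding abelian_rank_def using assms by (intro SUP_least) (auto simp: has_rank_def)
  ultimately show ?thesis by simp
qed

lemma has_rank_trivial:
  fixes G :: "('a, 'c) monoid_scheme"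
  assumes "trivial_group G" shows "has_rank G 0"
proof -
  interpret group G using assms by (simp add: trivial_group_def)
  have "card B = 0" if "int_independent G B" for B
  proof -
    have fin: "finite B" "B \<subseteq> {\<one>\<^bsub>G\<^esub>}" using that assms by (auto simp: int_independent_def trivial_group_def)
    have "finprod G (\<lambda>x. x [^]\<^bsub>G\<^esub> (1::int)) B = \<one>\<^bsub>G\<^esub>"
    proof -
      interpret comm_group G
        using assms by unfold_locales (auto simp: trivial_group_def)
      show ?thesis by (rule finprod_one_eqI) (use fin in auto)
    qed
    moreover have c: "finprod G (\<lambda>x. x [^]\<^bsub>G\<^esub> c x) B = \<one>\<^bsub>G\<^esub> \<Longrightarrow> \<forall>x\<in>B. c x = 0" for c :: "'a \<Rightarrow> int"
      using that unfolding int_independent_def by blast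
    ultimately have "\<forall>x\<in>B. (1::int) = 0" using c[of "\<lambda>_. 1"] by simp
    then show ?thesis by auto
  qed
  moreover have "int_independent G {}" by (simp add: int_independent_def)
  ultimately show ?thesis unfolding has_rank_def by (metis card.empty le_zero_eq)
qed

lemma int_independent_iso:
  fixes L :: "('a, 'c) monoid_scheme" and M :: "('b, 'd) monoid_scheme"
  assumes "comm_group L" "comm_group M" "L \<cong> M" and ind: "int_independent L B"
  shows "\<exists>B'. int_independent M B' \<and> card B' = card B"
proof -
  interpret L: comm_group L by fact
  interpret M: comm_group M by fact
  obtain h where h: "h \<in> iso L M" using assms(3) by (auto simp: is_iso_def)
  define h' where "h' = inv_into (carrier L) h"
  have h': "h' \<in> iso M L" unfolding h'_def using L.iso_set_sym[OF h] .
  then have hh: "h' \<in> hom M L" by (simp add: iso_def)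
  have B: "B \<subseteq> carrier L" using ind by (simp add: int_independent_def)
  have eq: "h' (h b) = b" if "b \<in> carrier L" for b
    using h that by (simp add: h'_def iso_def bij_betw_def)
  have "finprod L (\<lambda>b. h' (h b) [^]\<^bsub>L\<^esub> c b) B = finprod L (\<lambda>b. b [^]\<^bsub>L\<^esub> c b) B" for c :: "'a \<Rightarrow> int"
    by (intro L.finprod_cong') (use B in \<open>auto simp: eq subset_iff\<close>)
  moreover have "(\<lambda>b. h' (h b)) \<in> B \<rightarrow> carrier L" using B eq by auto
  ultimately have "family_independent L B (\<lambda>b. h' (h b))"
    using ind by (simp add: int_independent_def family_independent_def)
  moreover have "h \<in> B \<rightarrow> carrier M" using h B by (auto simp: iso_def hom_def)
  ultimately have "family_independent M B h"
    using family_independent_preimage[OF assms(2,1) hh] by blast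
  then show ?thesis using int_independent_image[OF assms(2)] by blast
qed

lemma has_rank_iso:
  assumes G: "comm_group G" and H: "comm_group H" and "G \<cong> H" "has_rank G k"
  shows "has_rank H k"
proof -
  interpret G: comm_group G by fact
  show ?thesis
    using assms(4) int_independent_iso[OF G H assms(3)] int_independent_iso[OF H G G.iso_sym[OF assms(3)]]
    unfolding has_rank_def by metis
qed

text \<open>Rank is additive for an extension of the integers by \<open>A\<close>. For the upper
  bound, one element outside the kernel of \<open>g\<close> serves to eliminate \<open>g\<close>
  from all others; for the lower bound, a preimage of 1 is adjoined to the image of a maximal
  independent set of \<open>A\<close>.\<close>

lemma has_rank_extension:
  fixes A :: "('a, 'c) monoid_scheme" and G :: "('b, 'd) monoid_scheme"
  assumes A: "comm_group A" and G: "comm_group G" and f: "f \<in> hom A G" "inj_on f (carrier A)"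
    and g: "g \<in> hom G integer_group" "g ` carrier G = UNIV"
    and ker: "kernel G integer_group g = f ` carrier A" and rank: "has_rank A k"
  shows "has_rank G (Suc k)"
proof -
  interpret A: comm_group A by fact
  interpret G: comm_group G by fact
  have g_mult: "g (x \<otimes>\<^bsub>G\<^esub> y) = g x + g y" if "x \<in> carrier G" "y \<in> carrier G" for x y
    using hom_mult[OF g(1) that] by simp
  have g_pow: "g (x [^]\<^bsub>G\<^esub> c) = c * g x" if "x \<in> carrier G" for x and c :: int
    using hom_int_pow[OF g(1) that G.is_group group_integer_group] by simp
  have g_ker: "x \<in> f ` carrier A" if "x \<in> carrier G" "g x = 0" for x
    using that ker by (auto simp: kernel_def)
  have gf: "g (f a) = 0" if "a \<in> carrier A" for a
    using that ker by (auto simp: kernel_def)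
  have fc: "f a \<in> carrier G" if "a \<in> carrier A" for a using f(1) that by (rule hom_in_carrier)
  have bound: "card I \<le> k" if "family_independent G I y" "\<And>i. i \<in> I \<Longrightarrow> g (y i) = 0" for I :: "'b set" and y
  proof -
    have y: "\<exists>a\<in>carrier A. y i = f a" if "i \<in> I" for i
      using \<open>family_independent G I y\<close> that \<open>\<And>i. i \<in> I \<Longrightarrow> g (y i) = 0\<close> g_ker[of "y i"]
      by (auto simp: family_independent_def)
    then obtain z where z: "\<And>i. i \<in> I \<Longrightarrow> z i \<in> carrier A \<and> y i = f (z i)" by metis
    have "finprod G (\<lambda>i. f (z i) [^]\<^bsub>G\<^esub> c i) I = finprod G (\<lambda>i. y i [^]\<^bsub>G\<^esub> c i) I" for c :: "'b \<Rightarrow> int"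
      using z fc by (intro G.finprod_cong') auto
    then have "family_independent G I (\<lambda>i. f (z i))"
      using that(1) z fc by (auto simp: family_independent_def)
    then have "family_independent A I z" using z by (intro family_independent_preimage[OF A G f(1)]) auto
    then show ?thesis using int_independent_image[OF A] rank unfolding has_rank_def by metis
  qed
  have "card B \<le> Suc k" if B: "int_independent G B" for B
  proof (cases "\<forall>x\<in>B. g x = 0")
    case True
    then show ?thesis using bound[of B "\<lambda>x. x"] B by (simp add: int_independent_iff_family)
  next
    case False
    then obtain w where w: "w \<in> B" "g w \<noteq> 0" by blast
    have finB: "finite B" and Bc: "B \<subseteq> carrier G" using B by (auto simp: int_independent_def)
    then have wc: "w \<in> carrier G" using w by blast
    \<comment> \<open>Cross multiplication as in Gaussian elimination:
      \<open>g (y x) = g w * g x - g x * g w = 0\<close>.\<close>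
    define y where "y x = x [^]\<^bsub>G\<^esub> g w \<otimes>\<^bsub>G\<^esub> w [^]\<^bsub>G\<^esub> (- g x)" for x
    have yc: "y x \<in> carrier G" if "x \<in> B" for x using that Bc wc by (auto simp: y_def)
    have gy: "g (y x) = 0" if "x \<in> B" for x
      using that Bc wc by (auto simp: y_def g_mult g_pow subset_iff)
    have "family_independent G (B - {w}) y"
      unfolding family_independent_def
    proof (intro conjI allI impI)
      fix c :: "'b \<Rightarrow> int" assume 1: "finprod G (\<lambda>x. y x [^]\<^bsub>G\<^esub> c x) (B - {w}) = \<one>\<^bsub>G\<^esub>"
      define s where "s = (\<Sum>x\<in>B - {w}. - g x * c x)"
      have w_sum: "finprod G (\<lambda>x. w [^]\<^bsub>G\<^esub> e x) S = w [^]\<^bsub>G\<^esub> sum e S" if "finite S" for e :: "'b \<Rightarrow> int" and S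
        using that by (induction S) (auto simp: wc G.int_pow_mult)
      have "y x [^]\<^bsub>G\<^esub> c x = x [^]\<^bsub>G\<^esub> (g w * c x) \<otimes>\<^bsub>G\<^esub> w [^]\<^bsub>G\<^esub> (- g x * c x)" if "x \<in> B" for x
        using that Bc wc by (auto simp: y_def G.int_pow_distrib G.int_pow_pow subset_iff)
      then have "finprod G (\<lambda>x. y x [^]\<^bsub>G\<^esub> c x) (B - {w}) =
          finprod G (\<lambda>x. x [^]\<^bsub>G\<^esub> (g w * c x) \<otimes>\<^bsub>G\<^esub> w [^]\<^bsub>G\<^esub> (- g x * c x)) (B - {w})"
        using Bc wc by (intro G.finprod_cong') auto
      also have "\<dots> = finprod G (\<lambda>x. x [^]\<^bsub>G\<^esub> (g w * c x)) (B - {w}) \<otimes>\<^bsub>G\<^esub>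
          finprod G (\<lambda>x. w [^]\<^bsub>G\<^esub> (- g x * c x)) (B - {w})"
        using Bc wc by (intro G.finprod_multf) auto
      also have "finprod G (\<lambda>x. w [^]\<^bsub>G\<^esub> (- g x * c x)) (B - {w}) = w [^]\<^bsub>G\<^esub> s"
        unfolding s_def using finB by (intro w_sum) auto
      finally have 2: "w [^]\<^bsub>G\<^esub> s \<otimes>\<^bsub>G\<^esub> finprod G (\<lambda>x. x [^]\<^bsub>G\<^esub> (g w * c x)) (B - {w}) = \<one>\<^bsub>G\<^esub>"
        using 1 Bc wc by (subst G.m_comm) (auto intro!: G.finprod_closed)
      \<comment> \<open>The relation among the \<open>y x\<close>, rewritten over \<open>B\<close>:
        the powers of \<open>w\<close> collect to the exponent \<open>s\<close>, and
        \<open>x\<close> gets \<open>g w * c x\<close>. As \<open>g w \<noteq> 0\<close>, vanishing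
        of \<open>c'\<close> forces vanishing of \<open>c\<close>.\<close>
      define c' where "c' x = (if x = w then s else g w * c x)" for x
      have "finprod G (\<lambda>x. x [^]\<^bsub>G\<^esub> c' x) (insert w (B - {w})) =
          w [^]\<^bsub>G\<^esub> c' w \<otimes>\<^bsub>G\<^esub> finprod G (\<lambda>x. x [^]\<^bsub>G\<^esub> c' x) (B - {w})"
        using finB Bc wc by (intro G.finprod_insert) auto
      also have "finprod G (\<lambda>x. x [^]\<^bsub>G\<^esub> c' x) (B - {w}) = finprod G (\<lambda>x. x [^]\<^bsub>G\<^esub> (g w * c x)) (B - {w})"
        using Bc by (intro G.finprod_cong') (auto simp: c'_def)
      finally have "finprod G (\<lambda>x. x [^]\<^bsub>G\<^esub> c' x) B = \<one>\<^bsub>G\<^esub>"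
        using 2 w(1) by (simp add: c'_def insert_absorb)
      then have c'0: "\<forall>x\<in>B. c' x = 0" using B by (simp add: int_independent_def)
      show "\<forall>x\<in>B - {w}. c x = 0"
      proof
        fix x assume "x \<in> B - {w}"
        then have "c' x = 0" "c' x = g w * c x" using c'0 by (auto simp: c'_def)
        then show "c x = 0" using w(2) by simp
      qed
    qed (use finB yc in auto)
    then have "card (B - {w}) \<le> k" by (rule bound) (use gy in auto)
    then show ?thesis using w(1) finB by (simp add: card_Diff_singleton)
  qed
  moreover have "\<exists>B. int_independent G B \<and> card B = Suc k"
  proof -
    obtain B where B: "int_independent A B" "card B = k" using rank by (auto simp: has_rank_def)
    have finB: "finite B" and Bc: "B \<subseteq> carrier A" using B by (auto simp: int_independent_def)
    obtain w where w: "w \<in> carrier G" "g w = 1" using g(2) by (metis UNIV_I image_iff)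
    define x where "x i = (case i of None \<Rightarrow> w | Some b \<Rightarrow> f b)" for i
    let ?I = "insert None (Some ` B)"
    have xc: "x i \<in> carrier G" if "i \<in> ?I" for i using that w Bc fc by (auto simp: x_def)
    have "family_independent G ?I x"
      unfolding family_independent_def
    proof (intro conjI allI impI)
      fix c :: "'a option \<Rightarrow> int" assume 1: "finprod G (\<lambda>i. x i [^]\<^bsub>G\<^esub> c i) ?I = \<one>\<^bsub>G\<^esub>"
      let ?a = "finprod A (\<lambda>b. b [^]\<^bsub>A\<^esub> c (Some b)) B"
      have ac: "?a \<in> carrier A" using Bc by (intro A.finprod_closed) auto
      have "f ?a = finprod G (\<lambda>b. f (b [^]\<^bsub>A\<^esub> c (Some b))) B"
        by (rule hom_finprod_comm[OF A G f(1)]) (use Bc in auto)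
      also have "\<dots> = finprod G (\<lambda>b. f b [^]\<^bsub>G\<^esub> c (Some b)) B"
        using Bc fc by (intro G.finprod_cong') (auto simp: hom_int_pow[OF f(1) _ A.is_group G.is_group] subset_iff)
      also have "\<dots> = finprod G (\<lambda>i. x i [^]\<^bsub>G\<^esub> c i) (Some ` B)"
        using Bc fc by (subst G.finprod_reindex) (auto simp: x_def)
      finally have fa: "f ?a = finprod G (\<lambda>i. x i [^]\<^bsub>G\<^esub> c i) (Some ` B)" .
      have "finprod G (\<lambda>i. x i [^]\<^bsub>G\<^esub> c i) ?I = x None [^]\<^bsub>G\<^esub> c None \<otimes>\<^bsub>G\<^esub> finprod G (\<lambda>i. x i [^]\<^bsub>G\<^esub> c i) (Some ` B)"
        using finB xc by (intro G.finprod_insert) auto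
      then have 2: "w [^]\<^bsub>G\<^esub> c None \<otimes>\<^bsub>G\<^esub> f ?a = \<one>\<^bsub>G\<^esub>" using 1 fa by (simp add: x_def)
      \<comment> \<open>Applying \<open>g\<close> kills the part that comes from \<open>A\<close>
        and isolates the exponent of \<open>w\<close>.\<close>
      then have "g (w [^]\<^bsub>G\<^esub> c None \<otimes>\<^bsub>G\<^esub> f ?a) = 0" using hom_one[OF g(1) G.is_group] by simp
      then have c0: "c None = 0" using w fc[OF ac] gf[OF ac] by (simp add: g_mult g_pow)
      then have "f ?a = f \<one>\<^bsub>A\<^esub>" using 2 w fc[OF ac] hom_one[OF f(1) A.is_group G.is_group] by simp
      then have "?a = \<one>\<^bsub>A\<^esub>" using f(2) ac by (auto dest: inj_onD)
      moreover have ind: "finprod A (\<lambda>b. b [^]\<^bsub>A\<^esub> e b) B = \<one>\<^bsub>A\<^esub> \<Longrightarrow> \<forall>b\<in>B. e b = 0" for e :: "'a \<Rightarrow> int"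
        using B(1) unfolding int_independent_def by blast
      ultimately have "\<forall>b\<in>B. c (Some b) = 0" using ind[of "\<lambda>b. c (Some b)"] by simp
      then show "\<forall>i\<in>?I. c i = 0" using c0 by auto
    qed (use finB xc in auto)
    moreover have "card ?I = Suc k" using B(2) finB by (simp add: card_image)
    ultimately show ?thesis using int_independent_image[OF G] by metis
  qed
  ultimately show ?thesis by (simp add: has_rank_def)
qed

section \<open>Homology of a contractible complex with simplices attached\<close>

lemma comm_group_reduced_homology_group: "comm_group (reduced_homology_group p X)"
  unfolding reduced_homology_group_def
  by (rule group.abelian_subgroup_generated[OF group_relative_homology_group abelian_homology_group])

lemma complex_on_Diff_maximal:
  assumes "complex_on V K" "\<And>\<sigma> S. \<sigma> \<in> B \<Longrightarrow> S \<in> K \<Longrightarrow> \<sigma> \<subseteq> S \<Longrightarrow> S = \<sigma>"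
  shows "complex_on V (K - B)"
  using assms by (auto simp: complex_on_def)

text \<open>The homology of a simplex relative to the complement of its barycenter, written with the open
  simplex so that it only depends on \<^term>\<open>\<sigma>\<close> and not on the surrounding complex.\<close>

definition local_homology :: "int \<Rightarrow> 'a set \<Rightarrow> ('a \<Rightarrow> real) chain set monoid" where
  "local_homology p \<sigma> = relative_homology_group p (top_of_set (realization_set {\<sigma>})) (realization_set {\<sigma>} - {barycenter \<sigma>})"

text \<open>Excising the closed subcomplex \<open>K - {\<sigma>}\<close>, which lies in the open
  complement of the barycenter, leaves just the open simplex.\<close>

lemma relative_homology_maximal_face:
  assumes K: "complex_on V K" and s: "\<sigma> \<in> K" "\<sigma> \<noteq> {}"
    and max: "\<And>S. S \<in> K \<Longrightarrow> \<sigma> \<subseteq> S \<Longrightarrow> S = \<sigma>"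
  shows "local_homology p \<sigma> \<cong>
    relative_homology_group p (top_of_set (realization_set K)) (realization_set K - {barycenter \<sigma>})"
proof -
  let ?X = "realization_set K" and ?U = "realization_set (K - {\<sigma>})" and ?c = "barycenter \<sigma>"
  have K': "complex_on V (K - {\<sigma>})" using complex_on_Diff_maximal[OF K, of "{\<sigma>}"] max by blast
  have UX: "?U \<subseteq> ?X" by (intro realization_set_mono) blast
  have "finite \<sigma>" using complex_onD(3)[OF K s(1)] .
  then have "card \<sigma> > 0" using s by (simp add: card_gt_0_iff)
  then have cU: "?c \<notin> ?U" by (auto simp: realization_set_def barycenter_def)
  have "closedin (top_of_set ?X) ?U" using closed_realization_set[OF K'] UX by (simp add: closed_subset)
  then have "top_of_set ?X closure_of ?U = ?U" by (simp add: closure_of_closedin)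
  moreover have "openin (top_of_set ?X) (?X - {?c})"
  proof -
    have "{?c} = (\<Inter>v. {x. x v = ?c v})" by auto
    moreover have "closed (\<Inter>v. {x. x v = ?c v})"
      by (intro closed_INT ballI closed_Collect_eq continuous_on_product_coordinates continuous_on_const)
    ultimately have "closed {?c}" by simp
    then show ?thesis by (simp add: Diff_eq openin_open_Int open_Compl)
  qed
  then have "top_of_set ?X interior_of (?X - {?c}) = ?X - {?c}" by (simp add: interior_of_openin)
  ultimately have "top_of_set ?X closure_of ?U \<subseteq> top_of_set ?X interior_of (?X - {?c})"
    using UX cU by auto
  then have *: "hom_induced p (subtopology (top_of_set ?X) (?X - ?U)) (?X - {?c} - ?U)
      (subtopology (top_of_set ?X) ?X) (?X - {?c}) id
    \<in> iso (relative_homology_group p (subtopology (top_of_set ?X) (?X - ?U)) (?X - {?c} - ?U))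
          (relative_homology_group p (subtopology (top_of_set ?X) ?X) (?X - {?c}))"
    by (rule homology_excision_axiom) blast
  have 1: "?X - ?U = realization_set {\<sigma>}" using s by (auto simp: realization_set_def)
  have 2: "?X - {?c} - ?U = realization_set {\<sigma>} - {?c}" using 1 by blast
  have 3: "subtopology (top_of_set ?X) (realization_set {\<sigma>}) = top_of_set (realization_set {\<sigma>})"
    using 1 by (metis Diff_subset inf.absorb_iff2 subtopology_subtopology)
  show ?thesis
    using is_isoI[OF *[unfolded 2, unfolded 1 3]] by (simp add: local_homology_def subtopology_subtopology)
qed

lemma group_local_homology [simp]: "group (local_homology p \<sigma>)"
  by (simp add: local_homology_def)

lemma trivial_groups_isomorphic:
  assumes "trivial_group G" "trivial_group H" shows "G \<cong> H"
proof -
  have "(\<lambda>_. \<one>\<^bsub>H\<^esub>) \<in> iso G H"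
    using assms group.is_monoid[of H]
    by (auto simp: trivial_group_def iso_def hom_def bij_betw_def monoid.l_one monoid.one_closed)
  then show ?thesis by (rule is_isoI)
qed

lemma local_homology_singleton:
  "local_homology p {v} \<cong> (if p = 0 then integer_group else singleton_group 0)"
proof -
  let ?x = "barycenter {v}"
  have "realization_set {{v}} = {?x}"
  proof
    show "{?x} \<subseteq> realization_set {{v}}" by (auto simp: realization_set_def barycenter_def)
    show "realization_set {{v}} \<subseteq> {?x}"
    proof
      fix x assume x: "x \<in> realization_set {{v}}"
      then have s: "{w. x w \<noteq> 0} = {v}" "(\<Sum>w | x w \<noteq> 0. x w) = 1" by (auto simp: realization_set_def)
      then have "x v = 1" "\<And>w. w \<noteq> v \<Longrightarrow> x w = 0" by auto
      then show "x \<in> {?x}" by (auto simp: barycenter_def)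
    qed
  qed
  then have eq: "local_homology p {v} = homology_group p (top_of_set {?x})"
    by (simp add: local_homology_def)
  show ?thesis
  proof (cases "p = 0")
    case True
    then show ?thesis unfolding eq using homology_coefficients[of "top_of_set {?x}" ?x] by simp
  next
    case False
    have "trivial_group (reduced_homology_group p (top_of_set {?x}))"
      by (rule homology_dimension_reduced) simp
    then have "trivial_group (homology_group p (top_of_set {?x}))"
      using un_reduced_homology_group[OF False] by metis
    then show ?thesis using False unfolding eq by (simp add: trivial_groups_isomorphic)
  qed
qed

text \<open>Induction on the vertices, without computing the homology of spheres. The simplex on
  \<open>insert v \<tau>\<close> is contractible and its puncture retracts to the boundary, so the
  degree drops by one. The boundary punctured in the face \<open>\<tau>\<close> retracts to a cone
  with apex \<open>v\<close>, so the reduced homology of the boundary is the local homology of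
  \<open>\<tau>\<close>.\<close>

lemma local_homology:
  assumes "finite \<sigma>" "\<sigma> \<noteq> {}"
  shows "local_homology p \<sigma> \<cong> (if p = int (card \<sigma>) - 1 then integer_group else singleton_group 0)"
  using assms
proof (induction \<sigma> arbitrary: p rule: finite_ne_induct)
  case (singleton v)
  show ?case using local_homology_singleton[of p v] by simp
next
  case (insert v \<tau>)
  let ?\<sigma> = "insert v \<tau>" and ?K = "Pow (insert v \<tau>)"
  let ?L = "?K - {?\<sigma>}"
  let ?X = "realization_set ?K" and ?S = "realization_set ?K - {barycenter ?\<sigma>}"
  let ?Y = "realization_set ?L" and ?T = "realization_set ?L - {barycenter \<tau>}"
  have K: "complex_on ?\<sigma> ?K" using insert by (auto simp: complex_on_def)
  have L: "complex_on ?\<sigma> ?L" by (rule complex_on_Diff_maximal[OF K]) auto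
  have LL: "complex_on ?\<sigma> (?L - {\<tau>})" by (rule complex_on_Diff_maximal[OF L]) auto
  \<comment> \<open>The vertex \<open>v\<close> as a point: it witnesses that both punctured spaces
    are nonempty, as the comparison of relative with reduced homology requires.\<close>
  define \<delta> where "\<delta> = (\<lambda>w. if w = v then 1 else 0::real)"
  have supp: "{w. \<delta> w \<noteq> 0} = {v}" by (auto simp: \<delta>_def)
  have \<delta>: "\<delta> \<in> realization_set M" if "{v} \<in> M" for M
    using that supp by (simp add: realization_set_def) (simp add: \<delta>_def)
  have card: "card ?\<sigma> \<ge> 2" using insert by (simp add: Suc_le_eq card_gt_0_iff)
  have "\<delta> \<noteq> barycenter ?\<sigma>"
  proof
    assume "\<delta> = barycenter ?\<sigma>"
    then have "\<delta> v = barycenter ?\<sigma> v" by simp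
    then show False using card by (simp add: \<delta>_def barycenter_def)
  qed
  then have "\<delta> \<in> ?S" using \<delta>[of ?K] by blast
  then have neS: "topspace (top_of_set ?X) \<inter> ?S \<noteq> {}" by auto
  have "\<delta> \<noteq> barycenter \<tau>"
  proof
    assume "\<delta> = barycenter \<tau>"
    then have "\<delta> v = barycenter \<tau> v" by simp
    then show False using insert by (simp add: \<delta>_def barycenter_def)
  qed
  moreover have "{v} \<in> ?L" using insert by auto
  ultimately have "\<delta> \<in> ?T" using \<delta>[of ?L] by blast
  then have neT: "topspace (top_of_set ?Y) \<inter> ?T \<noteq> {}" by auto
  have subS: "subtopology (top_of_set ?X) ?S = top_of_set ?S"
    by (simp add: subtopology_subtopology Int_absorb1)
  have subT: "subtopology (top_of_set ?Y) ?T = top_of_set ?T"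
    by (simp add: subtopology_subtopology Int_absorb1)
  have "local_homology p ?\<sigma> \<cong> relative_homology_group p (top_of_set ?X) ?S"
    by (rule relative_homology_maximal_face[OF K]) auto
  also have "\<dots> \<cong> reduced_homology_group (p - 1) (subtopology (top_of_set ?X) ?S)"
    by (rule isomorphic_group_relative_homology_of_contractible[OF _ neS])
      (rule cone_contractible[OF K, of v], auto)
  also have "\<dots> = reduced_homology_group (p - 1) (top_of_set ?S)" by (simp only: subS)
  also have "\<dots> \<cong> reduced_homology_group (p - 1) (top_of_set ?Y)"
    by (intro homotopy_equivalent_space_imp_isomorphic_reduced_homology_groups
        puncture_homotopy_equivalent[OF K]) auto
  also have "\<dots> \<cong> relative_homology_group (p - 1) (top_of_set ?Y) ?T"
  proof (rule isomorphic_reduced_homology_by_contractible[OF _ neT])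
    have "top_of_set ?T homotopy_equivalent_space top_of_set (realization_set (?L - {\<tau>}))"
      by (rule puncture_homotopy_equivalent[OF L]) (use insert in auto)
    moreover have "contractible_space (top_of_set (realization_set (?L - {\<tau>})))"
    \<comment> \<open>With the full simplex and its face opposite \<open>v\<close> both gone, adding
      \<open>v\<close> to a face never leaves the complex.\<close>
    proof (rule cone_contractible[OF LL])
      fix S assume S: "S \<in> ?L - {\<tau>}"
      have "insert v S \<noteq> ?\<sigma>"
      proof
        assume eq: "insert v S = ?\<sigma>"
        show False
        proof (cases "v \<in> S")
          case True then show False using S eq by (simp add: insert_absorb)
        next
          case False then show False using S eq insert.hyps(3) by (simp add: insert_ident)
        qed
      qed
      moreover have "insert v S \<noteq> \<tau>" using insert.hyps(3) by blast
      ultimately show "insert v S \<in> ?L - {\<tau>}" using S by auto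
    qed
    ultimately show "contractible_space (subtopology (top_of_set ?Y) ?T)"
      unfolding subT using homotopy_equivalent_space_contractibility by blast
  qed
  also have "\<dots> \<cong> local_homology (p - 1) \<tau>"
    by (rule group.iso_sym, simp, rule relative_homology_maximal_face[OF L]) (use insert in auto)
  also have "\<dots> \<cong> (if p - 1 = int (card \<tau>) - 1 then integer_group else singleton_group 0)"
    by (rule insert.IH)
  also have "\<dots> = (if p = int (card ?\<sigma>) - 1 then integer_group else singleton_group 0)"
    using insert by simp
  finally show ?case .
qed

text \<open>Attaching \<open>\<sigma>\<close> gives a pair whose relative homology is the integers
  in degree \<open>d\<close> and trivial elsewhere, and whose subspace, the puncture, has the
  homology of \<open>K - {\<sigma>}\<close>. In degree \<open>d\<close> the long exact sequence
  becomes a short one ending in the integers, so the rank grows by one.\<close>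

theorem reduced_homology_maximal_faces:
  assumes "finite B" "complex_on V K" "B \<subseteq> K" and card: "\<And>\<sigma>. \<sigma> \<in> B \<Longrightarrow> card \<sigma> = Suc d"
    and "\<And>\<sigma> S. \<sigma> \<in> B \<Longrightarrow> S \<in> K \<Longrightarrow> \<sigma> \<subseteq> S \<Longrightarrow> S = \<sigma>"
    and "contractible_space (top_of_set (realization_set (K - B)))" "realization_set (K - B) \<noteq> {}"
  shows "(\<forall>p. p \<noteq> int d \<longrightarrow> trivial_group (reduced_homology_group p (top_of_set (realization_set K)))) \<and>
    has_rank (reduced_homology_group (int d) (top_of_set (realization_set K))) (card B)"
  using assms
proof (induction B arbitrary: K rule: finite_induct)
  case empty
  then show ?case
    by (simp add: trivial_reduced_homology_group_contractible_space has_rank_trivial)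
next
  case (insert \<sigma> B)
  let ?L = "K - {\<sigma>}"
  let ?X = "top_of_set (realization_set K)" and ?S = "realization_set K - {barycenter \<sigma>}"
  note K = \<open>complex_on V K\<close>
  have s: "\<sigma> \<in> K" "\<sigma> \<noteq> {}" "finite \<sigma>" "card \<sigma> = Suc d"
    using insert.prems(2) insert.prems(3)[of \<sigma>] complex_onD(3)[OF K, of \<sigma>] by auto
  have max: "\<And>S. S \<in> K \<Longrightarrow> \<sigma> \<subseteq> S \<Longrightarrow> S = \<sigma>" using insert.prems(4) by blast
  have L: "complex_on V ?L" by (rule complex_on_Diff_maximal[OF K]) (use max in blast)
  have KL: "?L - B = K - insert \<sigma> B" by blast
  have IH: "(\<forall>p. p \<noteq> int d \<longrightarrow> trivial_group (reduced_homology_group p (top_of_set (realization_set ?L)))) \<and>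
      has_rank (reduced_homology_group (int d) (top_of_set (realization_set ?L))) (card B)"
  proof (rule insert.IH[OF L])
    show "B \<subseteq> ?L" using insert by blast
    show "card \<tau> = Suc d" if "\<tau> \<in> B" for \<tau> using insert.prems(3) that by blast
    show "S = \<tau>" if "\<tau> \<in> B" "S \<in> ?L" "\<tau> \<subseteq> S" for \<tau> S using insert.prems(4) that by blast
  qed (use insert.prems KL in auto)
  have subS: "subtopology ?X ?S = top_of_set ?S"
    by (simp add: subtopology_subtopology Int_absorb1)
  have "top_of_set ?S homotopy_equivalent_space top_of_set (realization_set ?L)"
    by (rule puncture_homotopy_equivalent[OF K s(1,2) max])
  then have iso: "reduced_homology_group p (subtopology ?X ?S) \<cong> reduced_homology_group p (top_of_set (realization_set ?L))" for p
    unfolding subS by (rule homotopy_equivalent_space_imp_isomorphic_reduced_homology_groups)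
  have trivS: "trivial_group (reduced_homology_group p (subtopology ?X ?S))" if "p \<noteq> int d" for p
    using IH isomorphic_group_triviality[OF iso] that by simp
  have rankS: "has_rank (reduced_homology_group (int d) (subtopology ?X ?S)) (card B)"
    by (rule has_rank_iso[OF comm_group_reduced_homology_group comm_group_reduced_homology_group
          group.iso_sym[OF group_reduced_homology_group iso] conjunct2[OF IH]])
  have "realization_set ?L \<noteq> {}" using insert.prems(6) realization_set_mono[of "K - insert \<sigma> B" ?L] by blast
  moreover have "realization_set ?L \<subseteq> ?S"
    using s realization_set_mono[of ?L K] by (auto simp: realization_set_def barycenter_def)
  ultimately have ne: "topspace ?X \<inter> ?S \<noteq> {}" by auto
  have rel: "relative_homology_group p ?X ?S \<cong> (if p = int d then integer_group else singleton_group 0)" for p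
  proof -
    have "relative_homology_group p ?X ?S \<cong> local_homology p \<sigma>"
      by (rule group.iso_sym, simp, rule relative_homology_maximal_face[OF K s(1,2) max])
    also have "\<dots> \<cong> (if p = int d then integer_group else singleton_group 0)"
      using local_homology[OF s(3,2), of p] s(4) by simp
    finally show ?thesis .
  qed
  have trivR: "trivial_group (relative_homology_group p ?X ?S)" if "p \<noteq> int d" for p
    using isomorphic_group_triviality[OF rel[of p]] that by simp
  let ?f = "\<lambda>p. hom_induced p (subtopology ?X ?S) {} ?X {} id" and ?g = "\<lambda>p. hom_induced p ?X {} ?X ?S id"
  have ex3: "?f p \<in> hom (reduced_homology_group p (subtopology ?X ?S)) (reduced_homology_group p ?X)"
    "?g p \<in> hom (reduced_homology_group p ?X) (relative_homology_group p ?X ?S)"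
    "kernel (reduced_homology_group p ?X) (relative_homology_group p ?X ?S) (?g p) =
      ?f p ` carrier (reduced_homology_group p (subtopology ?X ?S))" for p
    using homology_exactness_reduced_3[of p ?X ?S] by (simp_all add: group_hom_def group_hom_axioms_def)
  have ex1: "kernel (relative_homology_group p ?X ?S) (reduced_homology_group (p - 1) (subtopology ?X ?S))
      (hom_boundary p ?X ?S) = ?g p ` carrier (reduced_homology_group p ?X)"
    "hom_boundary p ?X ?S \<in> hom (relative_homology_group p ?X ?S) (reduced_homology_group (p - 1) (subtopology ?X ?S))" for p
    using homology_exactness_reduced_1[OF ne, of p] by (simp_all add: hom_boundary_reduced_hom)
  have ex2: "kernel (reduced_homology_group (p - 1) (subtopology ?X ?S)) (reduced_homology_group (p - 1) ?X) (?f (p - 1)) =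
      hom_boundary p ?X ?S ` carrier (relative_homology_group p ?X ?S)" for p
    using homology_exactness_reduced_2[of p ?X ?S] by simp
  show ?case
  proof (intro conjI allI impI)
    fix p assume p: "p \<noteq> int d"
    \<comment> \<open>Outside degree \<open>d\<close> exactness squeezes the group between two
      trivial ones.\<close>
    have "carrier (reduced_homology_group p ?X) =
        kernel (reduced_homology_group p ?X) (relative_homology_group p ?X ?S) (?g p)"
      using group_hom.kernel_to_trivial_group[of "reduced_homology_group p ?X" "relative_homology_group p ?X ?S" "?g p"]
        trivR[OF p] ex3(2)[of p] by (simp add: group_hom_def group_hom_axioms_def)
    also have "\<dots> = {\<one>\<^bsub>reduced_homology_group p ?X\<^esub>}"
      using group_hom.image_from_trivial_group[of "reduced_homology_group p (subtopology ?X ?S)" "reduced_homology_group p ?X" "?f p"]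
        trivS[OF p] ex3(1)[of p] ex3(3)[of p] by (simp add: group_hom_def group_hom_axioms_def)
    finally show "trivial_group (reduced_homology_group p ?X)" by (simp add: trivial_group_def)
  next
    let ?p = "int d"
    let ?A = "reduced_homology_group ?p (subtopology ?X ?S)" and ?G = "reduced_homology_group ?p ?X"
      and ?R = "relative_homology_group ?p ?X ?S"
    have f: "group_hom ?A ?G (?f ?p)" using ex3(1)[of ?p] by (simp add: group_hom_def group_hom_axioms_def)
    have bd: "group_hom (relative_homology_group (?p + 1) ?X ?S) ?A (hom_boundary (?p + 1) ?X ?S)"
      using ex1(2)[of "?p + 1"] by (simp add: group_hom_def group_hom_axioms_def)
    \<comment> \<open>Injectivity comes from the trivial relative group in degree
      \<open>d + 1\<close>; surjectivity of \<open>?g\<close> below comes from the trivial homology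
      of the puncture in degree \<open>d - 1\<close>.\<close>
    have "kernel ?A ?G (?f ?p) = {\<one>\<^bsub>?A\<^esub>}"
      using ex2[of "?p + 1"] group_hom.image_from_trivial_group[OF bd] trivR[of "?p + 1"] by simp
    then have inj: "inj_on (?f ?p) (carrier ?A)" by (rule group_hom.trivial_ker_imp_inj[OF f])
    have bd': "group_hom ?R (reduced_homology_group (?p - 1) (subtopology ?X ?S)) (hom_boundary ?p ?X ?S)"
      using ex1(2)[of ?p] by (simp add: group_hom_def group_hom_axioms_def)
    have surj: "?g ?p ` carrier ?G = carrier ?R"
      using ex1(1)[of ?p] group_hom.kernel_to_trivial_group[OF bd'] trivS[of "?p - 1"] by simp
    obtain h where h: "h \<in> iso ?R integer_group" using rel[of ?p] by (auto simp: is_iso_def)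
    then have hh: "h \<in> hom ?R integer_group" "inj_on h (carrier ?R)" "h ` carrier ?R = UNIV"
      by (auto simp: iso_def bij_betw_def)
    have h1: "h \<one>\<^bsub>?R\<^esub> = 0" using hom_one[OF hh(1)] by simp
    have "has_rank ?G (Suc (card B))"
    proof (rule has_rank_extension[OF comm_group_reduced_homology_group comm_group_reduced_homology_group
          ex3(1) inj _ _ _ rankS])
      show "h \<circ> ?g ?p \<in> hom ?G integer_group" by (rule hom_compose[OF ex3(2) hh(1)])
      show "(h \<circ> ?g ?p) ` carrier ?G = UNIV" using surj hh(3) by (metis image_comp)
      have "h (?g ?p x) = 0 \<longleftrightarrow> ?g ?p x = \<one>\<^bsub>?R\<^esub>" if "x \<in> carrier ?G" for x
      proof -
        have "?g ?p x \<in> carrier ?R" using surj that by blast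
        moreover have "\<one>\<^bsub>?R\<^esub> \<in> carrier ?R" by (rule monoid.one_closed[OF group.is_monoid[OF group_relative_homology_group]])
        ultimately show ?thesis using inj_on_eq_iff[OF hh(2), of "?g ?p x" "\<one>\<^bsub>?R\<^esub>"] h1 by simp
      qed
      then have "kernel ?G integer_group (h \<circ> ?g ?p) = kernel ?G ?R (?g ?p)"
        unfolding kernel_def one_integer_group comp_def by blast
      then show "kernel ?G integer_group (h \<circ> ?g ?p) = ?f ?p ` carrier ?A"
        using ex3(3)[of ?p] by (rule trans)
    qed
    then show "has_rank ?G (card (insert \<sigma> B))" using insert by simp
  qed
qed

section \<open>Connected vertex sets and tetrominoes\<close>

text \<open>Formulated by cuts instead of paths, connectedness passes easily to bijective images and
  to sets grown by one cell. It holds vacuously for the empty set, hence the condition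
  \<open>T \<noteq> {}\<close> in the comparison with \<open>connected\<close>.\<close>

definition set_connected :: "('a \<Rightarrow> 'a \<Rightarrow> bool) \<Rightarrow> 'a set \<Rightarrow> bool" where
  "set_connected adj T \<longleftrightarrow> (\<forall>A. A \<subseteq> T \<longrightarrow> A \<noteq> {} \<longrightarrow> A \<noteq> T \<longrightarrow> (\<exists>a\<in>A. \<exists>b\<in>T - A. adj a b))"

text \<open>No edge leaves the set of vertices reachable from \<open>u\<close>, so the cut condition
  makes it all of \<open>T\<close>.\<close>

lemma reachable_with_proj_if_set_connected:
  fixes G :: "'a pair_pre_digraph"
  assumes G: "pair_graph G" and T: "T \<subseteq> pverts G"
    and conn: "set_connected (\<lambda>a b. (a, b) \<in> parcs G) T" and u: "u \<in> T" and v: "v \<in> T"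
  shows "(u, v) \<in> rtrancl_on T {(a, b). (a, b) \<in> parcs G \<and> a \<in> T \<and> b \<in> T}"
proof (rule ccontr)
  let ?R = "{(a, b). (a, b) \<in> parcs G \<and> a \<in> T \<and> b \<in> T}"
  assume nv: "\<not> ?thesis"
  let ?A = "{w \<in> T. (u, w) \<in> rtrancl_on T ?R}"
  have "u \<in> ?A" using u by (simp add: rtrancl_on_refl)
  moreover have "?A \<noteq> T" using nv v by blast
  ultimately obtain a b where ab: "a \<in> ?A" "b \<in> T - ?A" "(a, b) \<in> parcs G"
    using conn[unfolded set_connected_def, rule_format, of ?A] by blast
  then have "(u, a) \<in> rtrancl_on T ?R" "(a, b) \<in> ?R" "b \<in> T" by simp_all
  then have "(u, b) \<in> rtrancl_on T ?R" by (rule rtrancl_on_into_rtrancl_on)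
  then show False using ab by blast
qed

lemma connected_induce_subgraph_iff:
  fixes G :: "'a pair_pre_digraph"
  assumes G: "pair_graph G" and T: "T \<subseteq> pverts G" "T \<noteq> {}"
  shows "Digraph_Component.connected (induce_subgraph (with_proj G) T) \<longleftrightarrow>
    set_connected (\<lambda>a b. (a, b) \<in> parcs G) T"
proof -
  interpret pair_graph G by fact
  have sym: "sym (parcs G)"
    using pair_sym_arcs by (simp add: symmetric_def arcs_ends_def arc_to_ends_def)
  have ends: "arcs_ends (with_proj (mk_symmetric (induce_subgraph (with_proj G) T))) =
      {(a, b). (a, b) \<in> parcs G \<and> a \<in> T \<and> b \<in> T}"
    using sym by (auto simp: mk_symmetric_def arcs_ends_def arc_to_ends_def symcl_def sym_def image_iff)
  have vs: "verts (with_proj (mk_symmetric (induce_subgraph (with_proj G) T))) = T"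
    by (simp add: mk_symmetric_def)
  let ?R = "{(a, b). (a, b) \<in> parcs G \<and> a \<in> T \<and> b \<in> T}"
  have iff: "Digraph_Component.connected (induce_subgraph (with_proj G) T) \<longleftrightarrow>
      (\<forall>u\<in>T. \<forall>v\<in>T. (u, v) \<in> rtrancl_on T ?R)"
    unfolding connected_def strongly_connected_def reachable_def ends vs using T by blast
  show ?thesis
  proof
    assume c: "Digraph_Component.connected (induce_subgraph (with_proj G) T)"
    show "set_connected (\<lambda>a b. (a, b) \<in> parcs G) T"
      unfolding set_connected_def
    proof (intro allI impI, rule ccontr)
      fix A assume A: "A \<subseteq> T" "A \<noteq> {}" "A \<noteq> T"
        and no: "\<not> (\<exists>a\<in>A. \<exists>b\<in>T - A. (a, b) \<in> parcs G)"
      obtain u v where uv: "u \<in> A" "v \<in> T" "v \<notin> A" using A by blast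
      have "(u, v) \<in> rtrancl_on T ?R" using c iff uv A by blast
      then have "v \<in> A" using uv(1)
      proof (induction rule: rtrancl_on_induct)
        case (step x y) then show ?case using no by auto
      qed
      then show False using uv by blast
    qed
  next
    assume "set_connected (\<lambda>a b. (a, b) \<in> parcs G) T"
    then show "Digraph_Component.connected (induce_subgraph (with_proj G) T)"
      unfolding iff using reachable_with_proj_if_set_connected[OF G T(1)] by blast
  qed
qed

text \<open>A cut of \<open>insert b S\<close> either restricts to a proper cut of \<open>S\<close>
  or separates \<open>b\<close> from all of \<open>S\<close>; in the latter case the edge between
  \<open>a\<close> and \<open>b\<close> crosses it.\<close>

lemma set_connected_insert:
  assumes S: "set_connected adj S" and ab: "a \<in> S" "adj a b" and sym: "\<And>x y. adj x y \<Longrightarrow> adj y x"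
  shows "set_connected adj (insert b S)"
  unfolding set_connected_def
proof (intro allI impI)
  fix A assume A: "A \<subseteq> insert b S" "A \<noteq> {}" "A \<noteq> insert b S"
  show "\<exists>x\<in>A. \<exists>y\<in>insert b S - A. adj x y"
  proof (cases "A \<inter> S = {}")
    case True
    then have "A = {b}" using A by blast
    then show ?thesis using ab sym True by blast
  next
    case ne: False
    show ?thesis
    proof (cases "A \<inter> S = S")
      case True
      then have "b \<notin> A" using A by blast
      then show ?thesis using ab True by blast
    next
      case False
      then obtain x y where "x \<in> A \<inter> S" "y \<in> S - A \<inter> S" "adj x y"
        using S[unfolded set_connected_def, rule_format, of "A \<inter> S"] ne by blast
      then show ?thesis by blast
    qed
  qed
qed

lemma set_connected_image:
  assumes "inj_on f T" "\<And>a b. a \<in> T \<Longrightarrow> b \<in> T \<Longrightarrow> adj' (f a) (f b) \<longleftrightarrow> adj a b"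
  shows "set_connected adj' (f ` T) \<longleftrightarrow> set_connected adj T"
proof
  assume c: "set_connected adj' (f ` T)"
  show "set_connected adj T" unfolding set_connected_def
  proof (intro allI impI)
    fix A assume A: "A \<subseteq> T" "A \<noteq> {}" "A \<noteq> T"
    have "f ` A \<noteq> f ` T" using A assms(1) by (simp add: inj_on_image_eq_iff)
    then obtain a b where "a \<in> f ` A" "b \<in> f ` T - f ` A" "adj' a b"
      using c[unfolded set_connected_def, rule_format, of "f ` A"] A by blast
    then show "\<exists>a\<in>A. \<exists>b\<in>T - A. adj a b" using assms(2) A by blast
  qed
next
  assume c: "set_connected adj T"
  show "set_connected adj' (f ` T)" unfolding set_connected_def
  proof (intro allI impI)
    fix A' assume A': "A' \<subseteq> f ` T" "A' \<noteq> {}" "A' \<noteq> f ` T"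
    let ?A = "{x \<in> T. f x \<in> A'}"
    have "?A \<subseteq> T" "?A \<noteq> {}" "?A \<noteq> T" using A' by blast+
    then obtain a b where "a \<in> ?A" "b \<in> T - ?A" "adj a b"
      using c[unfolded set_connected_def, rule_format, of ?A] by blast
    then show "\<exists>a\<in>A'. \<exists>b\<in>f ` T - A'. adj' a b" using assms(2) by blast
  qed
qed

section \<open>Cells, shapes and the enumeration of tetrominoes\<close>

type_synonym cell = "int \<times> int"

definition cell_steps :: "cell list" where
  "cell_steps = [(1, 0), (-1, 0), (0, 1), (0, -1)]"

definition cell_adj :: "cell \<Rightarrow> cell \<Rightarrow> bool" where
  "cell_adj p q \<longleftrightarrow> q - p \<in> set cell_steps"

text \<open>A canonical form up to translation. A shifted tetromino has coordinates from 0 to 3, so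
  \<open>4 * i + j\<close> orders its cells lexicographically and without ties.\<close>

definition normalize :: "cell list \<Rightarrow> cell list" where
  "normalize s = (let a = min_list (map fst s); b = min_list (map snd s) in
     sort_key (\<lambda>(i, j). 4 * i + j) (map (\<lambda>(i, j). (i - a, j - b)) s))"

definition place :: "cell list \<Rightarrow> cell \<Rightarrow> cell set" where
  "place s q = (\<lambda>p. q + p) ` set s"

text \<open>Each shape is listed with a cell and a rank.  Deleting the cell from the shape leaves three
  cells whose other connected completions have larger rank, and the completing cell is never weakly
  below the lower left corner of the shape; both are checked by computation below.\<close>

definition tetromino_table :: "(cell list \<times> cell \<times> nat) list" where
  "tetromino_table =
    [([(0, 0), (1, 0), (2, 0), (3, 0)], (1, 0), 2),
     ([(0, 0), (0, 1), (1, 0), (2, 0)], (1, 0), 2),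
     ([(0, 0), (1, 0), (2, 0), (2, 1)], (1, 0), 2),
     ([(0, 0), (1, 0), (1, 1), (2, 0)], (1, 0), 2),
     ([(0, 0), (1, 0), (1, 1), (2, 1)], (1, 0), 1),
     ([(0, 0), (0, 1), (1, 1), (2, 1)], (1, 1), 2),
     ([(0, 0), (0, 1), (1, 1), (1, 2)], (0, 1), 1),
     ([(0, 1), (1, 1), (2, 0), (2, 1)], (1, 1), 2),
     ([(0, 1), (0, 2), (1, 0), (1, 1)], (0, 1), 1),
     ([(0, 1), (1, 0), (1, 1), (2, 0)], (1, 0), 1),
     ([(0, 0), (0, 1), (1, 0), (1, 1)], (0, 0), 0),
     ([(0, 1), (1, 0), (1, 1), (2, 1)], (1, 1), 2),
     ([(0, 0), (0, 1), (0, 2), (1, 0)], (0, 1), 2),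
     ([(0, 0), (1, 0), (1, 1), (1, 2)], (1, 1), 2),
     ([(0, 0), (0, 1), (0, 2), (1, 1)], (0, 1), 2),
     ([(0, 1), (1, 0), (1, 1), (1, 2)], (1, 1), 2),
     ([(0, 0), (0, 1), (0, 2), (1, 2)], (0, 1), 2),
     ([(0, 2), (1, 0), (1, 1), (1, 2)], (1, 1), 2),
     ([(0, 0), (0, 1), (0, 2), (0, 3)], (0, 1), 2)]"

definition tetrominoes :: "cell list list" where
  "tetrominoes = map fst tetromino_table"

definition removed_cell :: "cell list \<Rightarrow> cell" where
  "removed_cell s = fst (the (map_of tetromino_table s))"

definition shape_rank :: "cell list \<Rightarrow> nat" where
  "shape_rank s = snd (the (map_of tetromino_table s))"

definition neighbours :: "cell list \<Rightarrow> cell list" where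
  "neighbours s = [c. p \<leftarrow> s, d \<leftarrow> cell_steps, c \<leftarrow> [p + d], c \<notin> set s]"

definition grow :: "cell list list \<Rightarrow> cell list list" where
  "grow ss = remdups [normalize (c # s). s \<leftarrow> ss, c \<leftarrow> neighbours s]"

text \<open>Certifies that the table is complete and that it lists connected shapes only.\<close>

lemma grow_tetrominoes: "set (grow (grow (grow [[(0, 0)]]))) = set tetrominoes"
  by code_simp

lemma tetrominoes_normal:
  "\<forall>s\<in>set tetrominoes. length s = 4 \<and> distinct s \<and> list_all (\<lambda>p. 0 \<le> fst p \<and> 0 \<le> snd p) s \<and>
     list_ex (\<lambda>p. fst p = 0) s \<and> list_ex (\<lambda>p. snd p = 0) s"
  by code_simp

lemma tetrominoes_distinct: "distinct tetrominoes"
  by code_simp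

lemma tetrominoes_set_inj: "\<forall>s\<in>set tetrominoes. \<forall>s'\<in>set tetrominoes. set s = set s' \<longrightarrow> s = s'"
  by code_simp

text \<open>A cell that completes the three others to a connected set is adjacent to one of them, so
  testing neighbours suffices. For shapes of rank 2, the largest rank, the strict inequality says
  that there is no other completion.\<close>

lemma tetrominoes_removed:
  "\<forall>s\<in>set tetrominoes. removed_cell s \<in> set s \<and>
     (\<forall>c\<in>set (neighbours (remove1 (removed_cell s) s)). c \<in> set s \<or>
       normalize (c # remove1 (removed_cell s) s) \<notin> set tetrominoes \<or>
       ((0 < fst c \<or> 0 < snd c) \<and> shape_rank s < shape_rank (normalize (c # remove1 (removed_cell s) s))))"
  by code_simp

lemma cell_adj_sym: "cell_adj p q \<Longrightarrow> cell_adj q p"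
  by (cases p; cases q) (auto simp: cell_adj_def cell_steps_def)

lemma set_neighbours: "set (neighbours s) = {c. c \<notin> set s \<and> (\<exists>p\<in>set s. cell_adj p c)}"
proof (intro Set.set_eqI iffI)
  fix c assume "c \<in> set (neighbours s)"
  then obtain p d where "p \<in> set s" "d \<in> set cell_steps" "c = p + d" "c \<notin> set s"
    by (auto simp: neighbours_def)
  then show "c \<in> {c. c \<notin> set s \<and> (\<exists>p\<in>set s. cell_adj p c)}" by (auto simp: cell_adj_def intro!: bexI[of _ p])
next
  fix c assume "c \<in> {c. c \<notin> set s \<and> (\<exists>p\<in>set s. cell_adj p c)}"
  then obtain p where p: "c \<notin> set s" "p \<in> set s" "c - p \<in> set cell_steps" by (auto simp: cell_adj_def)
  then show "c \<in> set (neighbours s)" unfolding neighbours_def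
    by (simp, intro bexI[of _ p] bexI[of _ "c - p"]) simp_all
qed

lemma card_place: "distinct s \<Longrightarrow> card (place s q) = length s"
  by (simp add: place_def card_image distinct_card)

lemma place_Cons: "place (c # s) q = insert (q + c) (place s q)"
  by (simp add: place_def)

lemma place_normalize: "\<exists>q'. place (normalize s) q' = place s q"
proof
  let ?a = "(min_list (map fst s), min_list (map snd s))"
  show "place (normalize s) (q + ?a) = place s q"
    by (force simp: place_def normalize_def Let_def image_image split: prod.splits)
qed

definition normal_shape :: "cell list \<Rightarrow> bool" where
  "normal_shape s \<longleftrightarrow> (\<forall>p\<in>set s. 0 \<le> fst p \<and> 0 \<le> snd p) \<and> (\<exists>p\<in>set s. fst p = 0) \<and> (\<exists>p\<in>set s. snd p = 0)"

lemma normal_tetromino: "s \<in> set tetrominoes \<Longrightarrow> normal_shape s"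
  using tetrominoes_normal by (auto simp: normal_shape_def list_all_iff list_ex_iff)

lemma normal_normalize:
  assumes "s \<noteq> []" shows "normal_shape (normalize s)"
proof -
  let ?a = "min_list (map fst s)" and ?b = "min_list (map snd s)"
  have a: "?a = Min (fst ` set s)" "?b = Min (snd ` set s)" using assms by (simp_all add: min_list_Min)
  have set: "set (normalize s) = (\<lambda>(i, j). (i - ?a, j - ?b)) ` set s" by (simp add: normalize_def Let_def)
  have "?a \<in> fst ` set s" "?b \<in> snd ` set s" unfolding a using assms by (auto intro!: Min_in)
  then obtain p p' where p: "p \<in> set s" "fst p = ?a" "p' \<in> set s" "snd p' = ?b" by force
  have le: "?a \<le> fst x" "?b \<le> snd x" if "x \<in> set s" for x unfolding a using that by auto
  have "(fst x - ?a, snd x - ?b) \<in> set (normalize s)" if "x \<in> set s" for x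
    unfolding set by (rule image_eqI[OF _ that]) (simp add: case_prod_beta)
  from this[OF p(1)] this[OF p(3)] show ?thesis
    using p le unfolding normal_shape_def by (auto simp: set intro: bexI[rotated])
qed

text \<open>\<open>q\<close> is the lower left corner of the bounding box of
  \<open>place s q\<close>. A cell of \<open>s'\<close> with a zero coordinate attains that
  coordinate of \<open>q'\<close>, and as a cell of \<open>place s q\<close> it cannot be below that
  of \<open>q\<close>.\<close>

lemma normal_place_le:
  assumes "normal_shape s" "normal_shape s'" "place s q = place s' q'"
  shows "fst q \<le> fst q' \<and> snd q \<le> snd q'"
proof -
  have *: "\<exists>p'\<in>set s. q' + p = q + p'" if "p \<in> set s'" for p
    using assms(3) that by (auto simp: place_def)
  obtain p where p: "p \<in> set s'" "fst p = 0" using assms(2) by (auto simp: normal_shape_def)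
  then obtain p' where p': "p' \<in> set s" "q' + p = q + p'" using * by blast
  have "fst q' + fst p = fst q + fst p'" using arg_cong[OF p'(2), of fst] by simp
  moreover have "0 \<le> fst p'" using assms(1) p'(1) by (simp add: normal_shape_def)
  ultimately have 1: "fst q \<le> fst q'" using p(2) by simp
  obtain p where p: "p \<in> set s'" "snd p = 0" using assms(2) by (auto simp: normal_shape_def)
  then obtain p' where p': "p' \<in> set s" "q' + p = q + p'" using * by blast
  have "snd q' + snd p = snd q + snd p'" using arg_cong[OF p'(2), of snd] by simp
  moreover have "0 \<le> snd p'" using assms(1) p'(1) by (simp add: normal_shape_def)
  ultimately show ?thesis using p(2) 1 by simp
qed

lemma normal_place_eqD:
  assumes "normal_shape s" "normal_shape s'" "place s q = place s' q'"
  shows "q = q' \<and> set s = set s'"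
proof -
  have q: "q = q'"
    using normal_place_le[OF assms] normal_place_le[OF assms(2,1) assms(3)[symmetric]] by (simp add: prod_eq_iff)
  have "set s = (\<lambda>p. p - q) ` place s q" for s by (auto simp: place_def image_image)
  then show ?thesis using assms(3) q by metis
qed

lemma place_eqD:
  assumes "s \<in> set tetrominoes" "s' \<in> set tetrominoes" "place s q = place s' q'"
  shows "s = s' \<and> q = q'"
  using normal_place_eqD[OF normal_tetromino[OF assms(1)] normal_tetromino[OF assms(2)] assms(3)]
    tetrominoes_set_inj assms(1,2) by blast

lemma set_connected_place_grow:
  assumes "\<forall>s\<in>set ss. \<forall>q. set_connected cell_adj (place s q)" "s \<in> set (grow ss)"
  shows "set_connected cell_adj (place s q)"
proof -
  obtain s' c where s': "s' \<in> set ss" "c \<in> set (neighbours s')" "s = normalize (c # s')"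
    using assms(2) by (auto simp: grow_def)
  obtain q0 where q0: "place (normalize (c # s')) q0 = place (c # s') 0"
    using place_normalize by blast
  have "place s q = place (c # s') (q - q0)"
  proof -
    have "place t (a + b) = (\<lambda>p. a + p) ` place t b" for t a b by (simp add: place_def image_image add.assoc)
    from this[of s "q - q0" q0] this[of "c # s'" "q - q0" 0] show ?thesis using q0 s'(3) by simp
  qed
  also have "\<dots> = insert (q - q0 + c) (place s' (q - q0))" by (rule place_Cons)
  also have "set_connected cell_adj \<dots>"
  proof -
    obtain p where p: "p \<in> set s'" "cell_adj p c" using s'(2) by (auto simp: set_neighbours)
    then have "q - q0 + p \<in> place s' (q - q0)" "cell_adj (q - q0 + p) (q - q0 + c)"
      by (auto simp: place_def cell_adj_def)
    moreover have "set_connected cell_adj (place s' (q - q0))" using assms(1) s'(1) by blast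
    ultimately show ?thesis using cell_adj_sym set_connected_insert by metis
  qed
  finally show ?thesis .
qed

text \<open>Some edge crosses the cut between the placed shape and the rest of \<open>T\<close>; its
  far end is the cell to add.\<close>

lemma grow_step:
  assumes T: "set_connected cell_adj T" and sub: "s \<in> set ss" "place s q \<subseteq> T" "s \<noteq> []" "place s q \<noteq> T"
  shows "\<exists>s'\<in>set (grow ss). \<exists>q'. place s' q' \<subseteq> T"
proof -
  have "place s q \<noteq> {}" using sub(3) by (auto simp: place_def)
  then obtain a b where ab: "a \<in> place s q" "b \<in> T - place s q" "cell_adj a b"
    using T[unfolded set_connected_def, rule_format, of "place s q"] sub by blast
  obtain p where p: "p \<in> set s" "a = q + p" using ab by (auto simp: place_def)
  have "b - q \<in> set (neighbours s)" using ab p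
    by (auto simp: set_neighbours place_def cell_adj_def image_iff algebra_simps intro!: bexI[of _ p])
  then have "normalize ((b - q) # s) \<in> set (grow ss)" using sub(1) by (auto simp: grow_def)
  moreover obtain q' where "place (normalize ((b - q) # s)) q' = place ((b - q) # s) q" using place_normalize by blast
  moreover have "place ((b - q) # s) q \<subseteq> T" using ab sub(2) by (simp add: place_Cons)
  ultimately show ?thesis by metis
qed

lemma grow_length:
  assumes "\<forall>s\<in>set ss. length s = n" "s \<in> set (grow ss)" shows "length s = Suc n"
  using assms by (auto simp: grow_def normalize_def Let_def)

lemma card_place_le: "card (place s q) \<le> length s"
  unfolding place_def by (rule order_trans[OF card_image_le card_length]) simp

text \<open>Growing adds adjacent cells and so preserves connectedness. Conversely, three growth
  steps inside \<open>T\<close>, started at any of its cells, yield a four-element subset, which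
  must be \<open>T\<close>.\<close>

theorem set_connected_4_iff:
  "set_connected cell_adj T \<and> card T = 4 \<longleftrightarrow> (\<exists>s\<in>set tetrominoes. \<exists>q. T = place s q)"
proof
  assume "\<exists>s\<in>set tetrominoes. \<exists>q. T = place s q"
  then obtain s q where s: "s \<in> set tetrominoes" "T = place s q" by blast
  have "\<forall>s\<in>set [[(0, 0)]]. \<forall>q. set_connected cell_adj (place s q)"
    by (auto simp: set_connected_def place_def)
  then have "\<forall>s\<in>set (grow (grow (grow [[(0, 0)]]))). \<forall>q. set_connected cell_adj (place s q)"
    using set_connected_place_grow by meson
  then have "set_connected cell_adj T" using s unfolding grow_tetrominoes by blast
  moreover have "card T = 4" using s tetrominoes_normal by (auto simp: card_place)
  ultimately show "set_connected cell_adj T \<and> card T = 4" by simp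
next
  assume a: "set_connected cell_adj T \<and> card T = 4"
  let ?s1 = "[[(0, 0) :: cell]]"
  have len: "\<forall>s\<in>set ?s1. length s = 1" "\<forall>s\<in>set (grow ?s1). length s = 2"
    "\<forall>s\<in>set (grow (grow ?s1)). length s = 3"
    using grow_length[of ?s1 1] grow_length[of "grow ?s1" 2] by auto
  have ne: "place s q \<noteq> T" if "length s \<le> 3" for s q
    using card_place_le[of s q] a that by auto
  obtain t where t: "t \<in> T" using a by (metis card.empty ex_in_conv zero_neq_numeral)
  then have "place [(0, 0)] t \<subseteq> T" by (simp add: place_def zero_prod_def[symmetric])
  then obtain s2 q2 where 2: "s2 \<in> set (grow ?s1)" "place s2 q2 \<subseteq> T"
    using grow_step[of T "[(0, 0)]" ?s1 t] a ne[of "[(0,0)]"] by auto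
  have l2: "length s2 = 2" using 2(1) len(2) by blast
  obtain s3 q3 where 3: "s3 \<in> set (grow (grow ?s1))" "place s3 q3 \<subseteq> T"
    using grow_step[OF conjunct1[OF a] 2] ne[of s2 q2] l2 by fastforce
  have l3: "length s3 = 3" using 3(1) len(3) by blast
  obtain s4 q4 where 4: "s4 \<in> set (grow (grow (grow ?s1)))" "place s4 q4 \<subseteq> T"
    using grow_step[OF conjunct1[OF a] 3] ne[of s3 q3] l3 by fastforce
  have s4: "s4 \<in> set tetrominoes" using 4(1) by (simp add: grow_tetrominoes)
  then have "card (place s4 q4) = 4" using tetrominoes_normal by (auto simp: card_place)
  then have "place s4 q4 = T" using 4(2) a by (metis card_subset_eq card.infinite zero_neq_numeral)
  then show "\<exists>s\<in>set tetrominoes. \<exists>q. T = place s q" using s4 by blast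
qed

definition cell_key :: "cell \<Rightarrow> int" where "cell_key = (\<lambda>(i, j). 4 * i + j)"

lemma tetrominoes_sorted:
  "\<forall>s\<in>set tetrominoes. sorted (map cell_key s) \<and> distinct (map cell_key s)"
  by code_simp

text \<open>Both lists increase strictly in \<open>cell_key\<close> and have the same cells. This
  links an arbitrary completion to the evaluated check, which compares lists and not sets.\<close>

lemma normalize_eq_tetromino:
  assumes s: "s \<in> set tetrominoes" and xs: "distinct xs" "xs \<noteq> []" and eq: "place xs q = place s q'"
  shows "normalize xs = s"
proof -
  obtain q0 where "place (normalize xs) q0 = place s q'" using place_normalize eq by metis
  then have set: "set (normalize xs) = set s"
    using normal_place_eqD[OF normal_normalize[OF xs(2)] normal_tetromino[OF s]] by blast
  have dist: "distinct (normalize xs)"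
    using xs(1) unfolding normalize_def Let_def by (auto simp: distinct_map inj_on_def)
  have key: "sorted (map cell_key s)" "distinct (map cell_key s)" using tetrominoes_sorted s by auto
  then have inj: "inj_on cell_key (set s)" by (simp add: distinct_map)
  have "sorted (map cell_key (normalize xs))"
    unfolding normalize_def Let_def cell_key_def by (rule sorted_sort_key)
  moreover have "distinct (map cell_key (normalize xs))" using dist inj set by (simp add: distinct_map)
  moreover have "set (map cell_key (normalize xs)) = set (map cell_key s)" using set by simp
  ultimately have "map cell_key (normalize xs) = map cell_key s"
    using key sorted_distinct_set_unique by blast
  then show ?thesis using inj set by (intro map_inj_on[of cell_key]) auto
qed

section \<open>Trimming a tetromino\<close>

definition shape_at :: "cell set \<Rightarrow> cell list \<times> cell" where
  "shape_at T = (SOME (s, q). s \<in> set tetrominoes \<and> T = place s q)"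

definition trimmed :: "cell set \<Rightarrow> cell set" where
  "trimmed T = (case shape_at T of (s, q) \<Rightarrow> place (remove1 (removed_cell s) s) q)"

definition tetromino_rank :: "cell set \<Rightarrow> nat" where
  "tetromino_rank T = shape_rank (fst (shape_at T))"

lemma shape_at_place:
  assumes "s \<in> set tetrominoes" shows "shape_at (place s q) = (s, q)"
proof -
  have "case shape_at (place s q) of (s', q') \<Rightarrow> s' \<in> set tetrominoes \<and> place s q = place s' q'"
    unfolding shape_at_def by (rule someI[of _ "(s, q)"]) (use assms in auto)
  moreover obtain s' q' where eq: "shape_at (place s q) = (s', q')" by (cases "shape_at (place s q)")
  ultimately have "s' \<in> set tetrominoes" "place s q = place s' q'" by simp_all
  then show ?thesis using place_eqD[OF assms] eq by blast
qed

lemma trimmed_place: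
  "s \<in> set tetrominoes \<Longrightarrow> trimmed (place s q) = place (remove1 (removed_cell s) s) q"
  by (simp add: trimmed_def shape_at_place)

lemma trimmed_subset:
  assumes "set_connected cell_adj T" "card T = 4"
  shows "trimmed T \<subseteq> T" "card (trimmed T) = 3"
proof -
  obtain s q where s: "s \<in> set tetrominoes" "T = place s q" using set_connected_4_iff assms by blast
  have "removed_cell s \<in> set s" "length s = 4" "distinct s" using s(1) tetrominoes_removed tetrominoes_normal by auto
  moreover have "trimmed T = place (remove1 (removed_cell s) s) q" using s by (simp add: trimmed_place)
  ultimately show "trimmed T \<subseteq> T" "card (trimmed T) = 3"
    using s(2) card_place[OF distinct_remove1[of s "removed_cell s"], of q]
    by (auto simp: length_remove1 place_def set_remove1_eq simp del: set_remove1_eq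
        dest: subsetD[OF set_remove1_subset])
qed

text \<open>Translated by the position of \<open>T\<close>, the completing cell is a neighbour of
  the trimmed shape outside the shape itself, so the evaluated check applies. The second conclusion
  is phrased through cells of \<open>T\<close>, so that it excludes a corner \<open>x\<close> of the
  grid whatever the position of \<open>T\<close>.\<close>

lemma trimmed_completion:
  assumes T: "set_connected cell_adj T" "card T = 4"
    and T': "set_connected cell_adj (insert x (trimmed T))" "card (insert x (trimmed T)) = 4" "insert x (trimmed T) \<noteq> T"
  shows "tetromino_rank T < tetromino_rank (insert x (trimmed T))"
    and "\<exists>p\<in>T. fst p < fst x \<or> (\<exists>p'\<in>T. snd p' < snd x)"
proof -
  obtain s q where s: "s \<in> set tetrominoes" "T = place s q" using set_connected_4_iff T by blast
  let ?t = "remove1 (removed_cell s) s" and ?T' = "insert x (trimmed T)"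
  have rem: "removed_cell s \<in> set s" "length s = 4" "distinct s"
    using s(1) tetrominoes_removed tetrominoes_normal by auto
  have red: "trimmed T = place ?t q" using s by (simp add: trimmed_place)
  have x: "x \<notin> place ?t q"
    using T'(2) trimmed_subset(2)[OF T] red by (auto simp: insert_absorb)
  define c where "c = x - q"
  have T'_eq: "?T' = place (c # ?t) q" by (simp add: place_Cons red c_def)
  have c: "c \<notin> set ?t" using x by (auto simp: place_def c_def image_iff)
  have "?T' \<noteq> {x}"
  proof
    assume "?T' = {x}"
    then have "card ?T' = card {x}" by (rule arg_cong)
    then show False using T'(2) by simp
  qed
  \<comment> \<open>Connectedness applied to the cut \<open>{x}\<close>: the added cell has a
    neighbour among the three trimmed ones.\<close>
  then obtain b where b: "b \<in> ?T' - {x}" "cell_adj x b"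
    using T'(1)[unfolded set_connected_def, rule_format, of "{x}"] by blast
  then obtain p where p: "p \<in> set ?t" "b = q + p" using red by (auto simp: place_def)
  then have "cell_adj p c" using cell_adj_sym[OF b(2)] by (simp add: cell_adj_def c_def algebra_simps)
  then have cn: "c \<in> set (neighbours ?t)" using c p(1) by (auto simp: set_neighbours)
  have cs: "c \<notin> set s"
  proof
    assume "c \<in> set s"
    then have "c = removed_cell s" using c rem by (simp add: set_remove1_eq)
    then have "set (c # ?t) = set s" using rem by auto
    then show False using T'(3) s(2) unfolding T'_eq by (simp add: place_def del: set_simps)
  qed
  obtain s' q' where s': "s' \<in> set tetrominoes" "?T' = place s' q'" using set_connected_4_iff T' by blast
  have "normalize (c # ?t) = s'"
    by (rule normalize_eq_tetromino[OF s'(1), of _ q q']) (use c rem s' T'_eq in auto)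
  then have *: "0 < fst c \<or> 0 < snd c" "shape_rank s < shape_rank s'"
    using tetrominoes_removed s(1) cn cs s'(1) by auto
  show "tetromino_rank T < tetromino_rank ?T'"
    using *(2) s s' by (simp add: tetromino_rank_def shape_at_place)
  obtain p p' where "p \<in> set s" "fst p = 0" "p' \<in> set s" "snd p' = 0"
    using normal_tetromino[OF s(1)] by (auto simp: normal_shape_def)
  then have "q + p \<in> T" "q + p' \<in> T" "fst (q + p) = fst q" "snd (q + p') = snd q"
    using s(2) by (auto simp: place_def)
  moreover have "fst q < fst x \<or> snd q < snd x" using *(1) by (auto simp: c_def)
  ultimately show "\<exists>p\<in>T. fst p < fst x \<or> (\<exists>p'\<in>T. snd p' < snd x)" by metis
qed

section \<open>Counting tetrominoes in a rectangle\<close>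

definition cell_box :: "nat \<Rightarrow> nat \<Rightarrow> cell set" where
  "cell_box m n = {1..int m} \<times> {1..int n}"

definition box_tetrominoes :: "nat \<Rightarrow> nat \<Rightarrow> cell set set" where
  "box_tetrominoes m n = {T. T \<subseteq> cell_box m n \<and> card T = 4 \<and> set_connected cell_adj T}"

text \<open>The admissible lower left corners form a rectangle; \<open>Max\<close> of the
  coordinates is one less than the extent of the shape, and \<open>nat\<close> gives 0 for a shape
  that does not fit.\<close>

lemma card_placements:
  assumes s: "normal_shape s"
  shows "card {q. place s q \<subseteq> cell_box m n} =
    nat (int m - Max (fst ` set s)) * nat (int n - Max (snd ` set s))"
proof -
  have ne: "set s \<noteq> {}" using s by (auto simp: normal_shape_def)
  have "place s q \<subseteq> cell_box m n \<longleftrightarrow> q \<in> {1..int m - Max (fst ` set s)} \<times> {1..int n - Max (snd ` set s)}" for q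
  proof -
    have "place s q \<subseteq> cell_box m n \<longleftrightarrow> (\<forall>p\<in>set s. 1 \<le> fst q + fst p \<and> fst q + fst p \<le> int m \<and>
        1 \<le> snd q + snd p \<and> snd q + snd p \<le> int n)"
      by (auto simp: place_def cell_box_def mem_Times_iff image_subset_iff)
    also have "\<dots> \<longleftrightarrow> 1 \<le> fst q \<and> 1 \<le> snd q \<and> (\<forall>a\<in>fst ` set s. a \<le> int m - fst q) \<and> (\<forall>a\<in>snd ` set s. a \<le> int n - snd q)"
      using s unfolding normal_shape_def by (auto simp: algebra_simps)
    also have "\<dots> \<longleftrightarrow> 1 \<le> fst q \<and> 1 \<le> snd q \<and> Max (fst ` set s) \<le> int m - fst q \<and> Max (snd ` set s) \<le> int n - snd q"
      using ne by (simp add: Max_le_iff)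
    finally show ?thesis by (auto simp: mem_Times_iff)
  qed
  then have "{q. place s q \<subseteq> cell_box m n} = {1..int m - Max (fst ` set s)} \<times> {1..int n - Max (snd ` set s)}" by blast
  then show ?thesis by (simp add: card_cartesian_product)
qed

text \<open>The summands belong to the two bars, the square, and the 2 by 3 and 3 by 2 bounding
  boxes with four L, two T and two skew shapes each.\<close>

lemma card_box_tetrominoes:
  "card (box_tetrominoes m n) = nat (int m - 3) * n + m * nat (int n - 3) + nat (int m - 1) * nat (int n - 1)
     + 8 * (nat (int m - 1) * nat (int n - 2)) + 8 * (nat (int m - 2) * nat (int n - 1))"
proof -
  let ?S = "SIGMA s:set tetrominoes. {q. place s q \<subseteq> cell_box m n}"
  have eq: "box_tetrominoes m n = (\<lambda>(s, q). place s q) ` ?S"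
  proof (intro subset_antisym subsetI)
    fix T assume "T \<in> box_tetrominoes m n"
    then have T: "T \<subseteq> cell_box m n" "set_connected cell_adj T \<and> card T = 4" by (simp_all add: box_tetrominoes_def)
    obtain s q where "s \<in> set tetrominoes" "T = place s q" using T(2)[unfolded set_connected_4_iff] by blast
    then show "T \<in> (\<lambda>(s, q). place s q) ` ?S" using T(1) by (intro image_eqI[of _ _ "(s, q)"]) auto
  next
    fix T assume "T \<in> (\<lambda>(s, q). place s q) ` ?S"
    then obtain s q where s: "s \<in> set tetrominoes" "place s q \<subseteq> cell_box m n" "T = place s q" by auto
    then have "set_connected cell_adj T \<and> card T = 4" unfolding set_connected_4_iff by blast
    then show "T \<in> box_tetrominoes m n" using s by (simp add: box_tetrominoes_def)
  qed
  have inj: "inj_on (\<lambda>(s, q). place s q) ?S"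
    by (rule inj_onI) (use place_eqD in fastforce)
  have fin: "finite {q. place s q \<subseteq> cell_box m n}" if s: "s \<in> set tetrominoes" for s
  proof -
    have "{q. place s q \<subseteq> cell_box m n} = {q. place s q \<subseteq> cell_box m n \<and> q \<in> {1..int m} \<times> {1..int n}}"
    proof -
      obtain p p' where p: "p \<in> set s" "fst p = 0" "p' \<in> set s" "snd p' = 0"
        using normal_tetromino[OF s] by (auto simp: normal_shape_def)
      have "q \<in> {1..int m} \<times> {1..int n}" if "place s q \<subseteq> cell_box m n" for q
      proof -
        have "q + p \<in> cell_box m n" "q + p' \<in> cell_box m n" using that p by (auto simp: place_def)
        then show ?thesis using p by (auto simp: cell_box_def mem_Times_iff)
      qed
      then show ?thesis by blast
    qed
    also have "finite \<dots>" by (rule finite_subset[of _ "{1..int m} \<times> {1..int n}"]) auto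
    finally show ?thesis .
  qed
  have "card (box_tetrominoes m n) = card ?S" unfolding eq by (rule card_image[OF inj])
  also have "\<dots> = (\<Sum>s\<in>set tetrominoes. card {q. place s q \<subseteq> cell_box m n})"
    by (rule card_SigmaI) (use fin in auto)
  also have "\<dots> = (\<Sum>s\<in>set tetrominoes. nat (int m - Max (fst ` set s)) * nat (int n - Max (snd ` set s)))"
    by (intro sum.cong refl card_placements normal_tetromino)
  also have "\<dots> = sum_list (map (\<lambda>s. nat (int m - Max (fst ` set s)) * nat (int n - Max (snd ` set s))) tetrominoes)"
    by (rule sum_list_distinct_conv_sum_set[OF tetrominoes_distinct, symmetric])
  also have "\<dots> = nat (int m - 3) * n + m * nat (int n - 3) + nat (int m - 1) * nat (int n - 1)
     + 8 * (nat (int m - 1) * nat (int n - 2)) + 8 * (nat (int m - 2) * nat (int n - 1))"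
    unfolding tetrominoes_def tetromino_table_def by simp
  finally show ?thesis .
qed

text \<open>For \<open>m = 2\<close> the bar of extent 4 in the first direction contributes 0, where
  the polynomial has \<open>(m - 3) * n = -n\<close>; this turns \<open>10 * n - 23\<close> into
  \<open>11 * n - 23\<close>. From \<open>m = 3\<close> on nothing is truncated.\<close>

lemma card_box_tetrominoes_formula:
  assumes "2 \<le> m" "m \<le> n" "3 \<le> n"
  shows "int (card (box_tetrominoes m n)) =
    (if m = 2 then 11 * int n - 23 else 19 * int m * int n - 28 * (int m + int n) + 33)"
proof -
  have n: "int (nat (int n - 3)) = int n - 3" "int (nat (int n - 2)) = int n - 2" "int (nat (int n - 1)) = int n - 1"
    "int (nat (int m - 1)) = int m - 1" "int (nat (int m - 2)) = int m - 2" using assms by auto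
  show ?thesis
  proof (cases "m = 2")
    case True
    then show ?thesis unfolding card_box_tetrominoes of_nat_add of_nat_mult n by simp
  next
    case False
    then have n3: "int (nat (int m - 3)) = int m - 3" using assms by auto
    show ?thesis unfolding if_not_P[OF False] card_box_tetrominoes of_nat_add of_nat_mult n n3
      by (simp add: algebra_simps)
  qed
qed

section \<open>The complex of complements of bad 4-sets\<close>

text \<open>\<open>\<T>\<close> plays the role of the connected 4-sets.  The faces \<open>S\<close> for which \<open>S \<union> {v}\<close> is a face
  form a cone \<open>M\<close>.  The remaining faces are the facets avoiding \<open>v\<close> and the ridges \<open>V - (T \<union> {v})\<close> with
  \<open>T \<in> \<T>\<close> avoiding \<open>v\<close>; such a ridge is collapsed through the facet \<open>V - (r T \<union> {v})\<close>, in order of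
  increasing \<open>\<rho>\<close>.  The facets \<open>B\<close> left over give the spheres.\<close>

locale four_set_complex =
  fixes V :: "'a set" and v :: 'a and \<T> :: "'a set set" and r :: "'a set \<Rightarrow> 'a set" and \<rho> :: "'a set \<Rightarrow> nat"
  assumes finV: "finite V" and vV: "v \<in> V" and cardV: "6 \<le> card V"
    and \<T>: "T \<in> \<T> \<Longrightarrow> T \<subseteq> V \<and> card T = 4"
    and r_subset: "T \<in> \<T> \<Longrightarrow> r T \<subseteq> T \<and> card (r T) = 3"
    and r_bad: "T \<in> \<T> \<Longrightarrow> v \<notin> T \<Longrightarrow> insert v (r T) \<notin> \<T>"
    and \<rho>: "T \<in> \<T> \<Longrightarrow> T' \<in> \<T> \<Longrightarrow> T \<noteq> T' \<Longrightarrow> r T' \<subseteq> T \<Longrightarrow> \<rho> T' < \<rho> T"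
begin

text \<open>A set \<^term>\<open>T \<in> \<T>\<close> of maximal rank inside \<^term>\<open>P\<close> cannot be exchanged for \<open>r T \<union> {x}\<close>.\<close>

lemma five_set_has_bad_subset:
  assumes P: "P \<subseteq> V" "card P = 5" shows "\<exists>D\<subseteq>P. card D = 4 \<and> D \<notin> \<T>"
proof (rule ccontr)
  assume no: "\<not> ?thesis"
  let ?F = "{D. D \<subseteq> P \<and> card D = 4}"
  have finP: "finite P" using P by (metis card.infinite zero_neq_numeral)
  have "card ?F = 5 choose 4" using n_subsets[OF finP, of 4] P(2) by simp
  then have "card ?F \<noteq> 0" by simp
  then have ne: "?F \<noteq> {}" by (metis card.empty)
  have "finite ?F" using finP by simp
  then have "Max (\<rho> ` ?F) \<in> \<rho> ` ?F" using ne by (intro Max_in) auto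
  then obtain T where T: "T \<in> ?F" "\<rho> T = Max (\<rho> ` ?F)" by auto
  then have max: "\<rho> D \<le> \<rho> T" if "D \<in> ?F" for D using \<open>finite ?F\<close> that by simp
  have T\<T>: "T \<in> \<T>" using T(1) no by blast
  have "T \<subseteq> P" "card T = 4" using T(1) by simp_all
  then have "T \<noteq> P" using P(2) by auto
  then obtain x where x: "x \<in> P" "x \<notin> T" using \<open>T \<subseteq> P\<close> by blast
  let ?D = "insert x (r T)"
  have rT: "r T \<subseteq> T" "card (r T) = 3" using r_subset[OF T\<T>] by auto
  have "finite (r T)" using finite_subset[OF rT(1) finite_subset[OF \<open>T \<subseteq> P\<close> finP]] .
  moreover have "x \<notin> r T" using rT(1) x(2) by blast
  ultimately have "card ?D = 4" using rT(2) by simp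
  moreover have "?D \<subseteq> P" using rT(1) \<open>T \<subseteq> P\<close> x(1) by blast
  ultimately have D: "?D \<in> ?F" by simp
  then have "?D \<in> \<T>" using no by blast
  then have "\<rho> T < \<rho> ?D" using \<rho>[of ?D T] T\<T> x by blast
  then show False using max[OF D] by simp
qed

section \<open>Faces, ridges and facets\<close>

definition bad :: "'a set \<Rightarrow> bool" where
  "bad C \<longleftrightarrow> (\<exists>D\<subseteq>C. card D = 4 \<and> D \<notin> \<T>)"

definition \<Delta> :: "'a set set" where
  "\<Delta> = {S. S \<subseteq> V \<and> bad (V - S)}"

definition \<T>0 :: "'a set set" where
  "\<T>0 = {T \<in> \<T>. v \<notin> T}"

definition M :: "'a set set" where
  "M = {S. S \<subseteq> V \<and> bad (V - S - {v})}"

definition ridge :: "'a set \<Rightarrow> 'a set" where "ridge T = V - insert v T"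

definition facet :: "'a set \<Rightarrow> 'a set" where "facet T = V - insert v (r T)"

definition L :: "'a set set \<Rightarrow> 'a set set" where
  "L \<U> = M \<union> ridge ` \<U> \<union> facet ` \<U>"

definition B :: "'a set set" where
  "B = (\<lambda>D. V - D) ` {D. D \<subseteq> V \<and> card D = 4 \<and> v \<in> D \<and> D \<notin> \<T> \<and> D \<notin> (\<lambda>T. insert v (r T)) ` \<T>0}"

lemma bad_mono: "bad C \<Longrightarrow> C \<subseteq> C' \<Longrightarrow> bad C'"
  by (auto simp: bad_def)

lemma bad_card_ge5:
  assumes "C \<subseteq> V" "5 \<le> card C" shows "bad C"
proof -
  obtain P where P: "P \<subseteq> C" "card P = 5" using obtain_subset_with_card_n[OF assms(2)] by metis
  then show ?thesis using five_set_has_bad_subset[of P] assms(1) by (meson bad_def order_trans)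
qed

lemma bad_card4:
  assumes "C \<subseteq> V" "card C \<le> 4" shows "bad C \<longleftrightarrow> card C = 4 \<and> C \<notin> \<T>"
proof -
  have "D = C" if "D \<subseteq> C" "card D = 4" for D
    using that assms finV by (metis card_seteq finite_subset)
  then show ?thesis by (auto simp: bad_def)
qed

lemma \<T>0D:
  assumes "T \<in> \<T>0"
  shows "T \<in> \<T>" "v \<notin> T" "T \<subseteq> V" "card T = 4" "finite T" "r T \<subseteq> T" "card (r T) = 3" "insert v (r T) \<notin> \<T>"
    "finite (r T)" "v \<notin> r T" "card (insert v T) = 5" "card (insert v (r T)) = 4"
    "insert v T \<subseteq> V" "insert v (r T) \<subseteq> V"
proof -
  show a: "T \<in> \<T>" "v \<notin> T" using assms by (auto simp: \<T>0_def)
  show b: "T \<subseteq> V" "card T = 4" using \<T>[OF a(1)] by auto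
  show c: "r T \<subseteq> T" "card (r T) = 3" "insert v (r T) \<notin> \<T>" using r_subset[OF a(1)] r_bad[OF a] by auto
  show d: "finite T" using b finV finite_subset by auto
  show e: "finite (r T)" using c d finite_subset by auto
  show f: "v \<notin> r T" using c a by auto
  show "card (insert v T) = 5" "card (insert v (r T)) = 4" using a b c d e f by auto
  show "insert v T \<subseteq> V" "insert v (r T) \<subseteq> V" using b c vV by auto
qed

text \<open>Equal three-element sets would make \<open>T\<close> and \<open>T'\<close> completions
  of each other's set, with strict inequalities of \<open>\<rho>\<close> both ways.\<close>

lemma r_inj:
  assumes "T \<in> \<T>0" "T' \<in> \<T>0" "r T = r T'" shows "T = T'"
proof (rule ccontr)
  assume "T \<noteq> T'"
  then have "\<rho> T' < \<rho> T" "\<rho> T < \<rho> T'"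
    using \<rho>[of T T'] \<rho>[of T' T] \<T>0D[OF assms(1)] \<T>0D[OF assms(2)] assms(3) by auto
  then show False by simp
qed

lemma complement_eq_iff: "C \<subseteq> V \<Longrightarrow> C' \<subseteq> V \<Longrightarrow> V - C = V - C' \<longleftrightarrow> C = C'"
  by blast

lemma ridge_not_M: "T \<in> \<T>0 \<Longrightarrow> ridge T \<notin> M"
proof -
  assume T: "T \<in> \<T>0"
  have "V - ridge T - {v} = T" using \<T>0D[OF T] vV by (auto simp: ridge_def)
  then show ?thesis using bad_card4[of T] \<T>0D[OF T] by (simp add: M_def)
qed

lemma facet_not_M: "T \<in> \<T>0 \<Longrightarrow> facet T \<notin> M"
proof -
  assume T: "T \<in> \<T>0"
  have "V - facet T - {v} = r T" using \<T>0D[OF T] vV by (auto simp: facet_def)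
  then show ?thesis using bad_card4[of "r T"] \<T>0D[OF T] by (simp add: M_def)
qed

lemma M_mono: "S \<in> M \<Longrightarrow> S' \<subseteq> S \<Longrightarrow> S' \<in> M"
  unfolding M_def using bad_mono[of "V - S - {v}" "V - S' - {v}"] by blast

text \<open>Dropping a vertex from the ridge leaves at least five elements besides \<open>v\<close>
  in the complement, and five elements always contain a bad 4-set.\<close>

lemma subset_ridge:
  assumes T: "T \<in> \<T>0" and S: "S \<subseteq> ridge T" shows "S \<in> M \<or> S = ridge T"
proof (cases "S = ridge T")
  case False
  have SV: "S \<subseteq> V" using S by (auto simp: ridge_def)
  have "T \<subset> V - S - {v}"
    using False S \<T>0D(2,3)[OF T] vV by (auto simp: ridge_def)
  then have "card T < card (V - S - {v})" using finV by (intro psubset_card_mono) auto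
  then have "bad (V - S - {v})" using \<T>0D(4)[OF T] by (intro bad_card_ge5) auto
  then show ?thesis using SV by (simp add: M_def)
qed simp

text \<open>For proper \<open>S\<close>, the complement without \<open>v\<close> properly contains
  \<open>r T\<close>. If it is not bad, it has exactly four elements and is itself some
  \<open>Q \<in> \<T>0\<close>.\<close>

lemma subset_facet:
  assumes T: "T \<in> \<T>0" and S: "S \<subseteq> facet T"
  shows "S \<in> M \<or> S = facet T \<or> (\<exists>Q\<in>\<T>0. r T \<subseteq> Q \<and> S = ridge Q)"
proof (cases "S = facet T")
  case False
  have SV: "S \<subseteq> V" using S by (auto simp: facet_def)
  let ?Q = "V - S - {v}"
  have sub: "r T \<subset> ?Q"
    using False S \<T>0D(10,14)[OF T] vV by (auto simp: facet_def)
  then have "card (r T) < card ?Q" using finV by (intro psubset_card_mono) auto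
  then have ge: "4 \<le> card ?Q" using \<T>0D(7)[OF T] by simp
  show ?thesis
  proof (cases "bad ?Q")
    case True then show ?thesis using SV by (simp add: M_def)
  next
    case nb: False
    then have 4: "card ?Q = 4" using ge bad_card_ge5[of ?Q] by fastforce
    then have "?Q \<in> \<T>0" using bad_card4[of ?Q] nb by (auto simp: \<T>0_def)
    moreover have "v \<notin> S" using S by (auto simp: facet_def)
    then have "S = ridge ?Q" using SV vV by (auto simp: ridge_def)
    ultimately show ?thesis using sub by blast
  qed
qed simp

text \<open>As \<open>ridge Q \<subseteq> facet T\<close> exactly when
  \<open>r T \<subseteq> Q\<close>, this is what makes \<open>L \<U>\<close> closed under subsets.
  Every such \<open>Q\<close> other than \<open>T\<close> has larger rank, so deleting a member of
  least rank preserves the condition.\<close>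

definition closed_family :: "'a set set \<Rightarrow> bool" where
  "closed_family \<U> \<longleftrightarrow> \<U> \<subseteq> \<T>0 \<and> (\<forall>T\<in>\<U>. \<forall>Q\<in>\<T>0. r T \<subseteq> Q \<longrightarrow> Q \<in> \<U>)"

lemma complex_on_L:
  assumes \<U>: "closed_family \<U>" shows "complex_on V (L \<U>)"
  unfolding complex_on_def
proof (intro conjI ballI subsetI)
  show "S \<in> Pow V" if "S \<in> L \<U>" for S using that by (auto simp: L_def M_def ridge_def facet_def)
  fix S S' assume S: "S \<in> L \<U>" and "S' \<in> Pow S"
  then have sub: "S' \<subseteq> S" by simp
  consider "S \<in> M" | T where "T \<in> \<U>" "S = ridge T" | T where "T \<in> \<U>" "S = facet T"
    using S by (auto simp: L_def)
  then show "S' \<in> L \<U>"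
  proof cases
    case 1 then show ?thesis using M_mono sub by (auto simp: L_def)
  next
    case 2
    then have "S' \<in> M \<or> S' = ridge T" using \<U> sub by (intro subset_ridge) (auto simp: closed_family_def)
    then show ?thesis using 2 by (auto simp: L_def)
  next
    case 3
    then have "S' \<in> M \<or> S' = facet T \<or> (\<exists>Q\<in>\<T>0. r T \<subseteq> Q \<and> S' = ridge Q)"
      using \<U> sub by (intro subset_facet) (auto simp: closed_family_def)
    then show ?thesis using 3 \<U> by (auto simp: L_def closed_family_def)
  qed
qed (rule finV)

text \<open>For \<open>T\<close> of least rank, \<open>ridge T\<close> is free. It is not in
  \<open>M\<close>, hence neither is any face above it; and a ridge or facet of \<open>T'\<close>
  above it would require \<open>r T' \<subseteq> T\<close>, which the ranking excludes for
  \<open>T' \<noteq> T\<close>.\<close>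

lemma L_contractible:
  assumes "finite \<U>" "closed_family \<U>" shows "contractible_space (top_of_set (realization_set (L \<U>)))"
  using assms
proof (induction "card \<U>" arbitrary: \<U>)
  case 0
  then have "L \<U> = M" by (simp add: L_def)
  moreover have "complex_on V (L \<U>)" using complex_on_L 0 by blast
  \<comment> \<open>The condition defining \<open>M\<close> does not see \<open>v\<close>, so
    \<open>M\<close> is a cone with apex \<open>v\<close>.\<close>
  moreover have "insert v S \<in> M" if "S \<in> M" for S
  proof -
    have "V - insert v S - {v} = V - S - {v}" by blast
    then show ?thesis using that vV by (simp add: M_def)
  qed
  ultimately show ?case using cone_contractible[of V M v] by simp
next
  case (Suc n)
  have ne: "\<U> \<noteq> {}" using Suc.hyps(2) by auto
  define T where "T = arg_min_on \<rho> \<U>"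
  have T: "T \<in> \<U>" and min: "\<And>T'. T' \<in> \<U> \<Longrightarrow> \<rho> T \<le> \<rho> T'"
    using arg_min_if_finite(1)[OF Suc.prems(1) ne, of \<rho>] arg_min_least[OF Suc.prems(1) ne, of _ \<rho>]
    by (auto simp: T_def)
  have sub: "\<U> \<subseteq> \<T>0" and up: "\<And>T Q. T \<in> \<U> \<Longrightarrow> Q \<in> \<T>0 \<Longrightarrow> r T \<subseteq> Q \<Longrightarrow> Q \<in> \<U>"
    using Suc.prems(2) by (auto simp: closed_family_def)
  have T0: "T \<in> \<T>0" using T sub by blast
  note D = \<T>0D[OF T0]
  have not_sub: "\<not> r T' \<subseteq> T" if "T' \<in> \<U>" "T' \<noteq> T" for T'
    using \<rho>[of T T'] min[OF that(1)] that sub T0 \<T>0D(1,2)[of T'] D by fastforce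
  have K: "complex_on V (L \<U>)" by (rule complex_on_L[OF Suc.prems(2)])
  have "card (T - r T) = 1" using D by (simp add: card_Diff_subset)
  then obtain u where u: "T - r T = {u}" by (rule card_1_singletonE)
  have u1: "u \<in> V" "u \<in> T" "u \<notin> r T" "T = insert u (r T)" "u \<noteq> v" using u D by auto
  have F: "facet T = insert u (ridge T)" using u1 D by (auto simp: facet_def ridge_def)
  have eq: "L \<U> - {ridge T, facet T} = L (\<U> - {T})"
  proof -
    have cr: "card (ridge T') = card V - 5" if "T' \<in> \<T>0" for T'
      using \<T>0D[OF that] finV by (simp add: ridge_def card_Diff_subset)
    have cf: "card (facet T') = card V - 4" if "T' \<in> \<T>0" for T'
      using \<T>0D[OF that] finV by (simp add: facet_def card_Diff_subset)
    \<comment> \<open>The cardinalities differ by one; \<open>6 \<le> card V\<close> keeps the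
      subtractions from being truncated to the same value.\<close>
    have rf: "ridge T' \<noteq> facet T''" if "T' \<in> \<U>" "T'' \<in> \<U>" for T' T''
    proof
      assume "ridge T' = facet T''"
      then have "card V - 5 = card V - 4" using cr[OF subsetD[OF sub that(1)]] cf[OF subsetD[OF sub that(2)]] by simp
      then show False using cardV by simp
    qed
    have rr: "ridge T' \<noteq> ridge T" if "T' \<in> \<U> - {T}" for T'
    proof
      assume "ridge T' = ridge T"
      then have "insert v T' = insert v T"
        using that sub \<T>0D(13) T0 unfolding ridge_def by (subst (asm) complement_eq_iff) auto
      moreover have "v \<notin> T'" using \<T>0D(2)[OF subsetD[OF sub, of T']] that by blast
      ultimately show False using that D(2) by (simp add: insert_ident)
    qed
    have ff: "facet T' \<noteq> facet T" if "T' \<in> \<U> - {T}" for T'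
    proof
      assume "facet T' = facet T"
      then have "insert v (r T') = insert v (r T)"
        using that sub \<T>0D(14) T0 unfolding facet_def by (subst (asm) complement_eq_iff) auto
      moreover have "v \<notin> r T'" using \<T>0D(10)[OF subsetD[OF sub, of T']] that by blast
      ultimately have "r T' = r T" using D(10) by (simp add: insert_ident)
      then show False using that sub T0 r_inj by blast
    qed
    show ?thesis
    proof (rule Set.set_eqI)
      fix S
      show "S \<in> L \<U> - {ridge T, facet T} \<longleftrightarrow> S \<in> L (\<U> - {T})"
        using rf rr ff ridge_not_M[OF T0] facet_not_M[OF T0] T by (auto simp: L_def) metis+
    qed
  qed
  have "top_of_set (realization_set (L \<U>)) homotopy_equivalent_space
      top_of_set (realization_set (L \<U> - {ridge T, insert u (ridge T)}))"
  proof (rule collapse_homotopy_equivalent[OF K])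
    show "u \<notin> ridge T" using u1 by (simp add: ridge_def)
    have "card (ridge T) = card V - 5" using D finV by (simp add: ridge_def card_Diff_subset)
    then show "ridge T \<noteq> {}" using cardV by auto
    show "insert u (ridge T) \<in> L \<U>" using T F by (auto simp: L_def)
    fix S assume S: "S \<in> L \<U>" "ridge T \<subseteq> S"
    consider "S \<in> M" | T' where "T' \<in> \<U>" "S = ridge T'" | T' where "T' \<in> \<U>" "S = facet T'"
      using S by (auto simp: L_def)
    then show "S = ridge T \<or> S = insert u (ridge T)"
    proof cases
      case 1
      then show ?thesis using M_mono[OF 1 S(2)] ridge_not_M[OF T0] by blast
    next
      case 2
      note D' = \<T>0D[OF subsetD[OF sub 2(1)]]
      have "T' \<subseteq> T" using S(2) 2(2) D'(2,3) unfolding ridge_def by blast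
      then have "r T' \<subseteq> T" using D'(6) by blast
      then show ?thesis using not_sub 2 by blast
    next
      case 3
      note D' = \<T>0D[OF subsetD[OF sub 3(1)]]
      have "r T' \<subseteq> T" using S(2) 3(2) D'(10,14) unfolding ridge_def facet_def by blast
      then show ?thesis using not_sub 3 F by blast
    qed
  qed
  then have "top_of_set (realization_set (L \<U>)) homotopy_equivalent_space top_of_set (realization_set (L (\<U> - {T})))"
    using eq F by simp
  moreover have "contractible_space (top_of_set (realization_set (L (\<U> - {T}))))"
  proof (rule Suc.hyps(1))
    show "n = card (\<U> - {T})" using Suc.hyps(2) T Suc.prems(1) by simp
    show "closed_family (\<U> - {T})" using sub up not_sub by (auto simp: closed_family_def)
  qed (use Suc.prems in auto)
  ultimately show ?case using homotopy_equivalent_space_contractibility by blast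
qed

lemma finite_\<T>: "finite \<T>"
  by (rule finite_subset[of _ "Pow V"]) (use \<T> finV in auto)

text \<open>A face outside \<open>M\<close> has \<open>v\<close> in its complement, which then has
  four or five elements. With four, the face is in \<open>B\<close> or is the facet of some
  \<open>T\<close>; with five it is a ridge.\<close>

lemma \<Delta>_Diff_B: "\<Delta> - B = L \<T>0"
proof (intro subset_antisym subsetI)
  fix S assume S: "S \<in> \<Delta> - B"
  then have SV: "S \<subseteq> V" and bad: "bad (V - S)" by (auto simp: \<Delta>_def)
  show "S \<in> L \<T>0"
  proof (cases "bad (V - S - {v})")
    case True then show ?thesis using SV by (simp add: L_def M_def)
  next
    case nb: False
    obtain D where D: "D \<subseteq> V - S" "card D = 4" "D \<notin> \<T>" using bad by (auto simp: bad_def)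
    have vD: "v \<in> D" using nb D by (auto simp: bad_def)
    then have vS: "v \<in> V - S" using D by blast
    have "\<not> 5 \<le> card (V - S - {v})" using nb bad_card_ge5[of "V - S - {v}"] by blast
    moreover have "card (V - S) = Suc (card (V - S - {v}))" using vS finV by (intro card.remove) auto
    moreover have "card D \<le> card (V - S)" using D finV by (intro card_mono) auto
    ultimately consider "card (V - S) = 4" | "card (V - S - {v}) = 4" using D by linarith
    then show ?thesis
    proof cases
      case 1
      then have "D = V - S" using D finV by (metis card_subset_eq finite_Diff)
      then have S': "S = V - D" "D \<subseteq> V" using SV by auto
      have "D \<in> (\<lambda>T. insert v (r T)) ` \<T>0"
      proof (rule ccontr)
        assume "D \<notin> (\<lambda>T. insert v (r T)) ` \<T>0"
        then have "S \<in> B" using S' D vD by (auto simp: B_def)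
        then show False using S by blast
      qed
      then show ?thesis using S' by (auto simp: L_def facet_def)
    next
      case 2
      then have "V - S - {v} \<in> \<T>0" using nb bad_card4[of "V - S - {v}"] by (auto simp: \<T>0_def)
      moreover have "S = ridge (V - S - {v})" using SV vS by (auto simp: ridge_def)
      ultimately show ?thesis by (auto simp: L_def)
    qed
  qed
next
  fix S assume S: "S \<in> L \<T>0"
  have not_B: "S \<notin> B" if "S \<in> M"
  proof
    assume "S \<in> B"
    then obtain D where D: "D \<subseteq> V" "card D = 4" "v \<in> D" "S = V - D" by (auto simp: B_def)
    have fD: "finite D" using D finV finite_subset by blast
    have "V - S - {v} = D - {v}" using D by auto
    moreover have "card (D - {v}) = 3" using D fD by simp
    ultimately show False using that bad_card4[of "D - {v}"] D by (auto simp: M_def)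
  qed
  consider "S \<in> M" | T where "T \<in> \<T>0" "S = ridge T" | T where "T \<in> \<T>0" "S = facet T"
    using S by (auto simp: L_def)
  then show "S \<in> \<Delta> - B"
  proof cases
    case 1
    then show ?thesis using not_B bad_mono[of "V - S - {v}" "V - S"] by (auto simp: M_def \<Delta>_def)
  next
    case 2
    note D = \<T>0D[OF 2(1)]
    have VS: "V - S = insert v T" using D 2 by (auto simp: ridge_def)
    have "bad (insert v T)" unfolding bad_def using D by (intro exI[of _ "insert v (r T)"]) auto
    moreover have "S \<notin> B"
    proof
      assume "S \<in> B"
      then obtain D' where "D' \<subseteq> V" "card D' = 4" "S = V - D'" by (auto simp: B_def)
      then have "insert v T = D'" using VS by blast
      then show False using D \<open>card D' = 4\<close> by simp
    qed
    ultimately show ?thesis using VS 2 by (auto simp: \<Delta>_def ridge_def)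
  next
    case 3
    note D = \<T>0D[OF 3(1)]
    have VS: "V - S = insert v (r T)" using D 3 by (auto simp: facet_def)
    have "bad (insert v (r T))" unfolding bad_def using D by (intro exI[of _ "insert v (r T)"]) auto
    moreover have "S \<notin> B"
    proof
      assume "S \<in> B"
      then obtain D' where "D' \<subseteq> V" "D' \<notin> (\<lambda>T. insert v (r T)) ` \<T>0" "S = V - D'" by (auto simp: B_def)
      then have "insert v (r T) = D'" using VS by blast
      then show False using 3 \<open>D' \<notin> (\<lambda>T. insert v (r T)) ` \<T>0\<close> by blast
    qed
    ultimately show ?thesis using VS 3 by (auto simp: \<Delta>_def facet_def)
  qed
qed

section \<open>The remaining facets and their number\<close>

lemma complex_on_\<Delta>: "complex_on V \<Delta>"
  unfolding complex_on_def using finV bad_mono by (auto simp: \<Delta>_def) (meson Diff_mono bad_mono order_refl)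

lemma B_subset: "B \<subseteq> \<Delta>"
proof
  fix S assume "S \<in> B"
  then obtain D where D: "D \<subseteq> V" "card D = 4" "D \<notin> \<T>" "S = V - D" by (auto simp: B_def)
  then have "V - S = D" by auto
  then show "S \<in> \<Delta>" using D by (auto simp: \<Delta>_def bad_def)
qed

lemma finite_B: "finite B"
  using finV by (simp add: B_def)

lemma card_in_B: "S \<in> B \<Longrightarrow> card S = card V - 4"
  using finV by (auto simp: B_def card_Diff_subset finite_subset)

lemma B_maximal:
  assumes "\<sigma> \<in> B" "S \<in> \<Delta>" "\<sigma> \<subseteq> S" shows "S = \<sigma>"
proof -
  obtain D where D: "D \<subseteq> V" "card D = 4" "\<sigma> = V - D" using assms(1) by (auto simp: B_def)
  obtain E where E: "E \<subseteq> V - S" "card E = 4" "S \<subseteq> V" using assms(2) by (auto simp: \<Delta>_def bad_def)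
  have "V - S \<subseteq> D" using assms(3) D by auto
  then have "E = D" using E D finV by (metis card_subset_eq finite_subset order_trans)
  then show ?thesis using E D assms(3) by blast
qed

lemma Diff_B_contractible: "contractible_space (top_of_set (realization_set (\<Delta> - B)))"
  unfolding \<Delta>_Diff_B
  by (rule L_contractible) (use finite_\<T> in \<open>auto simp: \<T>0_def closed_family_def\<close>)

lemma Diff_B_nonempty: "realization_set (\<Delta> - B) \<noteq> {}"
proof -
  have "card (V - {v} - {v}) \<ge> 5" using cardV vV finV by simp
  then have "{v} \<in> M" using vV bad_card_ge5[of "V - {v} - {v}"] by (auto simp: M_def)
  then have "{v} \<in> \<Delta> - B" unfolding \<Delta>_Diff_B by (simp add: L_def)
  moreover have "{w. (if w = v then 1 else (0::real)) \<noteq> 0} = {v}" by auto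
  ultimately have "(\<lambda>w. if w = v then 1 else 0) \<in> realization_set (\<Delta> - B)" by (simp add: realization_set_def)
  then show ?thesis by blast
qed

text \<open>\<open>B\<close> corresponds to the 4-sets through \<open>v\<close> that are neither in
  \<open>\<T>\<close> nor of the form \<open>insert v (r T)\<close>. The two exceptional families
  are disjoint, and together they number \<open>card \<T>\<close> because \<open>r\<close> is
  injective on \<open>\<T>0\<close>.\<close>

lemma card_B: "card B + card \<T> = (card V - 1) choose 3"
proof -
  let ?A = "{D. D \<subseteq> V \<and> card D = 4 \<and> v \<in> D}" and ?T1 = "{T \<in> \<T>. v \<in> T}"
    and ?R = "(\<lambda>T. insert v (r T)) ` \<T>0"
  have finA: "finite ?A" using finV by simp
  have "bij_betw (insert v) {P. P \<subseteq> V - {v} \<and> card P = 3} ?A"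
  proof (rule bij_betwI[of _ _ _ "\<lambda>D. D - {v}"])
    show "insert v \<in> {P. P \<subseteq> V - {v} \<and> card P = 3} \<rightarrow> ?A"
    proof
      fix P assume "P \<in> {P. P \<subseteq> V - {v} \<and> card P = 3}"
      moreover from this have "finite P" using finV finite_subset by (metis finite_Diff mem_Collect_eq)
      ultimately show "insert v P \<in> ?A" using vV by (auto simp: card_insert_if)
    qed
    show "(\<lambda>D. D - {v}) \<in> ?A \<rightarrow> {P. P \<subseteq> V - {v} \<and> card P = 3}"
      using finV finite_subset by (fastforce simp: card_Diff_singleton)
  qed auto
  then have cA: "card ?A = (card V - 1) choose 3"
    using n_subsets[of "V - {v}" 3] finV vV by (simp add: bij_betw_same_card[symmetric])
  have "B = (\<lambda>D. V - D) ` (?A - (?T1 \<union> ?R))" unfolding B_def by (rule arg_cong[of _ _ "image (\<lambda>D. V - D)"]) auto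
  moreover have "inj_on (\<lambda>D. V - D) (?A - (?T1 \<union> ?R))" by (rule inj_onI) blast
  ultimately have "card B = card (?A - (?T1 \<union> ?R))" by (simp add: card_image)
  also have sub: "?T1 \<union> ?R \<subseteq> ?A" using \<T> \<T>0D(12,14) by auto
  then have "card (?A - (?T1 \<union> ?R)) = card ?A - card (?T1 \<union> ?R)"
    using finA by (intro card_Diff_subset) (auto intro: finite_subset)
  finally have "card B + card (?T1 \<union> ?R) = card ?A" using card_mono[OF finA sub] by simp
  also have "card (?T1 \<union> ?R) = card ?T1 + card ?R"
    using finite_\<T> \<T>0D(8) by (intro card_Un_disjoint) (auto simp: \<T>0_def)
  also have "card ?R = card \<T>0"
  proof (rule card_image, rule inj_onI)
    fix T T' assume T: "T \<in> \<T>0" "T' \<in> \<T>0" "insert v (r T) = insert v (r T')"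
    then have "r T = r T'" using \<T>0D(10)[OF T(1)] \<T>0D(10)[OF T(2)] by (simp add: insert_ident)
    then show "T = T'" using r_inj T by blast
  qed
  also have "card ?T1 + card \<T>0 = card \<T>"
  proof -
    have "?T1 \<union> \<T>0 = \<T>" by (auto simp: \<T>0_def)
    moreover have "card (?T1 \<union> \<T>0) = card ?T1 + card \<T>0"
      using finite_\<T> by (intro card_Un_disjoint) (auto simp: \<T>0_def)
    ultimately show ?thesis by simp
  qed
  finally show ?thesis using cA by simp
qed

end

section \<open>The cut complex of the grid\<close>

text \<open>Integer coordinates let shapes be translated and subtracted freely, while the vertices
  of the grid are natural numbers.\<close>

definition cell_of :: "nat \<times> nat \<Rightarrow> cell" where
  "cell_of = (\<lambda>(i, j). (int i, int j))"

lemma inj_cell_of: "inj cell_of"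
  by (auto simp: cell_of_def intro!: injI)

abbreviation grid_cells :: "nat \<Rightarrow> nat \<Rightarrow> (nat \<times> nat) set" where
  "grid_cells m n \<equiv> {1..m} \<times> {1..n}"

lemma cell_of_image: "cell_of ` grid_cells m n = cell_box m n"
proof
  show "cell_box m n \<subseteq> cell_of ` grid_cells m n"
  proof
    fix p assume "p \<in> cell_box m n"
    then have "p = cell_of (nat (fst p), nat (snd p))" "(nat (fst p), nat (snd p)) \<in> grid_cells m n"
      by (auto simp: cell_box_def cell_of_def)
    then show "p \<in> cell_of ` grid_cells m n" by blast
  qed
qed (auto simp: cell_of_def cell_box_def)

lemma pverts_grid_graph: "pverts (grid_graph m n) = grid_cells m n"
  by (simp add: grid_graph_def Let_def)

lemma parcs_grid_graph_iff:
  assumes "a \<in> grid_cells m n" "b \<in> grid_cells m n"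
  shows "cell_adj (cell_of a) (cell_of b) \<longleftrightarrow> (a, b) \<in> parcs (grid_graph m n)"
proof -
  obtain i j k l where ab: "a = (i, j)" "b = (k, l)" by (cases a, cases b)
  have "cell_adj (cell_of a) (cell_of b) \<longleftrightarrow>
      (k = i + 1 \<and> l = j) \<or> (i = k + 1 \<and> l = j) \<or> (k = i \<and> l = j + 1) \<or> (k = i \<and> j = l + 1)"
    unfolding ab cell_adj_def cell_steps_def cell_of_def by (simp add: zero_prod_def) linarith
  also have "\<dots> \<longleftrightarrow> (a, b) \<in> parcs (grid_graph m n)"
    using assms unfolding ab grid_graph_def Let_def by (simp add: converse_iff) blast
  finally show ?thesis .
qed

definition grid_tetrominoes :: "nat \<Rightarrow> nat \<Rightarrow> (nat \<times> nat) set set" where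
  "grid_tetrominoes m n = {T. T \<subseteq> grid_cells m n \<and> cell_of ` T \<in> box_tetrominoes m n}"

lemma grid_tetrominoes_iff:
  assumes "T \<subseteq> grid_cells m n"
  shows "T \<in> grid_tetrominoes m n \<longleftrightarrow> card T = 4 \<and> set_connected (\<lambda>a b. (a, b) \<in> parcs (grid_graph m n)) T"
proof -
  have "set_connected cell_adj (cell_of ` T) \<longleftrightarrow> set_connected (\<lambda>a b. (a, b) \<in> parcs (grid_graph m n)) T"
    by (rule set_connected_image[OF inj_on_subset[OF inj_cell_of]])
      (use assms parcs_grid_graph_iff in blast)+
  moreover have "cell_of ` T \<subseteq> cell_box m n" using assms cell_of_image by blast
  moreover have "card (cell_of ` T) = card T" by (rule card_image[OF inj_on_subset[OF inj_cell_of]]) simp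
  ultimately show ?thesis using assms by (auto simp: grid_tetrominoes_def box_tetrominoes_def)
qed

lemma card_grid_tetrominoes: "card (grid_tetrominoes m n) = card (box_tetrominoes m n)"
proof -
  have "box_tetrominoes m n = (`) cell_of ` grid_tetrominoes m n"
  proof
    show "box_tetrominoes m n \<subseteq> (`) cell_of ` grid_tetrominoes m n"
    proof
      fix T assume T: "T \<in> box_tetrominoes m n"
      then have "T \<subseteq> cell_of ` grid_cells m n" unfolding cell_of_image by (simp add: box_tetrominoes_def)
      then obtain S where "S \<subseteq> grid_cells m n" "T = cell_of ` S" by (meson subset_imageE)
      then show "T \<in> (`) cell_of ` grid_tetrominoes m n" using T by (auto simp: grid_tetrominoes_def)
    qed
  qed (auto simp: grid_tetrominoes_def)
  moreover have "inj_on ((`) cell_of) (grid_tetrominoes m n)"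
    using inj_cell_of by (meson inj_image_eq_iff inj_onI)
  ultimately show ?thesis by (simp add: card_image)
qed

definition grid_trimmed :: "(nat \<times> nat) set \<Rightarrow> (nat \<times> nat) set" where
  "grid_trimmed T = {x \<in> T. cell_of x \<in> trimmed (cell_of ` T)}"

lemma box_tetrominoesD:
  "T \<in> box_tetrominoes m n \<Longrightarrow> T \<subseteq> cell_box m n \<and> set_connected cell_adj T \<and> card T = 4"
  by (simp add: box_tetrominoes_def)

lemma grid_trimmed_image:
  assumes "T \<in> grid_tetrominoes m n"
  shows "cell_of ` grid_trimmed T = trimmed (cell_of ` T)"
  using trimmed_subset(1)[of "cell_of ` T"] box_tetrominoesD[of "cell_of ` T" m n] assms
  by (auto simp: grid_trimmed_def grid_tetrominoes_def)

lemma card_cell_of_image: "card (cell_of ` T) = card T"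
  by (rule card_image[OF inj_on_subset[OF inj_cell_of]]) simp

lemma four_set_complex_grid:
  assumes "2 \<le> m" "m \<le> n" "3 \<le> n"
  shows "four_set_complex (grid_cells m n) (1, 1) (grid_tetrominoes m n) grid_trimmed
    (\<lambda>T. tetromino_rank (cell_of ` T))"
proof
  show "finite (grid_cells m n)" by simp
  show "(1, 1) \<in> grid_cells m n" using assms by simp
  have "2 * 3 \<le> m * n" using assms by (intro mult_le_mono) auto
  then show "6 \<le> card (grid_cells m n)" by simp
  show "T \<subseteq> grid_cells m n \<and> card T = 4" if "T \<in> grid_tetrominoes m n" for T
    using that box_tetrominoesD[of "cell_of ` T" m n] by (simp add: grid_tetrominoes_def card_cell_of_image)
  show "grid_trimmed T \<subseteq> T \<and> card (grid_trimmed T) = 3" if "T \<in> grid_tetrominoes m n" for T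
    using trimmed_subset(2)[of "cell_of ` T"] grid_trimmed_image[OF that] box_tetrominoesD[of "cell_of ` T" m n] that
    by (auto simp: grid_tetrominoes_def grid_trimmed_def simp flip: card_cell_of_image)
  show "insert (1, 1) (grid_trimmed T) \<notin> grid_tetrominoes m n"
    if T: "T \<in> grid_tetrominoes m n" "(1, 1) \<notin> T" for T
  proof
    assume "insert (1, 1) (grid_trimmed T) \<in> grid_tetrominoes m n"
    then have "insert (1, 1) (trimmed (cell_of ` T)) \<in> box_tetrominoes m n"
      using grid_trimmed_image[OF T(1)] by (simp add: grid_tetrominoes_def cell_of_def)
    moreover have "(1, 1) \<notin> cell_of ` T" using T(2) by (auto simp: cell_of_def)
    moreover have b: "cell_of ` T \<in> box_tetrominoes m n" using T by (simp add: grid_tetrominoes_def)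
    \<comment> \<open>If the corner completed the trimmed set, \<open>T\<close> would need a cell
      with a coordinate below 1.\<close>
    ultimately have "\<exists>p\<in>cell_of ` T. fst p < fst (1, 1 :: int) \<or> (\<exists>p'\<in>cell_of ` T. snd p' < snd (1 :: int, 1))"
      using box_tetrominoesD by (intro trimmed_completion(2)) blast+
    moreover have "1 \<le> fst p \<and> 1 \<le> snd p" if "p \<in> cell_of ` T" for p
      using box_tetrominoesD[OF b] that by (auto simp: cell_box_def)
    ultimately show False by fastforce
  qed
  show "tetromino_rank (cell_of ` T') < tetromino_rank (cell_of ` T)"
    if T: "T \<in> grid_tetrominoes m n" "T' \<in> grid_tetrominoes m n" "T \<noteq> T'" "grid_trimmed T' \<subseteq> T" for T T'
  proof -
    have b: "cell_of ` T \<in> box_tetrominoes m n" "cell_of ` T' \<in> box_tetrominoes m n"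
      using T by (simp_all add: grid_tetrominoes_def)
    note D = box_tetrominoesD[OF b(1)] and D' = box_tetrominoesD[OF b(2)]
    have sub: "trimmed (cell_of ` T') \<subseteq> cell_of ` T" using grid_trimmed_image[OF T(2)] T(4) by blast
    have c3: "card (trimmed (cell_of ` T')) = 3" using trimmed_subset(2) D' by blast
    then have "finite (trimmed (cell_of ` T'))" by (metis card.infinite zero_neq_numeral)
    then have "card (cell_of ` T - trimmed (cell_of ` T')) = 1"
      using D c3 sub by (simp add: card_Diff_subset)
    then obtain x where "cell_of ` T - trimmed (cell_of ` T') = {x}" by (rule card_1_singletonE)
    then have x: "cell_of ` T = insert x (trimmed (cell_of ` T'))" using sub by blast
    have "cell_of ` T \<noteq> cell_of ` T'" using T(3) inj_cell_of by (simp add: inj_image_eq_iff)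
    then show ?thesis unfolding x using D D' by (intro trimmed_completion(1)) (simp_all flip: x)
  qed
qed

text \<open>Passing to complements turns cut facets into 4-sets that are not tetrominoes; the
  right-hand side is \<open>\<Delta>\<close> of the abstract setting with \<open>bad\<close>
  unfolded.\<close>

lemma cut_complex_grid:
  "cut_complex 4 (with_proj (grid_graph m n)) =
    {S. S \<subseteq> grid_cells m n \<and> (\<exists>D\<subseteq>grid_cells m n - S. card D = 4 \<and> D \<notin> grid_tetrominoes m n)}"
proof -
  let ?V = "grid_cells m n" and ?G = "with_proj (grid_graph m n)"
  have conn: "Digraph_Component.connected (induce_subgraph ?G D) \<longleftrightarrow> D \<in> grid_tetrominoes m n"
    if "D \<subseteq> ?V" "card D = 4" for D
  proof -
    have "D \<noteq> {}" using that by auto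
    then show ?thesis
      using connected_induce_subgraph_iff[OF pair_graph_grid_graph, of D m n] grid_tetrominoes_iff[OF that(1)] that
      by (simp add: pverts_grid_graph)
  qed
  have facets: "cut_facets 4 ?G = (\<lambda>D. ?V - D) ` {D. D \<subseteq> ?V \<and> card D = 4 \<and> D \<notin> grid_tetrominoes m n}"
  proof (intro subset_antisym subsetI)
    fix F assume "F \<in> cut_facets 4 ?G"
    then have F: "F \<subseteq> ?V" "card F + 4 = card ?V" "\<not> Digraph_Component.connected (induce_subgraph ?G (?V - F))"
      by (auto simp: cut_facets_def pverts_grid_graph simp del: card_cartesian_product)
    have "card (?V - F) = card ?V - card F" using F(1) by (intro card_Diff_subset) (auto intro: finite_subset)
    then have "card (?V - F) = 4" using F(2) by simp
    moreover have "F = ?V - (?V - F)" using F(1) by blast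
    ultimately show "F \<in> (\<lambda>D. ?V - D) ` {D. D \<subseteq> ?V \<and> card D = 4 \<and> D \<notin> grid_tetrominoes m n}"
      using conn[of "?V - F"] F(3) by (intro image_eqI[of _ _ "?V - F"]) auto
  next
    fix F assume "F \<in> (\<lambda>D. ?V - D) ` {D. D \<subseteq> ?V \<and> card D = 4 \<and> D \<notin> grid_tetrominoes m n}"
    then obtain D where D: "D \<subseteq> ?V" "card D = 4" "D \<notin> grid_tetrominoes m n" "F = ?V - D" by blast
    have "card (?V - D) = card ?V - card D" using D(1) by (intro card_Diff_subset) (auto intro: finite_subset)
    moreover have "card D \<le> card ?V" using D(1) by (intro card_mono) auto
    moreover have "?V - F = D" using D by blast
    ultimately show "F \<in> cut_facets 4 ?G"
      using conn[OF D(1,2)] D by (simp add: cut_facets_def pverts_grid_graph del: card_cartesian_product)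
  qed
  have "S \<in> cut_complex 4 ?G \<longleftrightarrow> S \<subseteq> ?V \<and> (\<exists>D\<subseteq>?V - S. card D = 4 \<and> D \<notin> grid_tetrominoes m n)" for S
  proof
    assume "S \<in> cut_complex 4 ?G"
    then obtain D where "S \<subseteq> ?V - D" "D \<subseteq> ?V" "card D = 4" "D \<notin> grid_tetrominoes m n"
      unfolding cut_complex_def facets by blast
    moreover from this have "D \<subseteq> ?V - S" by blast
    ultimately show "S \<subseteq> ?V \<and> (\<exists>D\<subseteq>?V - S. card D = 4 \<and> D \<notin> grid_tetrominoes m n)" by blast
  next
    assume "S \<subseteq> ?V \<and> (\<exists>D\<subseteq>?V - S. card D = 4 \<and> D \<notin> grid_tetrominoes m n)"
    then obtain D where "S \<subseteq> ?V - D" "D \<subseteq> ?V" "card D = 4" "D \<notin> grid_tetrominoes m n" by blast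
    then show "S \<in> cut_complex 4 ?G" unfolding cut_complex_def facets by blast
  qed
  then show ?thesis by blast
qed

theorem theorem5p14:
  fixes m n :: nat
  assumes "2 \<le> m" and "m \<le> n" and "3 \<le> n"
  shows "\<exists>b :: nat.
    int b = int ((m * n - 1) choose 3) -
      (if m = 2 then 11 * int n - 23
       else 19 * int m * int n - 28 * (int m + int n) + 33) \<and>
    geometric_realization (cut_complex 4 (with_proj (grid_graph m n)))
      homotopy_equivalent_space wedge_of_spheres b (m * n - 5) \<and>
    (\<forall>p :: int. p \<noteq> int (m * n) - 5 \<longrightarrow>
      trivial_group (reduced_homology_group p
        (geometric_realization (cut_complex 4 (with_proj (grid_graph m n)))))) \<and>
    reduced_betti_number (int (m * n) - 5)
      (geometric_realization (cut_complex 4 (with_proj (grid_graph m n)))) = enat b"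
proof -
  interpret X: four_set_complex "grid_cells m n" "(1, 1)" "grid_tetrominoes m n" grid_trimmed
    "\<lambda>T. tetromino_rank (cell_of ` T)"
    by (rule four_set_complex_grid[OF assms])
  have "2 * 3 \<le> m * n" using assms by (intro mult_le_mono) auto
  then have N: "6 \<le> m * n" by simp
  have X: "geometric_realization (cut_complex 4 (with_proj (grid_graph m n))) = top_of_set (realization_set X.\<Delta>)"
    unfolding geometric_realization_eq cut_complex_grid X.\<Delta>_def X.bad_def by simp
  \<comment> \<open>Facets have \<open>m * n - 4\<close> vertices, hence dimension
    \<open>m * n - 5\<close>, which is positive because \<open>6 \<le> m * n\<close>.\<close>
  have card: "card \<sigma> = Suc (m * n - 5)" if "\<sigma> \<in> X.B" for \<sigma> using X.card_in_B[OF that] N by simp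
  have count: "card X.B + card (box_tetrominoes m n) = (m * n - 1) choose 3"
    using X.card_B by (simp add: card_grid_tetrominoes)
  have hom: "(\<forall>p. p \<noteq> int (m * n - 5) \<longrightarrow> trivial_group (reduced_homology_group p (top_of_set (realization_set X.\<Delta>)))) \<and>
    has_rank (reduced_homology_group (int (m * n - 5)) (top_of_set (realization_set X.\<Delta>))) (card X.B)"
    by (rule reduced_homology_maximal_faces[OF X.finite_B X.complex_on_\<Delta> X.B_subset card X.B_maximal
          X.Diff_B_contractible X.Diff_B_nonempty])
  have d: "int (m * n - 5) = int (m * n) - 5" using N by simp
  show ?thesis
  proof (intro exI[of _ "card X.B"] conjI)
    show "int (card X.B) = int ((m * n - 1) choose 3) -
      (if m = 2 then 11 * int n - 23 else 19 * int m * int n - 28 * (int m + int n) + 33)"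
      using count card_box_tetrominoes_formula[OF assms] by linarith
    show "geometric_realization (cut_complex 4 (with_proj (grid_graph m n)))
        homotopy_equivalent_space wedge_of_spheres (card X.B) (m * n - 5)"
      unfolding X
      by (rule maximal_faces_wedge_of_spheres[OF X.complex_on_\<Delta> X.B_subset refl card _ X.B_maximal
          X.Diff_B_contractible X.Diff_B_nonempty]) (use N in auto)
    show "\<forall>p :: int. p \<noteq> int (m * n) - 5 \<longrightarrow>
      trivial_group (reduced_homology_group p
        (geometric_realization (cut_complex 4 (with_proj (grid_graph m n)))))"
      using conjunct1[OF hom] unfolding X d .
    show "reduced_betti_number (int (m * n) - 5)
      (geometric_realization (cut_complex 4 (with_proj (grid_graph m n)))) = enat (card X.B)"
      using abelian_rank_eqI[OF conjunct2[OF hom]] unfolding X d reduced_betti_number_def .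
  qed
qed

end
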